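(* Let $R,Y$ be free, self-adjoint, positive, non-zero random variables in a $W^*$-probability space $(\mathcal A,\varphi)$, let $U=R^{1/2}YR^{1/2}$, and let $g_1(R),g_2(R)$ be two elements of the unital subalgebra generated by $R$. Let $$k(z,w)=\varphi\big(g_1(R)(I-zU)^{-1}g_2(R)(I-wU)^{-1}\big).$$ Then for $z,w$ in some neighborhood of $0$ in $\mathbb C$, $$k(z,w)=k_1(z,w)+k_2(z,w),$$ where $$k_1(z,w)=\varphi\big(g_1(R)g_2(R)(I-\omega_2(z)R)^{-1}(I-\omega_2(w)R)^{-1}\big),$$ $$k_2(z,w)=\frac{\big(w\omega_2(z)-z\omega_2(w)\big)\big(\omega_2(z)-\omega_2(w)\big)}{\big(M_U(z)-M_U(w)\big)(z-w)}A_1(z,w)A_2(z,w)=\frac{w\omega_2(z)-z\omega_2(w)}{z-w}\,\frac{A_1(z,w)A_2(z,w)}{B(z,w)},$$ and $$A_j(z,w)=\varphi\big(Rg_j(R)(I-\omega_2(z)R)^{-1}(I-\omega_2(w)R)^{-1}\big),\quad j=1,2,$$ $$B(z,w)=\varphi\big(R(I-\omega_2(z)R)^{-1}(I-\omega_2(w)R)^{-1}\big)=\frac{M_U(z)-M_U(w)}{\omega_2(z)-\omega_2(w)}.$$ (The quotients are understood at $z=w$ by continuous extension.)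
   Context: A $W^*$-probability space $(\mathcal A,\varphi)$ is a finite von Neumann algebra with unit $I$ and a faithful normal tracial state $\varphi$. Freeness is in the sense of Voiculescu. The moment transform of $Z$ is $M_Z(z)=\varphi(zZ(I-zZ)^{-1})$, defined whenever $I-zZ$ is invertible. Subordination functions: $\omega_1,\omega_2:\mathbb C\setminus[0,\infty)\to\mathbb C$ are the unique holomorphic functions satisfying $\omega_k(\bar z)=\overline{\omega_k(z)}$, $\arg\omega_k(z)\ge\arg z$ for $z\in\mathbb C^+$, and $M_U(z)=M_Y(\omega_1(z))=M_R(\omega_2(z))$. They extend analytically to a neighborhood of $0$ with $\omega_k(0)=0$, and $\varphi\big((I-zU)^{-1}\mid R\big)=(I-\omega_2(z)R)^{-1}$, where $\varphi(\cdot\mid R)$ is the conditional expectation onto the von Neumann subalgebra generated by $R$. *)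

theory Defs
  imports "HOL-Complex_Analysis.Complex_Analysis"
begin

section \<open>Complex Hilbert spaces and bounded operators\<close>

class scaleC =
  fixes scaleC :: "complex \<Rightarrow> 'a \<Rightarrow> 'a"  (infixr \<open>*\<^sub>C\<close> 75)

text \<open>The inner product is conjugate-linear in the first and linear in the second argument.\<close>

class complex_hilbert = banach + scaleC +
  fixes cinner :: "'a \<Rightarrow> 'a \<Rightarrow> complex"
  assumes scaleC_add_right: "c *\<^sub>C (x + y) = c *\<^sub>C x + c *\<^sub>C y"
    and scaleC_add_left: "(c + d) *\<^sub>C x = c *\<^sub>C x + d *\<^sub>C x"
    and scaleC_scaleC: "c *\<^sub>C d *\<^sub>C x = (c * d) *\<^sub>C x"
    and scaleR_scaleC: "r *\<^sub>R x = complex_of_real r *\<^sub>C x"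
    and cinner_commute: "cinner x y = cnj (cinner y x)"
    and cinner_add_right: "cinner x (y + z) = cinner x y + cinner x z"
    and cinner_scaleC_right: "cinner x (c *\<^sub>C y) = c * cinner x y"
    and cinner_self_nonneg: "0 \<le> Re (cinner x x)"
    and cinner_self_eq_0: "cinner x x = 0 \<longleftrightarrow> x = 0"
    and norm_eq_sqrt_cinner: "norm x = sqrt (Re (cinner x x))"

lemma norm_scaleC: "norm (c *\<^sub>C x) = cmod c * norm (x :: 'a::complex_hilbert)"
proof -
  have "cinner (c *\<^sub>C x) (c *\<^sub>C x) = c * cnj (c * cinner x x)"
    by (metis cinner_commute cinner_scaleC_right)
  also have "\<dots> = (c * cnj c) * cinner x x"
    using cinner_commute [of x x] by simp
  also have "\<dots> = complex_of_real ((cmod c)\<^sup>2) * cinner x x"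
    by (simp only: complex_norm_square)
  finally have "Re (cinner (c *\<^sub>C x) (c *\<^sub>C x)) = (cmod c)\<^sup>2 * Re (cinner x x)"
    by simp
  then show ?thesis
    by (simp add: norm_eq_sqrt_cinner real_sqrt_mult)
qed

lemma bounded_linear_scaleC:
  "bounded_linear (\<lambda>x :: 'a::complex_hilbert. c *\<^sub>C x)"
proof (rule bounded_linear_intro [where K = "cmod c"])
  show "c *\<^sub>C (x + y) = c *\<^sub>C x + c *\<^sub>C y" for x y :: 'a
    by (rule scaleC_add_right)
  show "c *\<^sub>C (r *\<^sub>R x) = r *\<^sub>R (c *\<^sub>C x)" for r and x :: 'a
    by (simp add: scaleR_scaleC scaleC_scaleC mult.commute)
  show "norm (c *\<^sub>C x) \<le> norm x * cmod c" for x :: 'a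
    by (simp add: norm_scaleC mult.commute)
qed

instantiation blinfun :: (real_normed_vector, complex_hilbert) scaleC
begin

lift_definition scaleC_blinfun :: "complex \<Rightarrow> 'a \<Rightarrow>\<^sub>L 'b \<Rightarrow> 'a \<Rightarrow>\<^sub>L 'b"
  is "\<lambda>c T x. c *\<^sub>C T x"
  by (rule bounded_linear_compose [OF bounded_linear_scaleC])

instance ..

end

text \<open>\<open>'h \<Rightarrow>\<^sub>L 'h\<close> is the type of real-linear bounded operators;
  \<open>bounded_ops\<close> is the algebra B(H) of complex-linear ones.\<close>

definition bounded_ops :: "('h::complex_hilbert \<Rightarrow>\<^sub>L 'h) set" where
  "bounded_ops = {T. \<forall>c x. blinfun_apply T (c *\<^sub>C x) = c *\<^sub>C blinfun_apply T x}"

definition is_adjoint ::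
    "('h::complex_hilbert \<Rightarrow>\<^sub>L 'h) \<Rightarrow> ('h \<Rightarrow>\<^sub>L 'h) \<Rightarrow> bool" where
  "is_adjoint S T \<longleftrightarrow>
     (\<forall>x y. cinner (blinfun_apply S x) y = cinner x (blinfun_apply T y))"

definition selfadjoint_op :: "('h::complex_hilbert \<Rightarrow>\<^sub>L 'h) \<Rightarrow> bool" where
  "selfadjoint_op T \<longleftrightarrow> T \<in> bounded_ops \<and> is_adjoint T T"

definition positive_op :: "('h::complex_hilbert \<Rightarrow>\<^sub>L 'h) \<Rightarrow> bool" where
  "positive_op T \<longleftrightarrow>
     selfadjoint_op T \<and> (\<forall>x. 0 \<le> Re (cinner x (blinfun_apply T x)))"

definition op_le :: "('h::complex_hilbert \<Rightarrow>\<^sub>L 'h) \<Rightarrow> ('h \<Rightarrow>\<^sub>L 'h) \<Rightarrow> bool" where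
  "op_le S T \<longleftrightarrow> positive_op (T - S)"

definition op_sqrt :: "('h::complex_hilbert \<Rightarrow>\<^sub>L 'h) \<Rightarrow> ('h \<Rightarrow>\<^sub>L 'h)" where
  "op_sqrt T = (THE S. positive_op S \<and> S o\<^sub>L S = T)"

definition op_invertible :: "('h::complex_hilbert \<Rightarrow>\<^sub>L 'h) \<Rightarrow> bool" where
  "op_invertible T \<longleftrightarrow>
     (\<exists>S \<in> bounded_ops. S o\<^sub>L T = id_blinfun \<and> T o\<^sub>L S = id_blinfun)"

definition op_inv :: "('h::complex_hilbert \<Rightarrow>\<^sub>L 'h) \<Rightarrow> ('h \<Rightarrow>\<^sub>L 'h)" where
  "op_inv T =
     (THE S. S \<in> bounded_ops \<and> S o\<^sub>L T = id_blinfun \<and> T o\<^sub>L S = id_blinfun)"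

text \<open>\<open>res T z\<close> is the inverse of \<open>I - zT\<close>.\<close>

definition res :: "('h::complex_hilbert \<Rightarrow>\<^sub>L 'h) \<Rightarrow> complex \<Rightarrow> ('h \<Rightarrow>\<^sub>L 'h)" where
  "res T z = op_inv (id_blinfun - z *\<^sub>C T)"

section \<open>$W^*$-probability spaces\<close>

definition commutant ::
    "('h::complex_hilbert \<Rightarrow>\<^sub>L 'h) set \<Rightarrow> ('h \<Rightarrow>\<^sub>L 'h) set" where
  "commutant \<A> = {T \<in> bounded_ops. \<forall>S \<in> \<A>. T o\<^sub>L S = S o\<^sub>L T}"

definition von_neumann_algebra :: "('h::complex_hilbert \<Rightarrow>\<^sub>L 'h) set \<Rightarrow> bool" where
  "von_neumann_algebra \<A> \<longleftrightarrow>
     \<A> \<subseteq> bounded_ops \<and> (\<forall>T \<in> \<A>. \<exists>S \<in> \<A>. is_adjoint S T) \<and>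
     commutant (commutant \<A>) = \<A>"

text \<open>Every isometry in the algebra is unitary.\<close>

definition finite_von_neumann_algebra ::
    "('h::complex_hilbert \<Rightarrow>\<^sub>L 'h) set \<Rightarrow> bool" where
  "finite_von_neumann_algebra \<A> \<longleftrightarrow>
     von_neumann_algebra \<A> \<and>
     (\<forall>V \<in> \<A>. \<forall>W \<in> \<A>.
        is_adjoint W V \<and> W o\<^sub>L V = id_blinfun \<longrightarrow> V o\<^sub>L W = id_blinfun)"

text \<open>Normality: \<open>\<phi>\<close> preserves suprema of bounded increasing nets of self-adjoint elements,
  stated here for upward directed sets.\<close>

definition normal_on ::
    "('h::complex_hilbert \<Rightarrow>\<^sub>L 'h) set \<Rightarrow> (('h \<Rightarrow>\<^sub>L 'h) \<Rightarrow> complex) \<Rightarrow> bool" where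
  "normal_on \<A> \<phi> \<longleftrightarrow>
     (\<forall>D T. D \<noteq> {} \<and> D \<subseteq> \<A> \<and> T \<in> \<A> \<and> (\<forall>S \<in> D. selfadjoint_op S) \<and>
        (\<forall>S1 \<in> D. \<forall>S2 \<in> D. \<exists>S3 \<in> D. op_le S1 S3 \<and> op_le S2 S3) \<and>
        (\<forall>S \<in> D. op_le S T) \<and>
        (\<forall>T' \<in> \<A>. (\<forall>S \<in> D. op_le S T') \<longrightarrow> op_le T T')
      \<longrightarrow> Re (\<phi> T) = (SUP S \<in> D. Re (\<phi> S)))"

text \<open>\<open>\<phi>\<close> is a total function, but only its values on \<open>\<A>\<close> are constrained.\<close>

locale wstar_probability_space =
  fixes \<A> :: "('h::complex_hilbert \<Rightarrow>\<^sub>L 'h) set"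
    and \<phi> :: "('h \<Rightarrow>\<^sub>L 'h) \<Rightarrow> complex"
  assumes finite_vN: "finite_von_neumann_algebra \<A>"
    and state_add: "\<lbrakk>S \<in> \<A>; T \<in> \<A>\<rbrakk> \<Longrightarrow> \<phi> (S + T) = \<phi> S + \<phi> T"
    and state_scaleC: "T \<in> \<A> \<Longrightarrow> \<phi> (c *\<^sub>C T) = c * \<phi> T"
    and state_pos: "\<lbrakk>T \<in> \<A>; positive_op T\<rbrakk> \<Longrightarrow> Im (\<phi> T) = 0 \<and> 0 \<le> Re (\<phi> T)"
    and state_unit: "\<phi> id_blinfun = 1"
    and tracial: "\<lbrakk>S \<in> \<A>; T \<in> \<A>\<rbrakk> \<Longrightarrow> \<phi> (S o\<^sub>L T) = \<phi> (T o\<^sub>L S)"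
    and faithful: "\<lbrakk>T \<in> \<A>; positive_op T; \<phi> T = 0\<rbrakk> \<Longrightarrow> T = 0"
    and normal: "normal_on \<A> \<phi>"

inductive_set unital_subalgebra ::
    "('h::complex_hilbert \<Rightarrow>\<^sub>L 'h) set \<Rightarrow> ('h \<Rightarrow>\<^sub>L 'h) set"
  for X :: "('h \<Rightarrow>\<^sub>L 'h) set" where
  unit: "id_blinfun \<in> unital_subalgebra X"
| gen: "T \<in> X \<Longrightarrow> T \<in> unital_subalgebra X"
| add: "S \<in> unital_subalgebra X \<Longrightarrow> T \<in> unital_subalgebra X \<Longrightarrow> S + T \<in> unital_subalgebra X"
| scale: "T \<in> unital_subalgebra X \<Longrightarrow> c *\<^sub>C T \<in> unital_subalgebra X"
| mult: "S \<in> unital_subalgebra X \<Longrightarrow> T \<in> unital_subalgebra X \<Longrightarrow> S o\<^sub>L T \<in> unital_subalgebra X"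

text \<open>Voiculescu's freeness of a family of unital subalgebras \<open>B i\<close>, \<open>i \<in> J\<close>.
  A list \<open>[(i1, a1), \<dots>, (in, an)]\<close> encodes the word \<open>a1 \<dots> an\<close> with \<open>aj \<in> B ij\<close>.\<close>

definition free_family ::
    "(('h::complex_hilbert \<Rightarrow>\<^sub>L 'h) \<Rightarrow> complex) \<Rightarrow> 'i set \<Rightarrow> ('i \<Rightarrow> ('h \<Rightarrow>\<^sub>L 'h) set) \<Rightarrow> bool" where
  "free_family \<phi> J B \<longleftrightarrow>
     (\<forall>xs. xs \<noteq> [] \<and> (\<forall>(i, a) \<in> set xs. i \<in> J \<and> a \<in> B i \<and> \<phi> a = 0) \<and>
        (\<forall>j. Suc j < length xs \<longrightarrow> fst (xs ! j) \<noteq> fst (xs ! Suc j))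
      \<longrightarrow> \<phi> (foldr (\<lambda>(i, a) T. a o\<^sub>L T) xs id_blinfun) = 0)"

text \<open>For self-adjoint variables the generated unital subalgebras are *-subalgebras.\<close>

definition free_variables ::
    "(('h::complex_hilbert \<Rightarrow>\<^sub>L 'h) \<Rightarrow> complex) \<Rightarrow> ('h \<Rightarrow>\<^sub>L 'h) \<Rightarrow> ('h \<Rightarrow>\<^sub>L 'h) \<Rightarrow> bool" where
  "free_variables \<phi> X Y \<longleftrightarrow>
     free_family \<phi> UNIV (\<lambda>b::bool. unital_subalgebra {if b then X else Y})"

section \<open>Moment transform and subordination\<close>

text \<open>Meaningful only when \<open>I - zZ\<close> is invertible.\<close>

definition moment_transform ::
    "(('h::complex_hilbert \<Rightarrow>\<^sub>L 'h) \<Rightarrow> complex) \<Rightarrow> ('h \<Rightarrow>\<^sub>L 'h) \<Rightarrow> complex \<Rightarrow> complex" where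
  "moment_transform \<phi> Z z = \<phi> ((z *\<^sub>C Z) o\<^sub>L res Z z)"

definition slit_plane :: "complex set" where
  "slit_plane = - (complex_of_real ` {0..})"

text \<open>The defining properties of the subordination pair. The values of \<open>\<omega>1\<close>, \<open>\<omega>2\<close> on
  \<open>[0,\<infinity>)\<close> are irrelevant. Since \<open>Arg\<close> takes values in \<open>(-\<pi>,\<pi>]\<close> and \<open>Arg 0 = 0\<close>, the condition on
  arguments forces \<open>Arg (\<omega> z) \<in> (0,\<pi>]\<close> for \<open>Im z > 0\<close>. By symmetry and continuity
  at the negative axis, \<open>\<omega>\<close> then never takes a value in \<open>(0,\<infinity>)\<close>, so all moment transforms
  below are evaluated where they are defined when \<open>U\<close>, \<open>Y\<close>, \<open>R\<close> are positive.\<close>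

definition subordination_functions ::
    "(('h::complex_hilbert \<Rightarrow>\<^sub>L 'h) \<Rightarrow> complex) \<Rightarrow> ('h \<Rightarrow>\<^sub>L 'h) \<Rightarrow> ('h \<Rightarrow>\<^sub>L 'h) \<Rightarrow> ('h \<Rightarrow>\<^sub>L 'h) \<Rightarrow>
     (complex \<Rightarrow> complex) \<Rightarrow> (complex \<Rightarrow> complex) \<Rightarrow> bool" where
  "subordination_functions \<phi> U Y R \<omega>1 \<omega>2 \<longleftrightarrow>
     (\<forall>\<omega> \<in> {\<omega>1, \<omega>2}. \<omega> holomorphic_on slit_plane \<and>
        (\<forall>z \<in> slit_plane. \<omega> (cnj z) = cnj (\<omega> z)) \<and>
        (\<forall>z. 0 < Im z \<longrightarrow> Arg z \<le> Arg (\<omega> z))) \<and>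
     (\<forall>z \<in> slit_plane.
        moment_transform \<phi> U z = moment_transform \<phi> Y (\<omega>1 z) \<and>
        moment_transform \<phi> U z = moment_transform \<phi> R (\<omega>2 z))"

text \<open>\<open>F\<close> off the diagonal, and its limit from off the diagonal at a point \<open>(z, z)\<close>.\<close>

definition diagonal_extension ::
    "(complex \<Rightarrow> complex \<Rightarrow> complex) \<Rightarrow> complex \<Rightarrow> complex \<Rightarrow> complex" where
  "diagonal_extension F z w =
     (if z \<noteq> w then F z w
      else Lim (at (z, w) within {p. fst p \<noteq> snd p}) (\<lambda>p. F (fst p) (snd p)))"

end

theory Submission
  imports Defs
begin

text \<open>Write \<open>r\<close>, \<open>y\<close> for the free variables, \<open>\<tau>\<close> for the trace, and let \<open>\<omega>\<^sub>1\<close>, \<open>\<omega>\<^sub>2\<close> be small with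
  \<open>p = (1 - \<omega>\<^sub>2 r)\<^sup>-\<^sup>1\<close> and \<open>q = (1 - \<omega>\<^sub>1 y)\<^sup>-\<^sup>1\<close> of the same trace \<open>1 + m\<close>. If \<open>\<omega>\<^sub>1 \<omega>\<^sub>2 (1 + m) = z m\<close>, then
  \<open>p (1 - z r y) q = (1 + m) - p' q' / m\<close> with \<open>p'\<close>, \<open>q'\<close> the centred parts of \<open>p\<close>, \<open>q\<close>, and the Neumann
  series gives \<open>(1 - z r y)\<^sup>-\<^sup>1 = (1 + c (p - 1) V) p\<close>, where \<open>V\<close> is a sum of alternating products of
  centred elements that start and end in the algebra of \<open>y\<close>. Freeness then evaluates every trace
  \<open>\<tau> (a V) = 0\<close> and \<open>\<tau> (a V b W) = \<tau> a \<tau> b \<tau> (V W)\<close>, which yields the two-point function up to one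
  scalar; this scalar is read off from the resolvent identity in the case \<open>g\<^sub>1 = g\<^sub>2 = 1\<close>. Traciality
  replaces \<open>r y\<close> by \<open>r\<^sup>1\<^sup>/\<^sup>2 y r\<^sup>1\<^sup>/\<^sup>2\<close>, and continuity covers the diagonal and the axes.\<close>

text \<open>\<open>subordination_functions\<close> describes \<open>\<omega>2\<close> on the slit
  plane only, and freeness is assumed for polynomials only, while the formula lives near the origin
  and concerns resolvents. So the proof does not start from the given pair: it builds a local
  function of its own, in normed algebras where every object is a convergent series and freeness
  passes to norm limits because the trace is continuous. This function is matched with
  \<open>\<omega>2\<close> only at the end. The natural parameter is \<open>m\<close>, not
  \<open>z\<close>: it determines both subordination values and through them \<open>z\<close>. The
  product \<open>p' q'\<close> is of order \<open>m\<^sup>2\<close> while it is divided by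
  \<open>m (1 + m)\<close>, which is why the Neumann series converges for small \<open>m\<close>.
  The division excludes \<open>m = 0\<close>, that is \<open>z = 0\<close>, and the resolvent
  identity is empty at \<open>z = w\<close>; this is what continuity has to repair. Conditional
  expectation never occurs as a map. Its role is taken by the rule that elements of the algebra of
  \<open>r\<close> times \<open>V\<close> have trace zero.\<close>

section \<open>Neumann series in complex Banach algebras\<close>

text \<open>\<open>monoid_mult\<close> instead of \<open>real_normed_algebra_1\<close>: the operators on the zero space
  form an algebra with \<open>0 = 1\<close>, and the Hilbert space type may be trivial.\<close>

class complex_banach_algebra = banach + real_normed_algebra + monoid_mult + scaleC +
  assumes smult_add_right: "c *\<^sub>C (x + y) = c *\<^sub>C x + c *\<^sub>C y"
    and smult_add_left: "(c + d) *\<^sub>C x = c *\<^sub>C x + d *\<^sub>C x"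
    and smult_smult [simp]: "c *\<^sub>C d *\<^sub>C x = (c * d) *\<^sub>C x"
    and scaleR_smult: "r *\<^sub>R x = complex_of_real r *\<^sub>C x"
    and mult_smult_left [simp]: "(c *\<^sub>C x) * y = c *\<^sub>C (x * y)"
    and mult_smult_right [simp]: "x * (c *\<^sub>C y) = c *\<^sub>C (x * y)"
    and norm_smult: "norm (c *\<^sub>C x) = cmod c * norm x"
    and norm_one_le: "norm 1 \<le> 1"

lemma smult_one [simp]: "1 *\<^sub>C x = (x :: 'a::complex_banach_algebra)"
  using scaleR_smult[of 1 x, symmetric] by simp

lemma smult_zero_left [simp]: "0 *\<^sub>C x = (0 :: 'a::complex_banach_algebra)"
  using scaleR_smult[of 0 x, symmetric] by simp

lemma smult_zero_right [simp]: "c *\<^sub>C 0 = (0 :: 'a::complex_banach_algebra)"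
  using smult_add_right[of c 0 0] by simp

lemma smult_minus_left [simp]: "(- c) *\<^sub>C (x :: 'a::complex_banach_algebra) = - (c *\<^sub>C x)"
  using smult_add_left[of c "- c" x] by (simp add: eq_neg_iff_add_eq_0 add.commute)

lemma smult_minus_right [simp]: "c *\<^sub>C (- x :: 'a::complex_banach_algebra) = - (c *\<^sub>C x)"
  using smult_add_right[of c x "- x"] by (simp add: eq_neg_iff_add_eq_0 add.commute)

lemma smult_diff_right: "c *\<^sub>C (x - y :: 'a::complex_banach_algebra) = c *\<^sub>C x - c *\<^sub>C y"
  using smult_add_right[of c x "- y"] by simp

lemma smult_diff_left: "(c - d) *\<^sub>C (x :: 'a::complex_banach_algebra) = c *\<^sub>C x - d *\<^sub>C x"
  using smult_add_left[of c "- d" x] by simp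

lemmas smult_distribs = smult_add_right smult_add_left smult_diff_right smult_diff_left

lemma bounded_bilinear_smult:
  "bounded_bilinear (\<lambda>c (x :: 'a::complex_banach_algebra). c *\<^sub>C x)"
proof
  show "(r *\<^sub>R a) *\<^sub>C b = r *\<^sub>R (a *\<^sub>C b)" for r a and b :: 'a
    by (simp add: scaleR_smult scaleR_conv_of_real)
  show "a *\<^sub>C (r *\<^sub>R b) = r *\<^sub>R (a *\<^sub>C b)" for r a and b :: 'a
    by (simp add: scaleR_smult mult.commute)
  show "\<exists>K. \<forall>a (b :: 'a). norm (a *\<^sub>C b) \<le> norm a * norm b * K"
    by (intro exI[of _ 1]) (simp add: norm_smult)
qed (simp_all add: smult_distribs)

lemmas continuous_on_smult [continuous_intros] =
  bounded_bilinear.continuous_on [OF bounded_bilinear_smult]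

lemmas tendsto_smult [tendsto_intros] = bounded_bilinear.tendsto [OF bounded_bilinear_smult]

lemma norm_power_le: "norm (x ^ n) \<le> norm (x :: 'a::complex_banach_algebra) ^ n"
proof (induction n)
  case 0
  show ?case by (simp add: norm_one_le)
next
  case (Suc n)
  have "norm (x ^ Suc n) \<le> norm x * norm (x ^ n)" by (simp add: norm_mult_ineq)
  also have "\<dots> \<le> norm x * norm x ^ n" by (intro mult_left_mono Suc) simp
  finally show ?case by simp
qed

definition neumann :: "'a::complex_banach_algebra \<Rightarrow> 'a" where
  "neumann x = (\<Sum>n. x ^ n)"

lemma neumann_summable:
  fixes x :: "'a::complex_banach_algebra"
  assumes "norm x < 1"
  shows "summable (\<lambda>n. x ^ n)"
proof (rule summable_comparison_test)
  show "\<exists>N. \<forall>n\<ge>N. norm (x ^ n) \<le> norm x ^ n" using norm_power_le by blast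
  show "summable (\<lambda>n. norm x ^ n)" using assms by (simp add: summable_geometric)
qed

lemma
  fixes x :: "'a::complex_banach_algebra"
  assumes "norm x < 1"
  shows neumann_left: "neumann x = 1 + x * neumann x"
    and neumann_right: "neumann x = 1 + neumann x * x"
proof -
  note s = neumann_summable[OF assms]
  have *: "neumann x = 1 + (\<Sum>n. x ^ Suc n)"
    using suminf_split_head[OF s] by (simp add: neumann_def)
  show "neumann x = 1 + x * neumann x"
    using * suminf_mult[OF s, of x] by (simp add: neumann_def)
  show "neumann x = 1 + neumann x * x"
    using * suminf_mult2[OF s, of x] by (simp add: neumann_def power_commutes)
qed

lemma norm_neumann_le:
  fixes x :: "'a::complex_banach_algebra"
  assumes "norm x < 1"
  shows "norm (neumann x) \<le> 1 / (1 - norm x)"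
proof -
  have "norm (neumann x) \<le> (\<Sum>n. norm x ^ n)"
    unfolding neumann_def
    by (rule norm_suminf_le) (use assms norm_power_le in \<open>auto simp: summable_geometric\<close>)
  also have "\<dots> = 1 / (1 - norm x)" using assms by (simp add: suminf_geometric)
  finally show ?thesis .
qed

text \<open>The inverse of \<open>1 - z a\<close> for small \<open>z\<close>.\<close>

definition rs :: "'a::complex_banach_algebra \<Rightarrow> complex \<Rightarrow> 'a" where
  "rs a z = neumann (z *\<^sub>C a)"

lemma
  fixes a :: "'a::complex_banach_algebra"
  assumes "cmod z * norm a < 1"
  shows rs_left: "rs a z = 1 + z *\<^sub>C (a * rs a z)"
    and rs_right: "rs a z = 1 + z *\<^sub>C (rs a z * a)"
    and rs_inverse_left: "(1 - z *\<^sub>C a) * rs a z = 1"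
    and rs_inverse_right: "rs a z * (1 - z *\<^sub>C a) = 1"
proof -
  have n: "norm (z *\<^sub>C a) < 1" using assms by (simp add: norm_smult)
  show l: "rs a z = 1 + z *\<^sub>C (a * rs a z)" using neumann_left[OF n] by (simp add: rs_def)
  show r: "rs a z = 1 + z *\<^sub>C (rs a z * a)" using neumann_right[OF n] by (simp add: rs_def)
  show "(1 - z *\<^sub>C a) * rs a z = 1" using l by (simp add: algebra_simps)
  show "rs a z * (1 - z *\<^sub>C a) = 1" using r by (simp add: algebra_simps)
qed

lemma rs_zero [simp]: "rs a 0 = (1 :: 'a::complex_banach_algebra)"
  using rs_left[of 0 a] by simp

lemma inverse_unique_monoid:
  fixes a :: "'a::monoid_mult"
  assumes "b * a = 1" "a * c = 1"
  shows "b = c"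
  by (metis assms mult.assoc mult_1_left mult_1_right)

lemma rs_commute:
  fixes a :: "'a::complex_banach_algebra"
  assumes "cmod z * norm a < 1" "b * a = a * b"
  shows "b * rs a z = rs a z * b"
proof -
  let ?d = "1 - z *\<^sub>C a"
  have c: "b * ?d = ?d * b" using assms(2) by (simp add: algebra_simps)
  have "rs a z * b = rs a z * b * (?d * rs a z)" by (simp add: rs_inverse_left[OF assms(1)])
  also have "\<dots> = rs a z * (b * ?d) * rs a z" by (simp add: mult.assoc)
  also have "\<dots> = (rs a z * ?d) * b * rs a z" by (simp only: c mult.assoc)
  also have "\<dots> = b * rs a z" by (simp add: rs_inverse_right[OF assms(1)])
  finally show ?thesis by simp
qed

lemma rs_commute_self:
  fixes a :: "'a::complex_banach_algebra"
  assumes "cmod z * norm a < 1"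
  shows "a * rs a z = rs a z * a"
  by (rule rs_commute[OF assms refl])

lemma resolvent_identity:
  fixes a :: "'a::complex_banach_algebra"
  assumes "cmod z * norm a < 1" "cmod w * norm a < 1"
  shows "rs a z - rs a w = (z - w) *\<^sub>C (a * rs a z * rs a w)"
proof -
  have "rs a z - rs a w = rs a z * ((1 - w *\<^sub>C a) * rs a w) - (rs a z * (1 - z *\<^sub>C a)) * rs a w"
    by (simp only: rs_inverse_right[OF assms(1)] rs_inverse_left[OF assms(2)] mult_1_left mult_1_right)
  also have "\<dots> = (z - w) *\<^sub>C (rs a z * a * rs a w)" by (simp add: algebra_simps smult_distribs)
  finally show ?thesis by (simp add: rs_commute_self[OF assms(1)])
qed

text \<open>Invertibility needs only \<open>cmod z * norm a < 1\<close>; the margin 1/2 makes the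
  bound uniform in \<open>z\<close>, and the continuity of \<open>rs a\<close> rests on it.\<close>

lemma norm_rs_le:
  fixes a :: "'a::complex_banach_algebra"
  assumes "cmod z * norm a \<le> 1 / 2"
  shows "norm (rs a z) \<le> 2"
proof -
  have "norm (rs a z) \<le> 1 / (1 - cmod z * norm a)"
    using norm_neumann_le[of "z *\<^sub>C a"] assms by (simp add: rs_def norm_smult)
  also have "\<dots> \<le> 1 / (1 / 2)" using assms by (intro divide_left_mono) auto
  finally show ?thesis by simp
qed

lemma norm_rs_minus_one_le:
  fixes a :: "'a::complex_banach_algebra"
  assumes "cmod z * norm a \<le> 1 / 2"
  shows "norm (rs a z - 1) \<le> 2 * norm a * cmod z"
proof -
  have "rs a z - 1 = z *\<^sub>C (a * rs a z)"
    using rs_left[of z a] assms by (simp add: algebra_simps)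
  then have "norm (rs a z - 1) = cmod z * norm (a * rs a z)"
    by (simp add: norm_smult)
  also have "\<dots> \<le> cmod z * (norm a * norm (rs a z))"
    by (intro mult_left_mono norm_mult_ineq) auto
  also have "\<dots> \<le> cmod z * (norm a * 2)"
    by (intro mult_left_mono norm_rs_le assms) auto
  finally show ?thesis by (simp add: mult_ac)
qed

text \<open>The resolvent identity splits off the factor \<open>z - w\<close>, and the remaining
  product has norm at most \<open>norm a * 2 * 2\<close>.\<close>

lemma continuous_on_rs:
  fixes a :: "'a::complex_banach_algebra"
  assumes "\<And>z. z \<in> S \<Longrightarrow> cmod z * norm a \<le> 1 / 2"
  shows "continuous_on S (rs a)"
proof (rule continuous_on_subset)
  let ?T = "{z. cmod z * norm a \<le> 1 / 2}"
  have "(4 * norm a)-lipschitz_on ?T (rs a)"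
  proof (rule lipschitz_onI)
    fix z w assume zw: "z \<in> ?T" "w \<in> ?T"
    have "norm (rs a z - rs a w) = cmod (z - w) * norm (a * rs a z * rs a w)"
      using resolvent_identity[of z a w] zw by (simp add: norm_smult)
    also have "\<dots> \<le> cmod (z - w) * (norm a * norm (rs a z) * norm (rs a w))"
      by (intro mult_left_mono order_trans[OF norm_mult_ineq] mult_mono norm_mult_ineq) auto
    also have "\<dots> \<le> cmod (z - w) * (norm a * 2 * 2)"
      using zw by (intro mult_left_mono mult_mono norm_rs_le) auto
    finally show "dist (rs a z) (rs a w) \<le> 4 * norm a * dist z w"
      by (simp add: dist_norm mult_ac)
  qed simp
  then show "continuous_on ?T (rs a)" by (rule lipschitz_on_continuous_on)
  show "S \<subseteq> ?T" using assms by auto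
qed

lemma continuous_on_rs_compose [continuous_intros]:
  fixes a :: "'a::complex_banach_algebra"
  assumes "continuous_on S f" "\<And>x. x \<in> S \<Longrightarrow> cmod (f x) * norm a \<le> 1 / 2"
  shows "continuous_on S (\<lambda>x. rs a (f x))"
  using continuous_on_compose2[OF continuous_on_rs[of "f ` S" a] assms(1)] assms(2) by auto

section \<open>Closed subalgebras\<close>

text \<open>Closedness puts Neumann series, hence resolvents, back into the algebra. Instances later
  on are the von Neumann algebra, the norm closure of the polynomials in one operator, and
  commutants.\<close>

locale closed_subalgebra =
  fixes S :: "'a::complex_banach_algebra set"
  assumes closed: "closed S"
    and one_mem [simp, intro]: "1 \<in> S"
    and add_mem [intro]: "x \<in> S \<Longrightarrow> y \<in> S \<Longrightarrow> x + y \<in> S"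
    and mult_mem [intro]: "x \<in> S \<Longrightarrow> y \<in> S \<Longrightarrow> x * y \<in> S"
    and smult_mem [intro]: "x \<in> S \<Longrightarrow> c *\<^sub>C x \<in> S"
begin

lemma zero_mem [simp, intro]: "0 \<in> S"
  using smult_mem[OF one_mem, of 0] by simp

lemma minus_mem [intro]: "x \<in> S \<Longrightarrow> - x \<in> S"
  using smult_mem[of x "-1"] by simp

lemma diff_mem [intro]: "x \<in> S \<Longrightarrow> y \<in> S \<Longrightarrow> x - y \<in> S"
  using add_mem[of x "- y"] minus_mem by simp

lemma power_mem [intro]: "x \<in> S \<Longrightarrow> x ^ n \<in> S"
  by (induction n) auto

lemma sum_mem: "(\<And>i. i \<in> I \<Longrightarrow> f i \<in> S) \<Longrightarrow> sum f I \<in> S"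
  by (induction I rule: infinite_finite_induct) auto

lemma suminf_mem:
  assumes "summable f" "\<And>n. f n \<in> S"
  shows "suminf f \<in> S"
proof (rule closed_sequentially[OF closed])
  show "(\<Sum>i<n. f i) \<in> S" for n by (rule sum_mem) (rule assms)
  show "(\<lambda>n. \<Sum>i<n. f i) \<longlonglongrightarrow> suminf f" by (rule summable_LIMSEQ[OF assms(1)])
qed

lemma neumann_mem: "x \<in> S \<Longrightarrow> norm x < 1 \<Longrightarrow> neumann x \<in> S"
  unfolding neumann_def by (intro suminf_mem neumann_summable) auto

lemma rs_mem: "a \<in> S \<Longrightarrow> cmod z * norm a < 1 \<Longrightarrow> rs a z \<in> S"
  unfolding rs_def by (intro neumann_mem) (auto simp: norm_smult)

end

text \<open>The square root of \<open>1 - t\<close> is \<open>1 - q\<close> with \<open>2 q = t + q\<^sup>2\<close>. The fixed point iteration for \<open>q\<close>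
  is majorised by the same iteration for the number 1, which is increasing and bounded by 1.\<close>

lemma sqrt_one_minus:
  fixes t :: "'a::complex_banach_algebra"
  assumes t: "norm t \<le> 1"
  obtains q where "(1 - q) * (1 - q) = 1 - t" "norm q \<le> 1"
    "\<forall>S. closed S \<longrightarrow> 0 \<in> S \<longrightarrow> (\<forall>x\<in>S. (1 / 2) *\<^sub>R (t + x * x) \<in> S) \<longrightarrow> q \<in> S"
proof -
  define Q where "Q = rec_nat (0 :: 'a) (\<lambda>_ x. (1 / 2) *\<^sub>R (t + x * x))"
  define q where "q = rec_nat (0 :: real) (\<lambda>_ x. (1 / 2) * (1 + x * x))"
  have Q0: "Q 0 = 0" and QS: "Q (Suc n) = (1 / 2) *\<^sub>R (t + Q n * Q n)" for n
    by (simp_all add: Q_def)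
  have q0: "q 0 = 0" and qS: "q (Suc n) = (1 / 2) * (1 + q n * q n)" for n
    by (simp_all add: q_def)
  have q01: "0 \<le> q n \<and> q n \<le> 1" for n
  proof (induction n)
    case (Suc n)
    then have "q n * q n \<le> 1" by (simp add: mult_le_one)
    then show ?case using Suc by (simp add: qS)
  qed (simp add: q0)
  have normQ: "norm (Q n) \<le> q n" for n
  proof (induction n)
    case (Suc n)
    have "norm (Q n * Q n) \<le> q n * q n"
      by (rule order_trans[OF norm_mult_ineq mult_mono]) (use Suc q01 in auto)
    then have "norm (t + Q n * Q n) \<le> 1 + q n * q n"
      using t norm_triangle_ineq[of t "Q n * Q n"] by linarith
    then show ?case by (simp add: QS qS)
  qed (simp add: Q0 q0)
  have tQ: "t * Q n = Q n * t" for n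
    by (induction n) (simp_all add: Q0 QS algebra_simps, metis mult.assoc)
  have comm: "Q m * Q n = Q n * Q m" for m n
  proof (induction m)
    case (Suc m)
    then show ?case
      by (simp add: QS algebra_simps tQ) (metis mult.assoc)
  qed (simp add: Q0)
  have step: "norm (Q (Suc n) - Q n) \<le> q (Suc n) - q n" for n
  proof (induction n)
    case 0
    show ?case using t by (simp add: Q0 QS q0 qS)
  next
    case (Suc n)
    \<comment> \<open>All iterates commute, so the difference of two squares factors, as it does for
      the numerical majorant \<open>q\<close>.\<close>
    have "Q (Suc (Suc n)) - Q (Suc n) = (1 / 2) *\<^sub>R ((Q (Suc n) - Q n) * (Q (Suc n) + Q n))"
      using comm[of "Suc n" n]
      by (simp add: QS[of "Suc n"] QS[of n] algebra_simps del: scaleR_right_distrib)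
         (simp add: QS[of n] algebra_simps)
    also have "norm \<dots> \<le> (1 / 2) * ((q (Suc n) - q n) * (q (Suc n) + q n))"
    proof -
      have "0 \<le> q (Suc n) - q n" using Suc norm_ge_zero order_trans by blast
      moreover have "norm (Q (Suc n) + Q n) \<le> q (Suc n) + q n"
        using normQ[of n] normQ[of "Suc n"] norm_triangle_ineq[of "Q (Suc n)" "Q n"] by linarith
      ultimately have "norm ((Q (Suc n) - Q n) * (Q (Suc n) + Q n)) \<le> (q (Suc n) - q n) * (q (Suc n) + q n)"
        by (intro order_trans[OF norm_mult_ineq] mult_mono Suc) auto
      then show ?thesis by simp
    qed
    also have "\<dots> = q (Suc (Suc n)) - q (Suc n)"
      by (simp add: qS[of "Suc n"]) (simp add: qS[of n] algebra_simps)
    finally show ?case .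
  qed
  \<comment> \<open>Telescoping: the increments of \<open>Q\<close> are dominated by those of the
    bounded increasing sequence \<open>q\<close>, so \<open>Q\<close> is Cauchy because
    \<open>q\<close> is.\<close>
  have dist: "norm (Q (n + k) - Q n) \<le> q (n + k) - q n" for n k
  proof (induction k)
    case (Suc k)
    have "norm (Q (n + Suc k) - Q n) \<le> norm (Q (Suc (n + k)) - Q (n + k)) + norm (Q (n + k) - Q n)"
      using norm_triangle_ineq[of "Q (Suc (n + k)) - Q (n + k)" "Q (n + k) - Q n"] by simp
    then show ?case using Suc step[of "n + k"] by simp
  qed simp
  have "incseq q"
  proof (rule incseq_SucI)
    show "q n \<le> q (Suc n)" for n using step[of n] norm_ge_zero[of "Q (Suc n) - Q n"] by linarith
  qed
  then have "convergent q"
    using q01 by (intro Bseq_mono_convergent BseqI'[of _ 1]) (auto simp: incseq_def)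
  then have cq: "Cauchy q" by (simp add: Cauchy_convergent_iff)
  have "Cauchy Q"
  proof (rule CauchyI)
    fix e :: real assume "0 < e"
    then obtain M where M: "\<forall>m\<ge>M. \<forall>n\<ge>M. norm (q m - q n) < e" using CauchyD[OF cq] by blast
    have *: "norm (Q m - Q n) < e" if "M \<le> n" "n \<le> m" for m n
    proof -
      have "norm (Q m - Q n) \<le> q m - q n" using dist[of n "m - n"] that by simp
      also have "\<dots> < e" using M that by (metis abs_ge_self le_trans order_le_less_trans real_norm_def)
      finally show ?thesis .
    qed
    show "\<exists>M. \<forall>m\<ge>M. \<forall>n\<ge>M. norm (Q m - Q n) < e"
      by (intro exI[of _ M] allI impI) (metis * linear norm_minus_commute)
  qed
  then obtain l where l: "Q \<longlonglongrightarrow> l" using Cauchy_convergent_iff convergent_def by blast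
  have "(\<lambda>n. Q (Suc n)) \<longlonglongrightarrow> (1 / 2) *\<^sub>R (t + l * l)"
    unfolding QS by (intro tendsto_intros l)
  with LIMSEQ_Suc[OF l] have "l = (1 / 2) *\<^sub>R (t + l * l)" by (rule LIMSEQ_unique)
  then have "l + l = t + l * l" by (metis scaleR_half_double scaleR_right_distrib)
  then have "(1 - l) * (1 - l) = 1 - t" by (simp add: algebra_simps)
  moreover have "norm l \<le> 1"
    by (rule Lim_bounded[OF tendsto_norm[OF l]]) (use normQ q01 order_trans in blast)
  \<comment> \<open>Every closed property that the iteration preserves passes to the limit. Later
    this yields self-adjointness, commutation with a fixed element, and membership in a closed
    subalgebra.\<close>
  moreover have "l \<in> S"
    if "closed S" "0 \<in> S" "\<And>x. x \<in> S \<Longrightarrow> (1 / 2) *\<^sub>R (t + x * x) \<in> S" for S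
  proof (rule closed_sequentially[OF that(1) _ l])
    show "Q n \<in> S" for n by (induction n) (simp_all only: Q0 QS that)
  qed
  ultimately show thesis by (intro that) auto
qed

section \<open>Tracial algebras and moment transforms\<close>

text \<open>Positivity stays in the operator layer; here a trace is linear, cyclic and bounded. The
  constant \<open>K\<close> leaves room for a crude bound: splitting an operator into two
  self-adjoint parts gives 2.\<close>

locale tracial_algebra = closed_subalgebra A for A :: "'a::complex_banach_algebra set" +
  fixes \<tau> :: "'a \<Rightarrow> complex" and K :: real
  assumes tau_add: "x \<in> A \<Longrightarrow> y \<in> A \<Longrightarrow> \<tau> (x + y) = \<tau> x + \<tau> y"
    and tau_smult: "x \<in> A \<Longrightarrow> \<tau> (c *\<^sub>C x) = c * \<tau> x"
    and tau_commute: "x \<in> A \<Longrightarrow> y \<in> A \<Longrightarrow> \<tau> (x * y) = \<tau> (y * x)"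
    and tau_one [simp]: "\<tau> 1 = 1"
    and tau_bound: "x \<in> A \<Longrightarrow> cmod (\<tau> x) \<le> K * norm x"
begin

lemma tau_zero [simp]: "\<tau> 0 = 0"
  using tau_smult[OF one_mem, of 0] by simp

lemma tau_minus: "x \<in> A \<Longrightarrow> \<tau> (- x) = - \<tau> x"
  using tau_smult[of x "-1"] by simp

lemma tau_diff: "x \<in> A \<Longrightarrow> y \<in> A \<Longrightarrow> \<tau> (x - y) = \<tau> x - \<tau> y"
  using tau_add[of x "- y"] by (simp add: tau_minus minus_mem)

lemma tau_sum: "(\<And>i. i \<in> I \<Longrightarrow> f i \<in> A) \<Longrightarrow> \<tau> (sum f I) = (\<Sum>i\<in>I. \<tau> (f i))"
  by (induction I rule: infinite_finite_induct) (auto simp: tau_add sum_mem)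

lemma K_pos: "0 < K"
proof (rule ccontr)
  assume "\<not> 0 < K"
  then have "K * norm (1 :: 'a) \<le> 0" by (simp add: mult_nonpos_nonneg)
  then show False using tau_bound[OF one_mem] by simp
qed

lemma tendsto_tau:
  assumes "(f \<longlongrightarrow> l) F" "\<And>x. f x \<in> A" "l \<in> A"
  shows "((\<lambda>x. \<tau> (f x)) \<longlongrightarrow> \<tau> l) F"
proof (rule LIM_zero_cancel, rule Lim_null_comparison)
  show "((\<lambda>x. K * norm (f x - l)) \<longlongrightarrow> 0) F"
    using assms(1) by (intro tendsto_mult_right_zero tendsto_norm_zero LIM_zero)
  have "cmod (\<tau> (f x) - \<tau> l) \<le> K * norm (f x - l)" for x
    using tau_bound[of "f x - l"] assms by (simp add: tau_diff diff_mem)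
  then show "\<forall>\<^sub>F x in F. cmod (\<tau> (f x) - \<tau> l) \<le> K * norm (f x - l)" by simp
qed

lemma continuous_on_tau [continuous_intros]:
  assumes "continuous_on S f" "\<And>x. x \<in> S \<Longrightarrow> f x \<in> A"
  shows "continuous_on S (\<lambda>x. \<tau> (f x))"
proof -
  have "K-lipschitz_on A \<tau>"
  proof (rule lipschitz_onI)
    show "dist (\<tau> x) (\<tau> y) \<le> K * dist x y" if "x \<in> A" "y \<in> A" for x y
      using tau_bound[of "x - y"] that by (simp add: tau_diff diff_mem dist_norm)
  qed (use K_pos in simp)
  then have "continuous_on A \<tau>" by (rule lipschitz_on_continuous_on)
  then show ?thesis by (rule continuous_on_compose2) (use assms in auto)
qed

lemma tau_suminf_zero:
  assumes "summable f" "\<And>n. f n \<in> A" "\<And>n. \<tau> (f n) = 0"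
  shows "\<tau> (suminf f) = 0"
proof (rule LIMSEQ_unique)
  show "(\<lambda>n. \<tau> (\<Sum>i<n. f i)) \<longlonglongrightarrow> \<tau> (suminf f)"
    by (intro tendsto_tau summable_LIMSEQ sum_mem suminf_mem assms)
  show "(\<lambda>n. \<tau> (\<Sum>i<n. f i)) \<longlonglongrightarrow> 0" by (simp add: tau_sum assms)
qed

definition center :: "'a \<Rightarrow> 'a" where
  "center x = x - \<tau> x *\<^sub>C 1"

lemma center_add: "x = center x + \<tau> x *\<^sub>C 1"
  by (simp add: center_def)

lemma tau_center: "x \<in> A \<Longrightarrow> \<tau> (center x) = 0"
  by (simp add: center_def tau_diff tau_smult smult_mem)

text \<open>The moment transform near 0, with the Neumann series as inverse;
  \<open>moment_transform_eq\<close> links it to \<open>moment_transform\<close>.\<close>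

definition mom :: "'a \<Rightarrow> complex \<Rightarrow> complex" where
  "mom a z = \<tau> (z *\<^sub>C (a * rs a z))"

lemma tau_rs:
  assumes "a \<in> A" "cmod z * norm a < 1"
  shows "\<tau> (rs a z) = 1 + mom a z"
  using arg_cong[OF rs_left[OF assms(2)], of \<tau>] assms
  by (simp add: mom_def tau_add smult_mem mult_mem rs_mem)

text \<open>The trace of the resolvent identity. The divided differences of \<open>mom a\<close> are
  thus explicit and continuous up to the diagonal, which gives injectivity, the derivative and, for
  \<open>a = r\<close>, the function \<open>B\<close> of the theorem.\<close>

lemma mom_diff:
  assumes "a \<in> A" "cmod z * norm a < 1" "cmod w * norm a < 1"
  shows "mom a z - mom a w = (z - w) * \<tau> (a * rs a z * rs a w)"
proof -
  have "mom a z - mom a w = \<tau> (rs a z) - \<tau> (rs a w)" using assms by (simp add: tau_rs)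
  also have "\<dots> = \<tau> (rs a z - rs a w)" using assms by (simp add: tau_diff rs_mem)
  also have "\<dots> = (z - w) * \<tau> (a * rs a z * rs a w)"
    using assms by (simp add: resolvent_identity tau_smult mult_mem rs_mem)
  finally show ?thesis .
qed

lemma mom_zero [simp]: "mom a 0 = 0"
  by (simp add: mom_def)

text \<open>At \<open>z = w = 0\<close> the divided difference of \<open>mom a\<close> is
  \<open>\<tau> a\<close>. By continuity its modulus exceeds half of \<open>cmod (\<tau> a)\<close>
  on a small bidisc, so \<open>mom a\<close> is injective there and its inverse grows at most with
  slope \<open>2 / cmod (\<tau> a)\<close>.\<close>

lemma mom_local_inverse:
  assumes a: "a \<in> A" "\<tau> a \<noteq> 0"
  obtains \<delta> \<rho> g where "0 < \<delta>" "0 < \<rho>"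
    "\<forall>z\<in>ball 0 \<delta>. cmod z * norm a \<le> 1 / 2"
    "\<forall>z\<in>ball 0 \<delta>. \<forall>w\<in>ball 0 \<delta>. \<tau> (a * rs a z * rs a w) \<noteq> 0"
    "inj_on (mom a) (ball 0 \<delta>)" "mom a holomorphic_on ball 0 \<delta>"
    "g holomorphic_on ball 0 \<rho>"
    "\<forall>m\<in>ball 0 \<rho>. g m \<in> ball 0 \<delta>"
    "\<forall>m\<in>ball 0 \<rho>. mom a (g m) = m"
    "\<forall>m\<in>ball 0 \<rho>. cmod (g m) \<le> 2 / cmod (\<tau> a) * cmod m"
proof -
  define S where "S = ball (0 :: complex) (1 / (2 * (norm a + 1)))"
  have small: "cmod z * norm a \<le> 1 / 2" if "z \<in> S" for z
  proof -
    have "cmod z * norm a \<le> 1 / (2 * (norm a + 1)) * (norm a + 1)"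
      using that by (intro mult_mono) (auto simp: S_def)
    also have "\<dots> = 1 / 2"
    proof -
      have "norm a + 1 \<noteq> 0" using norm_ge_zero[of a] by linarith
      then show ?thesis by simp
    qed
    finally show ?thesis .
  qed
  have small1: "cmod z * norm a < 1" if "z \<in> S" for z using small[OF that] by simp
  have "0 < norm a + 1" using norm_ge_zero[of a] by linarith
  then have S: "open S" "0 \<in> S" by (auto simp: S_def)
  define f where "f p = \<tau> (a * rs a (fst p) * rs a (snd p))" for p
  have cf: "continuous_on (S \<times> S) f"
    unfolding f_def
    by (intro continuous_intros) (use small small1 in \<open>auto intro!: mult_mem rs_mem a\<close>)
  define T where "T = (S \<times> S) \<inter> (\<lambda>p. cmod (f p)) -` {cmod (\<tau> a) / 2 <..}"
  have "open T" unfolding T_def using S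
    by (intro continuous_open_preimage open_Times continuous_on_norm cf open_greaterThan)
  moreover have "(0, 0) \<in> T" using S a by (simp add: T_def f_def)
  ultimately obtain P Q where PQ: "open P" "open Q" "(0, 0) \<in> P \<times> Q" "P \<times> Q \<subseteq> T"
    by (rule open_prod_elim)
  then obtain \<delta> where d: "0 < \<delta>" "ball 0 \<delta> \<subseteq> P \<inter> Q"
    using openE[of "P \<inter> Q" 0] by auto
  have T: "(z, w) \<in> T" if "z \<in> ball 0 \<delta>" "w \<in> ball 0 \<delta>" for z w using that d PQ by blast
  have inS: "z \<in> S" if "z \<in> ball 0 \<delta>" for z using T[OF that that] by (simp add: T_def)
  have lower: "cmod (\<tau> a) / 2 < cmod (\<tau> (a * rs a z * rs a w))"
    if "z \<in> ball 0 \<delta>" "w \<in> ball 0 \<delta>" for z w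
    using T[OF that] by (simp add: T_def f_def)
  have nz: "\<tau> (a * rs a z * rs a w) \<noteq> 0" if "z \<in> ball 0 \<delta>" "w \<in> ball 0 \<delta>" for z w
    using lower[OF that] by auto
  have inj: "inj_on (mom a) (ball 0 \<delta>)"
  proof (rule inj_onI)
    fix z w assume *: "z \<in> ball 0 \<delta>" "w \<in> ball 0 \<delta>" "mom a z = mom a w"
    then have "(z - w) * \<tau> (a * rs a z * rs a w) = 0"
      using mom_diff[OF a(1) small1[OF inS] small1[OF inS], of z w] by simp
    then show "z = w" using nz[OF *(1,2)] by simp
  qed
  have "(mom a has_field_derivative f (z, z)) (at z)" if z: "z \<in> ball 0 \<delta>" for z
    unfolding has_field_derivative_iff
  proof (rule Lim_transform_within_open[OF _ open_ball z])
    have "continuous_on (ball 0 \<delta>) (\<lambda>w. f (w, z))"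
      by (rule continuous_on_compose2[OF cf]) (use inS z in \<open>auto intro!: continuous_intros\<close>)
    then show "((\<lambda>w. f (w, z)) \<longlongrightarrow> f (z, z)) (at z)"
      using z by (simp add: continuous_on_eq_continuous_at isCont_def)
    show "f (w, z) = (mom a w - mom a z) / (w - z)" if "w \<in> ball 0 \<delta>" "w \<noteq> z" for w
      using that mom_diff[OF a(1) small1[OF inS] small1[OF inS], of w z] z by (simp add: f_def)
  qed
  then have hol: "mom a holomorphic_on ball 0 \<delta>"
    by (intro holomorphic_onI) (auto simp: field_differentiable_def intro: DERIV_subset)
  obtain g where g: "g holomorphic_on (mom a ` ball 0 \<delta>)" "\<And>z. z \<in> ball 0 \<delta> \<Longrightarrow> g (mom a z) = z"
    using holomorphic_has_inverse[OF hol open_ball inj] by metis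
  have "open (mom a ` ball 0 \<delta>)"
    by (rule open_mapping_thm3[OF hol open_ball inj])
  moreover have "0 \<in> mom a ` ball 0 \<delta>" using d by (intro image_eqI[of _ _ 0]) auto
  ultimately obtain \<rho> where r: "0 < \<rho>" "ball 0 \<rho> \<subseteq> mom a ` ball 0 \<delta>"
    by (metis openE)
  have gm: "g m \<in> ball 0 \<delta> \<and> mom a (g m) = m" if "m \<in> ball 0 \<rho>" for m
    using r(2) that g(2) by fastforce
  have "cmod (g m) \<le> 2 / cmod (\<tau> a) * cmod m" if "m \<in> ball 0 \<rho>" for m
  proof -
    have g0: "g m \<in> ball 0 \<delta>" "0 \<in> ball 0 \<delta>" using gm[OF that] d by auto
    \<comment> \<open>The divided difference is taken between \<open>g m\<close> and 0, where
      \<open>mom a\<close> vanishes.\<close>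
    have "cmod m = cmod (g m) * cmod (\<tau> (a * rs a (g m) * rs a 0))"
      using mom_diff[OF a(1) small1[OF inS] small1[OF inS], OF g0] gm[OF that]
      by (simp flip: norm_mult)
    moreover have "cmod (g m) * (cmod (\<tau> a) / 2) \<le> cmod (g m) * cmod (\<tau> (a * rs a (g m) * rs a 0))"
      using lower[OF g0] by (intro mult_left_mono) auto
    ultimately show ?thesis using a(2) by (simp add: field_simps)
  qed
  then show thesis
    using that[of \<delta> \<rho> g] d r nz inj hol small inS gm holomorphic_on_subset[OF g(1) r(2)] by blast
qed

text \<open>Centring removes the constant term 1 of \<open>rs a z\<close>, so the norm becomes
  linear in \<open>z\<close>. A product of two such elements is of second order and is beaten by the
  first-order quantity \<open>m * (1 + m)\<close> in \<open>subordinate_exists\<close>.\<close>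

lemma norm_center_rs_le:
  assumes a: "a \<in> A" and z: "cmod z * norm a \<le> 1 / 2"
  shows "norm (center (rs a z)) \<le> (2 + 2 * K) * norm a * cmod z"
proof -
  have mem: "rs a z - 1 \<in> A" using assms by (intro diff_mem rs_mem) auto
  have "center (rs a z) = (rs a z - 1) - \<tau> (rs a z - 1) *\<^sub>C 1"
    using a z by (simp add: center_def tau_diff rs_mem smult_distribs)
  also have "norm \<dots> \<le> norm (rs a z - 1) + cmod (\<tau> (rs a z - 1)) * norm (1 :: 'a)"
    using norm_triangle_ineq4[of "rs a z - 1" "\<tau> (rs a z - 1) *\<^sub>C 1"] by (simp add: norm_smult)
  also have "\<dots> \<le> norm (rs a z - 1) + K * norm (rs a z - 1) * 1"
    by (intro add_left_mono mult_mono tau_bound mem norm_one_le) (use K_pos in auto)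
  also have "\<dots> = (1 + K) * norm (rs a z - 1)" by (simp add: algebra_simps)
  also have "\<dots> \<le> (1 + K) * (2 * norm a * cmod z)"
    using K_pos by (intro mult_left_mono norm_rs_minus_one_le z) auto
  finally show ?thesis by (simp add: algebra_simps)
qed

end

section \<open>Free pairs\<close>

text \<open>\<open>AR\<close> and \<open>AY\<close> stand for the closed algebras generated by
  \<open>r\<close> and \<open>y\<close>, so that resolvents lie in them. A letter of a word carries
  the tag \<open>True\<close> if it comes from \<open>AR\<close>. Commutativity of \<open>AR\<close>
  later allows \<open>r\<close>, \<open>g1\<close>, \<open>g2\<close> and the resolvents of
  \<open>r\<close> to be rearranged.\<close>

locale free_pair = tracial_algebra A \<tau> K
  for A :: "'a::complex_banach_algebra set" and \<tau> K +
  fixes AR AY :: "'a set" and r y :: 'a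
  assumes AR: "closed_subalgebra AR" "AR \<subseteq> A" and AY: "closed_subalgebra AY" "AY \<subseteq> A"
    and r: "r \<in> AR" and y: "y \<in> AY"
    and AR_commute: "a \<in> AR \<Longrightarrow> b \<in> AR \<Longrightarrow> a * b = b * a"
    and free: "xs \<noteq> [] \<Longrightarrow>
      (\<forall>(i, a) \<in> set xs. a \<in> (if i then AR else AY) \<and> \<tau> a = 0) \<Longrightarrow>
      distinct_adj (map fst xs) \<Longrightarrow> \<tau> (prod_list (map snd xs)) = 0"
begin

interpretation R: closed_subalgebra AR by (rule AR)
interpretation Y: closed_subalgebra AY by (rule AY)

lemma AR_A [intro]: "x \<in> AR \<Longrightarrow> x \<in> A" using AR by auto
lemma AY_A [intro]: "x \<in> AY \<Longrightarrow> x \<in> A" using AY by auto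

lemma r_A [simp]: "r \<in> A" and y_A [simp]: "y \<in> A" using r y by auto

text \<open>With both ends in \<open>AY\<close>, a centred element of \<open>AR\<close> can be put
  in front of such a word or between two of them without breaking the alternation.\<close>

inductive alternating :: "'a \<Rightarrow> bool" where
  base: "b \<in> AY \<Longrightarrow> \<tau> b = 0 \<Longrightarrow> alternating b"
| step: "b \<in> AY \<Longrightarrow> \<tau> b = 0 \<Longrightarrow> a \<in> AR \<Longrightarrow> \<tau> a = 0 \<Longrightarrow> alternating w \<Longrightarrow> alternating (b * (a * w))"

lemma alternating_mem: "alternating w \<Longrightarrow> w \<in> A"
  by (induction rule: alternating.induct) auto

lemma alternating_append:
  "alternating v \<Longrightarrow> a \<in> AR \<Longrightarrow> \<tau> a = 0 \<Longrightarrow> alternating w \<Longrightarrow> alternating (v * (a * w))"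
  by (induction rule: alternating.induct) (auto simp: mult.assoc intro: alternating.intros)

text \<open>The first letter is exposed with its tag, so that a letter from \<open>AR\<close> can be
  prefixed to the list.\<close>

lemma alternating_word:
  assumes "alternating w"
  obtains b xs where "w = prod_list (map snd ((False, b) # xs))"
    "\<forall>(i, a) \<in> set ((False, b) # xs). a \<in> (if i then AR else AY) \<and> \<tau> a = 0"
    "distinct_adj (map fst ((False, b) # xs))"
  using assms
proof (induction arbitrary: thesis rule: alternating.induct)
  case (base b)
  show ?case by (rule base(3)[of b "[]"]) (use base in auto)
next
  case (step b a w)
  obtain b' xs where "w = prod_list (map snd ((False, b') # xs))"
    "\<forall>(i, a) \<in> set ((False, b') # xs). a \<in> (if i then AR else AY) \<and> \<tau> a = 0"
    "distinct_adj (map fst ((False, b') # xs))"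
    using step.IH by blast
  then show ?case using step.hyps
    by (intro step.prems[of b "(True, a) # (False, b') # xs"]) (simp_all add: mult.assoc)
qed

lemma tau_alternating:
  assumes "alternating w"
  shows "\<tau> w = 0"
  by (rule alternating_word[OF assms]) (simp only: free[OF list.distinct(2)])

lemma tau_centred_alternating:
  assumes "alternating w" "a \<in> AR" "\<tau> a = 0"
  shows "\<tau> (a * w) = 0"
proof -
  obtain b xs where *: "w = prod_list (map snd ((False, b) # xs))"
    "\<forall>(i, a) \<in> set ((False, b) # xs). a \<in> (if i then AR else AY) \<and> \<tau> a = 0"
    "distinct_adj (map fst ((False, b) # xs))"
    by (rule alternating_word[OF assms(1)])
  have "\<tau> (prod_list (map snd ((True, a) # (False, b) # xs))) = 0"
    by (rule free) (use * assms(2,3) in auto)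
  then show ?thesis by (simp add: *(1))
qed

text \<open>The centred part of \<open>a\<close> lengthens the word by one letter, the scalar part
  leaves the word as it is; freeness kills both.\<close>

lemma tau_mult_alternating:
  assumes "alternating w" "a \<in> AR"
  shows "\<tau> (a * w) = 0"
proof -
  have m: "center a \<in> AR" "w \<in> A" using assms
    by (auto simp: center_def alternating_mem)
  have "\<tau> (a * w) = \<tau> (center a * w + \<tau> a *\<^sub>C w)"
    by (subst center_add[of a]) (simp add: distrib_right)
  also have "\<dots> = \<tau> (center a * w) + \<tau> a * \<tau> w"
    using m by (simp add: tau_add tau_smult mult_mem smult_mem AR_A)
  also have "\<dots> = 0"
    using assms m by (simp add: tau_alternating tau_centred_alternating tau_center AR_A)
  finally show ?thesis .
qed

definition alternating_series :: "'a \<Rightarrow> bool" where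
  "alternating_series V \<longleftrightarrow> (\<exists>f. (\<forall>n. alternating (f n)) \<and> summable f \<and> V = suminf f)"

lemma alternating_series_mem: "alternating_series V \<Longrightarrow> V \<in> A"
  by (auto simp: alternating_series_def intro: suminf_mem alternating_mem)

lemma tau_series_generic:
  assumes "alternating_series V" "a \<in> A" "b \<in> A" "\<And>w. alternating w \<Longrightarrow> \<tau> (a * w * b) = 0"
  shows "\<tau> (a * V * b) = 0"
proof -
  obtain f where f: "\<And>n. alternating (f n)" "summable f" "V = suminf f"
    using assms(1) by (auto simp: alternating_series_def)
  have s: "summable (\<lambda>n. a * f n * b)" by (intro summable_mult summable_mult2 f)
  have "a * V * b = (\<Sum>n. a * f n * b)"
    using f suminf_mult[OF f(2), of a] suminf_mult2[OF summable_mult[OF f(2)], of a b] by simp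
  also have "\<tau> \<dots> = 0"
    using assms f alternating_mem by (intro tau_suminf_zero[OF s]) (auto simp: mult_mem)
  finally show ?thesis .
qed

lemma tau_mult_series:
  assumes "alternating_series V" "a \<in> AR"
  shows "\<tau> (a * V) = 0"
  using tau_series_generic[OF assms(1), of a 1] tau_mult_alternating assms(2) by auto

text \<open>Termwise first in \<open>V\<close>, then in \<open>W\<close>: a centred \<open>b\<close>
  fuses one word of each series into a single alternating word.\<close>

lemma tau_two_series_centred:
  assumes "alternating_series V" "alternating_series W" "a \<in> AR" "b \<in> AR" "\<tau> b = 0"
  shows "\<tau> (a * V * b * W) = 0"
proof -
  have "\<tau> (a * V * (b * W)) = 0"
  proof (rule tau_series_generic[OF assms(1)])
    show "\<tau> (a * v * (b * W)) = 0" if v: "alternating v" for v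
    proof -
      have "\<tau> (a * v * b * W * 1) = 0"
      proof (rule tau_series_generic[OF assms(2)])
        show "\<tau> (a * v * b * w * 1) = 0" if "alternating w" for w
          using tau_mult_alternating[OF alternating_append[OF v assms(4,5) that] assms(3)]
          by (simp add: mult.assoc)
      qed (use assms alternating_mem[OF v] in \<open>auto simp: mult_mem\<close>)
      then show ?thesis by (simp add: mult.assoc)
    qed
  qed (use assms alternating_series_mem[OF assms(2)] in \<open>auto simp: mult_mem\<close>)
  then show ?thesis by (simp add: mult.assoc)
qed

text \<open>The centred part of \<open>b\<close> contributes nothing. The scalar part leaves
  \<open>V * W\<close>, where two letters of \<open>AY\<close> collide; this is the trace that
  freeness does not annihilate.\<close>

lemma tau_two_series_right:
  assumes "alternating_series V" "alternating_series W" "a \<in> AR" "b \<in> AR"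
  shows "\<tau> (a * V * b * W) = \<tau> b * \<tau> (a * V * W)"
proof -
  note m = alternating_series_mem[OF assms(1)] alternating_series_mem[OF assms(2)]
  have c: "center b \<in> AR" using assms by (auto simp: center_def)
  have "\<tau> (a * V * b * W) = \<tau> (a * V * center b * W + \<tau> b *\<^sub>C (a * V * W))"
    by (subst center_add[of b]) (simp add: distrib_right distrib_left mult.assoc)
  also have "\<dots> = \<tau> (a * V * center b * W) + \<tau> b * \<tau> (a * V * W)"
    using m c assms by (simp add: tau_add tau_smult mult_mem smult_mem AR_A)
  also have "\<tau> (a * V * center b * W) = 0"
    using assms c by (intro tau_two_series_centred) (auto intro: tau_center)
  finally show ?thesis by simp
qed

text \<open>Only one factor can be split off directly; traciality exchanges the roles of the two.\<close>

lemma tau_two_series: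
  assumes "alternating_series V" "alternating_series W" "a \<in> AR" "b \<in> AR"
  shows "\<tau> (a * V * b * W) = \<tau> a * \<tau> b * \<tau> (V * W)"
proof -
  note m = alternating_series_mem[OF assms(1)] alternating_series_mem[OF assms(2)]
  have "\<tau> (a * V * W) = \<tau> (W * (a * V))"
    using tau_commute[of "a * V" W] m assms by (simp add: mult_mem AR_A)
  also have "\<dots> = \<tau> (1 * W * a * V)" by (simp add: mult.assoc)
  also have "\<dots> = \<tau> a * \<tau> (1 * W * V)" by (rule tau_two_series_right) (use assms in auto)
  also have "\<tau> (1 * W * V) = \<tau> (V * W)" using m by (simp add: tau_commute)
  finally show ?thesis using tau_two_series_right[OF assms] by simp
qed

section \<open>The resolvent of a product of free variables\<close>

text \<open>\<open>subordinate z \<omega> m c V\<close>: \<open>V\<close> carries the part of \<open>(1 - z r y)\<^sup>-\<^sup>1\<close> beyond \<open>(1 - \<omega> r)\<^sup>-\<^sup>1\<close>.\<close>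

definition subordinate :: "complex \<Rightarrow> complex \<Rightarrow> complex \<Rightarrow> complex \<Rightarrow> 'a \<Rightarrow> bool" where
  "subordinate z \<omega> m c V \<longleftrightarrow>
     cmod z * norm (r * y) \<le> 1 / 2 \<and> cmod \<omega> * norm r \<le> 1 / 2 \<and> mom r \<omega> = m \<and>
     alternating_series V \<and>
     rs (r * y) z = (1 + c *\<^sub>C ((rs r \<omega> - 1) * V)) * rs r \<omega>"

text \<open>With \<open>p = (1 - \<omega>\<^sub>2 r)\<^sup>-\<^sup>1\<close> and \<open>q = (1 - \<omega>\<^sub>1 y)\<^sup>-\<^sup>1\<close> one has \<open>\<omega>\<^sub>2 p r = p - 1\<close> and
  \<open>\<omega>\<^sub>1 y q = q - 1\<close>. In terms of the centred elements the mixed linear terms of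
  \<open>p (1 - z r y) q\<close> cancel precisely because \<open>\<omega>\<^sub>1 \<omega>\<^sub>2 (1 + m) = z m\<close>.\<close>

lemma centred_factorisation:
  assumes small: "cmod \<omega>1 * norm y < 1" "cmod \<omega>2 * norm r < 1"
    and m: "mom y \<omega>1 = m" "mom r \<omega>2 = m"
    and z: "\<omega>1 * \<omega>2 * (1 + m) = z * m"
  shows "m *\<^sub>C (rs r \<omega>2 * (1 - z *\<^sub>C (r * y)) * rs y \<omega>1) =
    (m * (1 + m)) *\<^sub>C 1 - center (rs r \<omega>2) * center (rs y \<omega>1)"
proof -
  let ?p = "rs r \<omega>2" and ?q = "rs y \<omega>1"
  have p: "\<omega>2 *\<^sub>C (?p * r) = ?p - 1" using rs_right[OF small(2)] by (simp add: algebra_simps)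
  have q: "\<omega>1 *\<^sub>C (y * ?q) = ?q - 1" using rs_left[OF small(1)] by (simp add: algebra_simps)
  have "(m * z) *\<^sub>C (?p * r * (y * ?q)) = (1 + m) *\<^sub>C ((\<omega>2 *\<^sub>C (?p * r)) * (\<omega>1 *\<^sub>C (y * ?q)))"
    using z by (simp add: mult_ac)
  also have "\<dots> = (1 + m) *\<^sub>C ((?p - 1) * (?q - 1))" by (simp only: p q)
  finally have *: "(m * z) *\<^sub>C (?p * r * (y * ?q)) = (1 + m) *\<^sub>C ((?p - 1) * (?q - 1))" .
  have t: "\<tau> ?p = 1 + m" "\<tau> ?q = 1 + m" using small m by (simp_all add: tau_rs)
  have "m *\<^sub>C (?p * (1 - z *\<^sub>C (r * y)) * ?q) = m *\<^sub>C (?p * ?q) - (m * z) *\<^sub>C (?p * r * (y * ?q))"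
    by (simp add: algebra_simps smult_distribs mult.assoc)
  also have "\<dots> = (m * (1 + m)) *\<^sub>C 1 - center ?p * center ?q"
    unfolding * center_def t by (simp add: algebra_simps smult_distribs)
  finally show ?thesis .
qed

text \<open>Division of the centred factorisation by \<open>m * (1 + m)\<close> leaves
  \<open>1 - x\<close>, and the last hypothesis makes the norm of \<open>x\<close> less than 1.
  Stripping \<open>p\<close> and \<open>q\<close> from the inverse of \<open>1 - x\<close> gives the
  resolvent of \<open>r * y\<close>.\<close>

lemma subordinate_exists:
  assumes small: "cmod \<omega>1 * norm y \<le> 1 / 2" "cmod \<omega>2 * norm r \<le> 1 / 2" "cmod z * norm (r * y) \<le> 1 / 2"
    and m: "mom y \<omega>1 = m" "mom r \<omega>2 = m" "m \<noteq> 0" "1 + m \<noteq> 0"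
    and z: "\<omega>1 * \<omega>2 * (1 + m) = z * m"
    and x: "norm (center (rs r \<omega>2)) * norm (center (rs y \<omega>1)) < cmod (m * (1 + m))"
  obtains c V where "subordinate z \<omega>2 m c V"
proof -
  let ?p = "rs r \<omega>2" and ?q = "rs y \<omega>1"
  have small': "cmod \<omega>1 * norm y < 1" "cmod \<omega>2 * norm r < 1" "cmod z * norm (r * y) < 1"
    using small by auto
  define c where "c = 1 / (m * (1 + m))"
  define x where "x = c *\<^sub>C (center ?p * center ?q)"
  define N where "N = neumann x"
  define V where "V = center ?q * N"
  have p_AR: "?p \<in> AR" and q_AY: "?q \<in> AY" using small' r y by (auto intro: R.rs_mem Y.rs_mem)
  have t: "\<tau> ?p = 1 + m" "\<tau> ?q = 1 + m" using small' m by (simp_all add: tau_rs)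
  have cp: "center ?p \<in> AR" "\<tau> (center ?p) = 0" using p_AR by (auto intro: tau_center) (auto simp: center_def)
  have cq: "center ?q \<in> AY" "\<tau> (center ?q) = 0" using q_AY by (auto intro: tau_center) (auto simp: center_def)
  have "norm x \<le> cmod c * (norm (center ?p) * norm (center ?q))"
    by (simp add: x_def norm_smult mult_left_mono norm_mult_ineq)
  also have "\<dots> < cmod c * cmod (m * (1 + m))" using assms m by (intro mult_strict_left_mono) (auto simp: c_def)
  also have "\<dots> = 1" using m by (simp add: c_def norm_divide norm_mult)
  finally have nx: "norm x < 1" .
  have alt: "alternating (center ?q * x ^ n)" for n
  proof (induction n)
    case 0
    show ?case using cq by (simp add: alternating.base)
  next
    case (Suc n)
    \<comment> \<open>The scalar \<open>c\<close> is absorbed into the letter from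
      \<open>AR\<close>, so each power of \<open>x\<close> yields one alternating word.\<close>
    have "center ?q * x ^ Suc n = center ?q * ((c *\<^sub>C center ?p) * (center ?q * x ^ n))"
      by (simp add: x_def mult.assoc)
    also have "alternating \<dots>"
      by (rule alternating.step) (use Suc cp cq in \<open>auto simp: tau_smult AR_A\<close>)
    finally show ?case .
  qed
  have "alternating_series V"
    unfolding alternating_series_def V_def N_def neumann_def
    by (intro exI[of _ "\<lambda>n. center ?q * x ^ n"])
       (use alt neumann_summable[OF nx] in \<open>auto intro: summable_mult simp: suminf_mult\<close>)
  moreover have "rs (r * y) z = (1 + c *\<^sub>C ((?p - 1) * V)) * ?p"
  proof -
    have "N = 1 + x * N" unfolding N_def by (rule neumann_left[OF nx])
    then have N: "N = 1 + c *\<^sub>C (center ?p * V)" by (simp add: x_def V_def mult.assoc)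
    have "?q * N = center ?q * N + (1 + m) *\<^sub>C N"
      by (subst center_add[of ?q]) (simp only: t distrib_right mult_smult_left mult_1_left)
    then have "(c * m) *\<^sub>C (?q * N) = (c * m) *\<^sub>C (center ?q * N) + (c * m * (1 + m)) *\<^sub>C N"
      by (simp only: smult_add_right smult_smult)
    also have "\<dots> = (c * m) *\<^sub>C V + N" using m by (simp add: V_def c_def)
    \<comment> \<open>\<open>N\<close> contributes \<open>c\<close> times
      \<open>center ?p * V\<close>; adding the scalar \<open>m\<close> to \<open>center ?p\<close>
      gives \<open>?p - 1\<close>, because \<open>?p\<close> has trace \<open>1 + m\<close>.\<close>
    also have "\<dots> = 1 + c *\<^sub>C ((?p - 1) * V)"
      by (subst N) (simp add: center_def t algebra_simps smult_distribs)
    finally have T: "(c * m) *\<^sub>C (?q * N) = 1 + c *\<^sub>C ((?p - 1) * V)" .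
    let ?L = "1 - z *\<^sub>C (r * y)"
    have "(c * m) *\<^sub>C (?p * ?L * ?q) = c *\<^sub>C (m *\<^sub>C (?p * ?L * ?q))" by simp
    also have "\<dots> = 1 - x"
      unfolding centred_factorisation[OF small'(1,2) m(1,2) z] using m
      by (simp add: x_def c_def smult_distribs)
    finally have "(c * m) *\<^sub>C (?p * ?L * ?q) * N = (1 - x) * N" by simp
    also have "\<dots> = 1" using \<open>N = 1 + x * N\<close> by (simp add: algebra_simps)
    finally have "?p * ?L * ((c * m) *\<^sub>C (?q * N)) = 1" by (simp add: mult.assoc)
    then have 1: "?p * (?L * (1 + c *\<^sub>C ((?p - 1) * V))) = 1" by (simp only: T mult.assoc)
    \<comment> \<open>Multiplication by the inverse of \<open>?p\<close> on the left, and then by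
      \<open>?p\<close> on the right, turns the previous identity into a right inverse of
      \<open>?L\<close>; by uniqueness this is the Neumann series.\<close>
    have "(1 - \<omega>2 *\<^sub>C r) * (?p * (?L * (1 + c *\<^sub>C ((?p - 1) * V)))) = 1 - \<omega>2 *\<^sub>C r"
      by (simp only: 1) simp
    then have "?L * (1 + c *\<^sub>C ((?p - 1) * V)) = 1 - \<omega>2 *\<^sub>C r"
      by (simp only: mult.assoc[symmetric] rs_inverse_left[OF small'(2)]) (simp add: mult.assoc)
    then have "?L * (1 + c *\<^sub>C ((?p - 1) * V)) * ?p = 1"
      by (simp only: rs_inverse_left[OF small'(2)])
    then have "?L * ((1 + c *\<^sub>C ((?p - 1) * V)) * ?p) = 1" by (simp only: mult.assoc)
    from inverse_unique_monoid[OF rs_inverse_right[OF small'(3)] this] show ?thesis .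
  qed
  ultimately have "subordinate z \<omega>2 m c V"
    using small m by (simp add: subordinate_def)
  then show thesis by (rule that)
qed

text \<open>This is the conditional expectation of the resolvent onto the algebra of
  \<open>r\<close>, tested against \<open>g\<close>. Traciality moves the last
  \<open>rs r \<omega>\<close> to the front, and an element of \<open>AR\<close> times
  \<open>V\<close> has trace zero.\<close>

lemma subordinate_one_point:
  assumes "subordinate z \<omega> m c V" "g \<in> AR"
  shows "\<tau> (g * rs (r * y) z) = \<tau> (g * rs r \<omega>)"
proof -
  let ?p = "rs r \<omega>"
  have s: "cmod \<omega> * norm r < 1" "alternating_series V"
    and d: "rs (r * y) z = (1 + c *\<^sub>C ((?p - 1) * V)) * ?p"
    using assms(1) by (auto simp: subordinate_def)
  have p: "?p \<in> AR" using s r by (auto intro: R.rs_mem)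
  note m = p[THEN AR_A] assms(2)[THEN AR_A] alternating_series_mem[OF s(2)]
  have "\<tau> (g * rs (r * y) z) = \<tau> (g * ?p + c *\<^sub>C ((g * (?p - 1)) * V * ?p))"
    by (simp add: d distrib_left distrib_right mult.assoc)
  also have "\<dots> = \<tau> (g * ?p) + c * \<tau> (((g * (?p - 1)) * V) * ?p)"
    using m by (simp add: tau_add tau_smult mult_mem smult_mem diff_mem)
  also have "\<tau> (((g * (?p - 1)) * V) * ?p) = \<tau> ((?p * (g * (?p - 1))) * V)"
    using m by (subst tau_commute) (auto simp: mult.assoc)
  also have "\<dots> = 0"
    by (rule tau_mult_series[OF s(2)]) (use p assms(2) in auto)
  finally show ?thesis by simp
qed

lemma subordinate_mom:
  assumes "subordinate z \<omega> m c V"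
  shows "mom (r * y) z = m"
proof -
  have s: "cmod z * norm (r * y) < 1" "cmod \<omega> * norm r < 1" "mom r \<omega> = m"
    using assms by (auto simp: subordinate_def)
  have "\<tau> (rs (r * y) z) = \<tau> (rs r \<omega>)"
    using subordinate_one_point[OF assms R.one_mem] by simp
  then show ?thesis using s by (simp add: tau_rs mult_mem)
qed

text \<open>The scalar \<open>C\<close> is fixed before \<open>g1\<close> and \<open>g2\<close>, so
  one choice of these can determine it for all. It is
  \<open>c * c' * \<omega> * \<omega>' * \<tau> (V * V')\<close>; the two terms that contain a
  single series vanish.\<close>

lemma subordinate_two_point_aux:
  assumes z: "subordinate z \<omega> m c V" and w: "subordinate w \<omega>' m' c' V'"
  obtains C where "\<And>g1 g2. g1 \<in> AR \<Longrightarrow> g2 \<in> AR \<Longrightarrow>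
    \<tau> (g1 * rs (r * y) z * g2 * rs (r * y) w) =
    \<tau> (g1 * g2 * rs r \<omega> * rs r \<omega>') +
    C * \<tau> (r * g1 * rs r \<omega> * rs r \<omega>') * \<tau> (r * g2 * rs r \<omega> * rs r \<omega>')"
proof
  let ?p = "rs r \<omega>" and ?p' = "rs r \<omega>'"
  have s: "cmod \<omega> * norm r < 1" "cmod \<omega>' * norm r < 1" "alternating_series V" "alternating_series V'"
    and d: "rs (r * y) z = (1 + c *\<^sub>C ((?p - 1) * V)) * ?p"
      "rs (r * y) w = (1 + c' *\<^sub>C ((?p' - 1) * V')) * ?p'"
    using assms by (auto simp: subordinate_def)
  have p: "?p \<in> AR" "?p' \<in> AR" using s r by (auto intro: R.rs_mem)
  have VA: "V \<in> A" "V' \<in> A" using s by (auto intro: alternating_series_mem)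
  have pm: "?p - 1 = \<omega> *\<^sub>C (r * ?p)" "?p' - 1 = \<omega>' *\<^sub>C (r * ?p')"
    using rs_left[OF s(1)] rs_left[OF s(2)] by (simp_all add: algebra_simps)
  fix g1 g2 assume g: "g1 \<in> AR" "g2 \<in> AR"
  \<comment> \<open>Traciality moves the last \<open>?p'\<close> to the front. So \<open>g1\<close>
    receives \<open>?p'\<close> and \<open>g2\<close> receives \<open>?p\<close>, and
    \<open>?p - 1\<close>, \<open>?p' - 1\<close> supply the missing partner together with a factor
    \<open>r\<close>: both traces become symmetric in the two resolvents.\<close>
  define a where "a = ?p' * g1"
  define b where "b = ?p * g2"
  define \<alpha> where "\<alpha> = a * (?p - 1)"
  define \<beta> where "\<beta> = b * (?p' - 1)"
  have AR': "a \<in> AR" "b \<in> AR" "\<alpha> \<in> AR" "\<beta> \<in> AR"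
    using p g by (auto simp: a_def b_def \<alpha>_def \<beta>_def)
  note mem = AR'[THEN AR_A] VA p[THEN AR_A] g[THEN AR_A]
  have comm: "?p * ?p' = ?p' * ?p" "r * ?p = ?p * r" "r * ?p' = ?p' * r" "r * g1 = g1 * r" "r * g2 = g2 * r"
    "?p * g1 = g1 * ?p" "?p' * g1 = g1 * ?p'" "?p * g2 = g2 * ?p" "?p' * g2 = g2 * ?p'"
    using AR_commute p g r by blast+
  define T where "T = a * (1 + c *\<^sub>C ((?p - 1) * V)) * b * (1 + c' *\<^sub>C ((?p' - 1) * V'))"
  have TA: "g1 * rs (r * y) z * g2 * (1 + c' *\<^sub>C ((?p' - 1) * V')) \<in> A"
    unfolding d using mem by (intro mult_mem add_mem smult_mem diff_mem) auto
  have "\<tau> (g1 * rs (r * y) z * g2 * rs (r * y) w) =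
      \<tau> ((g1 * rs (r * y) z * g2 * (1 + c' *\<^sub>C ((?p' - 1) * V'))) * ?p')"
    by (simp only: d mult.assoc)
  also have "\<dots> = \<tau> (?p' * (g1 * rs (r * y) z * g2 * (1 + c' *\<^sub>C ((?p' - 1) * V'))))"
    by (rule tau_commute[OF TA mem(8)])
  also have "\<dots> = \<tau> T" by (simp only: T_def d a_def b_def mult.assoc)
  also have "T = a * b + c *\<^sub>C (\<alpha> * V * b) + c' *\<^sub>C (a * \<beta> * V') + (c * c') *\<^sub>C (\<alpha> * V * \<beta> * V')"
  proof -
    have "a * (1 + c *\<^sub>C (u * V)) * b * (1 + c' *\<^sub>C (v * V')) =
      a * b + c *\<^sub>C (a * u * V * b) + c' *\<^sub>C (a * (b * v) * V') + (c * c') *\<^sub>C (a * u * V * (b * v) * V')"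
      for u v by (simp add: algebra_simps smult_distribs)
    then show ?thesis by (simp only: T_def \<alpha>_def \<beta>_def)
  qed
  also have "\<tau> \<dots> = \<tau> (a * b) + c * \<tau> (\<alpha> * V * b) + c' * \<tau> (a * \<beta> * V') + c * c' * \<tau> (\<alpha> * V * \<beta> * V')"
    using mem by (simp add: tau_add tau_smult add_mem mult_mem smult_mem)
  also have "\<tau> (\<alpha> * V * b) = \<tau> (b * \<alpha> * V)"
    using mem by (subst tau_commute) (auto simp: mult.assoc)
  also have "\<tau> (b * \<alpha> * V) = 0" by (rule tau_mult_series) (use s AR' in auto)
  also have "\<tau> (a * \<beta> * V') = 0" by (rule tau_mult_series) (use s AR' in auto)
  also have "\<tau> (\<alpha> * V * \<beta> * V') = \<tau> \<alpha> * \<tau> \<beta> * \<tau> (V * V')" by (rule tau_two_series) (use s AR' in auto)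
  also have "a * b = g1 * g2 * ?p * ?p'"
    unfolding a_def b_def by (metis comm mult.assoc)
  also have "\<alpha> = \<omega> *\<^sub>C (r * g1 * ?p * ?p')"
    unfolding \<alpha>_def a_def pm mult_smult_right by (metis comm mult.assoc)
  also have "\<beta> = \<omega>' *\<^sub>C (r * g2 * ?p * ?p')"
    unfolding \<beta>_def b_def pm mult_smult_right by (metis comm mult.assoc)
  finally show "\<tau> (g1 * rs (r * y) z * g2 * rs (r * y) w) =
    \<tau> (g1 * g2 * ?p * ?p') + (c * c' * \<omega> * \<omega>' * \<tau> (V * V')) *
      \<tau> (r * g1 * ?p * ?p') * \<tau> (r * g2 * ?p * ?p')"
    using mem by (simp add: tau_smult mult_mem algebra_simps)
qed

lemma subordinate_two_point:
  assumes z: "subordinate z \<omega> m c V" and w: "subordinate w \<omega>' m' c' V'"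
    and g: "g1 \<in> AR" "g2 \<in> AR" and neq: "z \<noteq> w"
    and B: "\<tau> (r * rs r \<omega> * rs r \<omega>') \<noteq> 0"
  shows "\<tau> (g1 * rs (r * y) z * g2 * rs (r * y) w) =
    \<tau> (g1 * g2 * rs r \<omega> * rs r \<omega>') +
    (w * \<omega> - z * \<omega>') / (z - w) *
      (\<tau> (r * g1 * rs r \<omega> * rs r \<omega>') * \<tau> (r * g2 * rs r \<omega> * rs r \<omega>') / \<tau> (r * rs r \<omega> * rs r \<omega>'))"
proof -
  let ?p = "rs r \<omega>" and ?p' = "rs r \<omega>'" and ?s = "rs (r * y) z" and ?t = "rs (r * y) w"
  let ?B = "\<tau> (r * ?p * ?p')"
  have s: "cmod \<omega> * norm r < 1" "cmod \<omega>' * norm r < 1"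
    "cmod z * norm (r * y) < 1" "cmod w * norm (r * y) < 1" "mom r \<omega> = m" "mom r \<omega>' = m'"
    using z w by (auto simp: subordinate_def)
  have mem: "?p \<in> A" "?p' \<in> A" "?s \<in> A" "?t \<in> A" using s by (auto simp: rs_mem mult_mem)
  obtain C where C: "\<And>g1 g2. g1 \<in> AR \<Longrightarrow> g2 \<in> AR \<Longrightarrow>
    \<tau> (g1 * ?s * g2 * ?t) = \<tau> (g1 * g2 * ?p * ?p') +
      C * \<tau> (r * g1 * ?p * ?p') * \<tau> (r * g2 * ?p * ?p')"
    using subordinate_two_point_aux[OF z w] by blast
  have C1: "\<tau> (?s * ?t) = \<tau> (?p * ?p') + C * ?B * ?B" using C[of 1 1] by simp
  have mm: "m - m' = (\<omega> - \<omega>') * ?B"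
    using mom_diff[OF r_A s(1,2)] s(5,6) by simp
  have "?p' = 1 + \<omega>' *\<^sub>C (r * ?p')" by (rule rs_left[OF s(2)])
  then have "?p * ?p' = ?p * (1 + \<omega>' *\<^sub>C (r * ?p'))" by simp
  also have "\<dots> = ?p + \<omega>' *\<^sub>C (r * ?p * ?p')"
    by (simp add: distrib_left rs_commute_self[OF s(1)] mult.assoc[symmetric])
  finally have pp: "\<tau> (?p * ?p') = 1 + m + \<omega>' * ?B"
    using mem s by (simp add: tau_add tau_smult tau_rs mult_mem smult_mem)
  \<comment> \<open>The resolvent identity for \<open>r * y\<close>, multiplied by \<open>z\<close>,
    with \<open>z r y ?s\<close> replaced by \<open>?s - 1\<close>. It expresses the two-point trace
    for \<open>g1 = g2 = 1\<close> by moment transforms.\<close>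
  have "(z - w) *\<^sub>C (?s * ?t) = z *\<^sub>C ?s - w *\<^sub>C ?t"
  proof -
    have zs: "z *\<^sub>C (r * y * ?s) = ?s - 1" using rs_left[OF s(3)] by (simp add: algebra_simps)
    have "z *\<^sub>C (?s - ?t) = (z - w) *\<^sub>C (z *\<^sub>C (r * y * ?s) * ?t)"
      by (subst resolvent_identity[OF s(3,4)]) (simp add: mult_ac)
    also have "\<dots> = (z - w) *\<^sub>C (?s * ?t) - (z - w) *\<^sub>C ?t"
      by (simp only: zs) (simp add: left_diff_distrib smult_distribs)
    finally show ?thesis by (simp add: smult_distribs algebra_simps)
  qed
  then have "\<tau> ((z - w) *\<^sub>C (?s * ?t)) = \<tau> (z *\<^sub>C ?s - w *\<^sub>C ?t)" by simp
  then have "(z - w) * \<tau> (?s * ?t) = z * (1 + m) - w * (1 + m')"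
    using mem s subordinate_mom[OF z] subordinate_mom[OF w]
    by (simp add: tau_smult tau_diff tau_rs mult_mem smult_mem)
  \<comment> \<open>Inserting \<open>m - m' = (\<omega> - \<omega>') * ?B\<close> exhibits a common
    factor \<open>?B\<close>; after cancellation one \<open>?B\<close> remains in the denominator of
    \<open>C\<close>.\<close>
  then have "(z - w) * (C * ?B * ?B) = ?B * (w * \<omega> - z * \<omega>')"
    unfolding C1 pp using mm by algebra
  then have "(z - w) * (C * ?B) = w * \<omega> - z * \<omega>'" using B by simp
  then have "C = (w * \<omega> - z * \<omega>') / (z - w) / ?B" using neq B by (simp add: field_simps)
  then show ?thesis using C[OF g] by simp
qed

end

text \<open>The excluded pairs are those where the construction breaks down: \<open>z = w\<close>
  leaves the scalar undetermined, and a zero coordinate means \<open>m = 0\<close>, by which it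
  divides. Nonempty open subsets of the plane are infinite, so every open box contains an admissible
  pair.\<close>

lemma eq_on_square_by_density:
  fixes F G :: "complex \<times> complex \<Rightarrow> 'b::real_normed_vector"
  assumes D: "open D" and cont: "continuous_on (D \<times> D) F" "continuous_on (D \<times> D) G"
    and eq: "\<And>z w. z \<in> D \<Longrightarrow> w \<in> D \<Longrightarrow> z \<noteq> w \<Longrightarrow> z \<noteq> 0 \<Longrightarrow> w \<noteq> 0 \<Longrightarrow> F (z, w) = G (z, w)"
    and p: "p \<in> D \<times> D"
  shows "F p = G p"
proof (rule ccontr)
  assume neq: "F p \<noteq> G p"
  have "open ((D \<times> D) \<inter> (\<lambda>p. F p - G p) -` (- {0}))"
    by (intro continuous_open_preimage continuous_on_diff cont open_Times D) auto
  moreover have "p \<in> (D \<times> D) \<inter> (\<lambda>p. F p - G p) -` (- {0})" using p neq by simp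
  ultimately obtain S T where ST: "open S" "open T" "p \<in> S \<times> T"
    "S \<times> T \<subseteq> (D \<times> D) \<inter> (\<lambda>p. F p - G p) -` (- {0})"
    by (rule open_prod_elim)
  have "S \<noteq> {}" "T \<noteq> {}" using ST(3) by auto
  then have inf: "infinite S" "infinite T"
    using ST(1,2) finite_imp_not_open by blast+
  have "S - {0} \<noteq> {}"
    by (rule infinite_imp_nonempty[OF Diff_infinite_finite[OF _ inf(1)]]) simp
  then obtain z where z: "z \<in> S" "z \<noteq> 0" by auto
  have "T - {0, z} \<noteq> {}"
    by (rule infinite_imp_nonempty[OF Diff_infinite_finite[OF _ inf(2)]]) simp
  then obtain w where w: "w \<in> T" "w \<notin> {0, z}" by auto
  have "(z, w) \<in> S \<times> T" using z w by simp
  with ST(4) have "(z, w) \<in> D \<times> D" "F (z, w) \<noteq> G (z, w)" by auto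
  then show False using eq z w by auto
qed

section \<open>Passage from \<open>r * y\<close> to the symmetric product
  \<open>x * y * x\<close>\<close>

context tracial_algebra
begin

text \<open>\<open>u = x y x\<close> and \<open>v = x\<^sup>2 y\<close> have intertwined resolvents: \<open>(1 - z v)\<^sup>-\<^sup>1 x = x (1 - z u)\<^sup>-\<^sup>1\<close>.\<close>

lemma conjugate_resolvents:
  fixes x y
  defines "u \<equiv> x * y * x" and "v \<equiv> x * x * y"
  assumes mem: "x \<in> A" "y \<in> A" "g1 \<in> A" "g2 \<in> A"
    and comm: "g1 * x = x * g1" "g2 * x = x * g2"
    and small: "cmod z * norm u < 1" "cmod z * norm v < 1" "cmod w * norm u < 1" "cmod w * norm v < 1"
  shows "\<tau> (g1 * rs u z * g2 * rs u w) = \<tau> (g1 * rs v z * g2 * rs v w)"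
proof -
  have uv: "u \<in> A" "v \<in> A" using mem by (auto simp: u_def v_def)
  \<comment> \<open>One \<open>h\<close> serves both resolvents, which then differ only in the
    position of an \<open>x\<close>. Their traces agree after this \<open>x\<close> is carried
    around the trace and past \<open>g1\<close> and \<open>g2\<close>.\<close>
  have *: "\<exists>h\<in>A. rs u z = 1 + x * h * x \<and> rs v z = 1 + x * x * h"
    if small: "cmod z * norm u < 1" "cmod z * norm v < 1" for z
  proof (intro bexI conjI)
    have "(1 - z *\<^sub>C v) * x * rs u z = x * ((1 - z *\<^sub>C u) * rs u z)"
      by (simp add: u_def v_def algebra_simps)
    then have "rs v z * ((1 - z *\<^sub>C v) * x * rs u z) = rs v z * x"
      by (simp add: rs_inverse_left[OF small(1)])
    then have t: "x * rs u z = rs v z * x"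
      by (simp only: mult.assoc[symmetric] rs_inverse_right[OF small(2)]) simp
    have "rs u z = 1 + z *\<^sub>C (u * rs u z)" by (rule rs_left[OF small(1)])
    also have "u * rs u z = x * y * (x * rs u z)" by (simp add: u_def mult.assoc)
    also have "\<dots> = x * y * rs v z * x" by (simp only: t mult.assoc)
    finally show "rs u z = 1 + x * (z *\<^sub>C (y * rs v z)) * x" by (simp add: mult.assoc)
    have "rs v z = 1 + z *\<^sub>C (v * rs v z)" by (rule rs_left[OF small(2)])
    then show "rs v z = 1 + x * x * (z *\<^sub>C (y * rs v z))" by (simp add: v_def mult.assoc)
    show "z *\<^sub>C (y * rs v z) \<in> A" using mem uv small by (intro smult_mem mult_mem rs_mem) auto
  qed
  obtain h where h: "h \<in> A" "rs u z = 1 + x * h * x" "rs v z = 1 + x * x * h"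
    using *[OF small(1,2)] by blast
  obtain k where k: "k \<in> A" "rs u w = 1 + x * k * x" "rs v w = 1 + x * x * k"
    using *[OF small(3,4)] by blast
  note m = mem h(1) k(1)
  have c: "x * g1 = g1 * x" "x * g2 = g2 * x" using comm by auto
  have cr: "x * (g1 * b) = g1 * (x * b)" "x * (g2 * b) = g2 * (x * b)" for b
    by (simp_all add: c mult.assoc[symmetric])
  have 1: "\<tau> (g1 * (x * h * x) * g2) = \<tau> (g1 * (x * x * h) * g2)"
  proof -
    have "\<tau> (g1 * (x * h * x) * g2) = \<tau> ((g1 * x * h) * (x * g2))" by (simp add: mult.assoc)
    also have "\<dots> = \<tau> ((x * g2) * (g1 * x * h))" using m by (intro tau_commute mult_mem)
    also have "\<dots> = \<tau> (g2 * (g1 * (x * x * h)))" by (simp add: mult.assoc c cr)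
    also have "\<dots> = \<tau> (g1 * (x * x * h) * g2)" using m by (intro tau_commute mult_mem)
    finally show ?thesis .
  qed
  have 2: "\<tau> (g1 * g2 * (x * k * x)) = \<tau> (g1 * g2 * (x * x * k))"
  proof -
    have "\<tau> (g1 * g2 * (x * k * x)) = \<tau> ((g1 * g2 * x * k) * x)" by (simp add: mult.assoc)
    also have "\<dots> = \<tau> (x * (g1 * g2 * x * k))" using m by (intro tau_commute mult_mem)
    finally show ?thesis by (simp add: mult.assoc c cr)
  qed
  have 3: "\<tau> (g1 * (x * h * x) * g2 * (x * k * x)) = \<tau> (g1 * (x * x * h) * g2 * (x * x * k))"
  proof -
    have "\<tau> (g1 * (x * h * x) * g2 * (x * k * x)) = \<tau> ((g1 * (x * h * x) * g2 * x * k) * x)"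
      by (simp add: mult.assoc)
    also have "\<dots> = \<tau> (x * (g1 * (x * h * x) * g2 * x * k))" using m by (intro tau_commute mult_mem)
    finally show ?thesis by (simp add: mult.assoc c cr)
  qed
  have expand: "g1 * (1 + a) * g2 * (1 + b) = g1 * g2 + g1 * a * g2 + g1 * g2 * b + g1 * a * g2 * b" for a b
    by (simp add: algebra_simps)
  have t: "\<tau> (g1 * (1 + a) * g2 * (1 + b)) =
      \<tau> (g1 * g2) + \<tau> (g1 * a * g2) + \<tau> (g1 * g2 * b) + \<tau> (g1 * a * g2 * b)"
    if "a \<in> A" "b \<in> A" for a b
    unfolding expand using m that by (simp add: tau_add mult_mem add_mem)
  have "\<tau> (g1 * rs u z * g2 * rs u w) =
      \<tau> (g1 * g2) + \<tau> (g1 * (x * h * x) * g2) + \<tau> (g1 * g2 * (x * k * x)) +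
      \<tau> (g1 * (x * h * x) * g2 * (x * k * x))"
    unfolding h(2) k(2) using m by (intro t mult_mem)
  also have "\<dots> = \<tau> (g1 * rs v z * g2 * rs v w)"
    unfolding 1 2 3 h(3) k(3) using m by (intro t[symmetric] mult_mem)
  finally show ?thesis .
qed

lemma conjugate_mom:
  assumes "x \<in> A" "y \<in> A" "cmod z * norm (x * y * x) < 1" "cmod z * norm (x * x * y) < 1"
  shows "mom (x * y * x) z = mom (x * x * y) z"
  \<comment> \<open>At \<open>w = 0\<close> the second resolvent is 1, so this compares traces of
    single resolvents.\<close>
  using conjugate_resolvents[of x y 1 1 z 0] assms
  by (simp add: tau_rs mult_mem)

end

text \<open>\<open>x\<close> stands for the square root of \<open>r\<close>; the conjugation
  argument needs its commutation with \<open>AR\<close>. The nonzero traces will come from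
  faithfulness and make the moment transforms invertible at 0.\<close>

locale free_pair_sqrt = free_pair A \<tau> K AR AY r y
  for A :: "'a::complex_banach_algebra set" and \<tau> K AR AY r y +
  fixes x :: 'a
  assumes x: "x \<in> A" "x * x = r" and x_commute: "a \<in> AR \<Longrightarrow> a * x = x * a"
    and nonzero: "\<tau> r \<noteq> 0" "\<tau> y \<noteq> 0"
begin

text \<open>\<open>center y\<close> is an alternating word, so \<open>center r * center y\<close>
  has trace zero. The product formula makes \<open>\<tau> (r * y)\<close> nonzero, as the local
  inverse of \<open>mom (r * y)\<close> requires.\<close>

lemma tau_ry: "\<tau> (r * y) = \<tau> r * \<tau> y"
proof -
  interpret R: closed_subalgebra AR by (rule AR)
  interpret Y: closed_subalgebra AY by (rule AY)
  have c: "center r \<in> AR" "center y \<in> AY" using r y by (auto simp: center_def)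
  have "alternating (center y)" by (rule alternating.base[OF c(2) tau_center[OF y_A]])
  then have "\<tau> (center r * center y) = 0"
    using c by (intro tau_centred_alternating) (auto intro: tau_center)
  moreover have "center r * center y = r * y - \<tau> r *\<^sub>C y - \<tau> y *\<^sub>C r + (\<tau> r * \<tau> y) *\<^sub>C 1"
    by (simp add: center_def algebra_simps smult_distribs)
  ultimately show ?thesis
    by (simp add: tau_add tau_diff tau_smult smult_mem mult_mem diff_mem)
qed

text \<open>For small \<open>m \<noteq> 0\<close> the local inverses of the moment transforms of \<open>r\<close> and \<open>y\<close> produce a
  point \<open>z = \<omega>\<^sub>1 \<omega>\<^sub>2 (1 + m) / m\<close> at which the moment transform of \<open>r y\<close> equals \<open>m\<close>
  (multiplicativity of the S-transform); injectivity near \<open>0\<close> shows that every small \<open>z\<close> arises.\<close>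

lemma local_subordination:
  obtains \<delta> \<epsilon> \<omega> where "0 < \<delta>" "0 < \<epsilon>" "inj_on (mom r) (ball 0 \<delta>)"
    "\<omega> holomorphic_on ball 0 \<epsilon>" "\<omega> 0 = 0" "mom (r * y) holomorphic_on ball 0 \<epsilon>"
    "\<forall>z\<in>ball 0 \<epsilon>. \<omega> z \<in> ball 0 \<delta>"
    "\<forall>z\<in>ball 0 \<epsilon>. mom r (\<omega> z) = mom (r * y) z"
    "\<forall>z\<in>ball 0 \<epsilon>. cmod z * norm (r * y) \<le> 1 / 2"
    "\<forall>z\<in>ball 0 \<epsilon>. cmod (\<omega> z) * norm r \<le> 1 / 2"
    "\<forall>z\<in>ball 0 \<epsilon>. \<forall>w\<in>ball 0 \<epsilon>. \<tau> (r * rs r (\<omega> z) * rs r (\<omega> w)) \<noteq> 0"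
    "inj_on (mom (r * y)) (ball 0 \<epsilon>)"
    "\<forall>z\<in>ball 0 \<epsilon>. z \<noteq> 0 \<longrightarrow> (\<exists>m c V. subordinate z (\<omega> z) m c V)"
    "\<forall>z\<in>ball 0 \<delta>. cmod z * norm r \<le> 1 / 2"
proof -
  obtain \<delta> \<rho> g where R: "0 < \<delta>" "0 < \<rho>"
    "\<forall>z\<in>ball 0 \<delta>. cmod z * norm r \<le> 1 / 2"
    "\<forall>z\<in>ball 0 \<delta>. \<forall>w\<in>ball 0 \<delta>. \<tau> (r * rs r z * rs r w) \<noteq> 0"
    "inj_on (mom r) (ball 0 \<delta>)" "mom r holomorphic_on ball 0 \<delta>"
    "g holomorphic_on ball 0 \<rho>"
    "\<forall>m\<in>ball 0 \<rho>. g m \<in> ball 0 \<delta>"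
    "\<forall>m\<in>ball 0 \<rho>. mom r (g m) = m"
    "\<forall>m\<in>ball 0 \<rho>. cmod (g m) \<le> 2 / cmod (\<tau> r) * cmod m"
    by (rule mom_local_inverse[OF r_A nonzero(1)])
  note R = R[rule_format]
  obtain \<delta>' \<rho>' g' where Y: "0 < \<delta>'" "0 < \<rho>'"
    "\<forall>z\<in>ball 0 \<delta>'. cmod z * norm y \<le> 1 / 2"
    "\<forall>z\<in>ball 0 \<delta>'. \<forall>w\<in>ball 0 \<delta>'. \<tau> (y * rs y z * rs y w) \<noteq> 0"
    "inj_on (mom y) (ball 0 \<delta>')" "mom y holomorphic_on ball 0 \<delta>'"
    "g' holomorphic_on ball 0 \<rho>'"
    "\<forall>m\<in>ball 0 \<rho>'. g' m \<in> ball 0 \<delta>'"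
    "\<forall>m\<in>ball 0 \<rho>'. mom y (g' m) = m"
    "\<forall>m\<in>ball 0 \<rho>'. cmod (g' m) \<le> 2 / cmod (\<tau> y) * cmod m"
    by (rule mom_local_inverse[OF y_A nonzero(2)])
  note Y = Y[rule_format]
  have ry: "r * y \<in> A" "\<tau> (r * y) \<noteq> 0" using nonzero by (auto simp: tau_ry mult_mem)
  obtain \<delta>u \<rho>u gu where U: "0 < \<delta>u" "0 < \<rho>u"
    "\<forall>z\<in>ball 0 \<delta>u. cmod z * norm (r * y) \<le> 1 / 2"
    "\<forall>z\<in>ball 0 \<delta>u. \<forall>w\<in>ball 0 \<delta>u. \<tau> ((r * y) * rs (r * y) z * rs (r * y) w) \<noteq> 0"
    "inj_on (mom (r * y)) (ball 0 \<delta>u)" "mom (r * y) holomorphic_on ball 0 \<delta>u"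
    "gu holomorphic_on ball 0 \<rho>u"
    "\<forall>m\<in>ball 0 \<rho>u. gu m \<in> ball 0 \<delta>u"
    "\<forall>m\<in>ball 0 \<rho>u. mom (r * y) (gu m) = m"
    "\<forall>m\<in>ball 0 \<rho>u. cmod (gu m) \<le> 2 / cmod (\<tau> (r * y)) * cmod m"
    by (rule mom_local_inverse[OF ry])
  note U = U[rule_format]
  define C where "C = 2 / cmod (\<tau> r)"
  define C' where "C' = 2 / cmod (\<tau> y)"
  define D where "D = ((2 + 2 * K) * norm r * C) * ((2 + 2 * K) * norm y * C')"
  \<comment> \<open>Sources of the bounds on \<open>cmod m\<close>: the domains of \<open>g\<close>
    and \<open>g'\<close>; 1/2 puts \<open>cmod (1 + m)\<close> between 1/2 and 2; the fourth keeps
    \<open>z\<close>, of modulus at most \<open>2 * C * C' * cmod m\<close>, in the ball of radius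
    \<open>\<delta>u\<close>; the last makes the centred product, at most
    \<open>D * (cmod m)\<^sup>2\<close>, smaller than \<open>cmod m / 2\<close>.\<close>
  define \<mu> where "\<mu> = Min {\<rho>, \<rho>', 1 / 2, \<delta>u / (2 * C * C'), 1 / (2 * (D + 1))}"
  have C0: "0 < C" "0 < C'" using nonzero by (auto simp: C_def C'_def)
  then have D0: "0 \<le> D" unfolding D_def using K_pos by (intro mult_nonneg_nonneg) auto
  have "0 < \<mu>" using R(2) Y(2) U(1) C0 D0 by (simp add: \<mu>_def)
  have \<mu>: "\<mu> \<le> \<rho>" "\<mu> \<le> \<rho>'" "\<mu> \<le> 1 / 2" "\<mu> \<le> \<delta>u / (2 * C * C')" "\<mu> \<le> 1 / (2 * (D + 1))"
    by (simp_all add: \<mu>_def)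
  have main: "\<exists>z c V. z \<in> ball 0 \<delta>u \<and> subordinate z (g m) m c V"
    if m: "m \<noteq> 0" "cmod m < \<mu>" for m
  proof -
    have mb: "m \<in> ball 0 \<rho>" "m \<in> ball 0 \<rho>'" "cmod m < 1 / 2" using m \<mu> by auto
    have m1: "1 / 2 \<le> cmod (1 + m)" "cmod (1 + m) \<le> 2" "1 + m \<noteq> 0"
      using norm_triangle_ineq4[of "1 + m" m] norm_triangle_ineq[of 1 m] mb(3) by auto
    define z where "z = g' m * g m * (1 + m) / m"
    have g: "cmod (g m) \<le> C * cmod m" "cmod (g' m) \<le> C' * cmod m"
      using R(10) Y(10) mb by (auto simp: C_def C'_def)
    have "cmod z = cmod (g' m) * cmod (g m) * cmod (1 + m) / cmod m"
      by (simp add: z_def norm_mult norm_divide)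
    also have "\<dots> \<le> (C' * cmod m) * (C * cmod m) * 2 / cmod m"
      using g m1 C0 by (intro divide_right_mono mult_mono) auto
    also have "\<dots> = 2 * C * C' * cmod m" using m by simp
    also have "\<dots> < \<delta>u"
    proof -
      have "cmod m < \<delta>u / (2 * C * C')" using m(2) \<mu>(4) by linarith
      then have "cmod m * (2 * C * C') < \<delta>u"
        using C0 by (subst (asm) pos_less_divide_eq) auto
      then show ?thesis by (simp only: mult.commute)
    qed
    finally have z: "z \<in> ball 0 \<delta>u" by simp
    have gb: "g m \<in> ball 0 \<delta>" "g' m \<in> ball 0 \<delta>'" using R(8) Y(8) mb by auto
    have "norm (center (rs r (g m))) * norm (center (rs y (g' m))) \<le>
        ((2 + 2 * K) * norm r * cmod (g m)) * ((2 + 2 * K) * norm y * cmod (g' m))"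
      using gb R(3) Y(3) K_pos by (intro mult_mono norm_center_rs_le) auto
    also have "\<dots> \<le> ((2 + 2 * K) * norm r * (C * cmod m)) * ((2 + 2 * K) * norm y * (C' * cmod m))"
      using g K_pos C0 by (intro mult_mono) auto
    also have "\<dots> = (D * cmod m) * cmod m" by (simp add: D_def mult_ac)
    also have "\<dots> < 1 / 2 * cmod m"
    proof (rule mult_strict_right_mono)
      have "cmod m < 1 / (2 * (D + 1))" using m \<mu> by simp
      then have "(D + 1) * cmod m < 1 / 2" using D0 by (simp add: field_simps)
      then have "D * cmod m + cmod m < 1 / 2" by (simp only: distrib_right mult_1_left)
      then show "D * cmod m < 1 / 2" using norm_ge_zero[of m] by linarith
    qed (use m in simp)
    also have "\<dots> \<le> cmod (m * (1 + m))"
      using mult_right_mono[OF m1(1), of "cmod m"] by (simp add: norm_mult mult.commute)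
    finally have x: "norm (center (rs r (g m))) * norm (center (rs y (g' m))) < cmod (m * (1 + m))" .
    have rel: "g' m * g m * (1 + m) = z * m" using m by (simp add: z_def)
    have "\<exists>c V. subordinate z (g m) m c V"
      by (rule subordinate_exists[OF Y(3)[OF gb(2)] R(3)[OF gb(1)] U(3)[OF z] Y(9)[OF mb(2)]
            R(9)[OF mb(1)] m(1) m1(3) rel x]) blast
    then show ?thesis using z by blast
  qed
  define S where "S = ball 0 \<delta>u \<inter> mom (r * y) -` ball 0 \<mu>"
  have "open S" unfolding S_def
    by (intro continuous_open_preimage holomorphic_on_imp_continuous_on U(6)) auto
  moreover have "0 \<in> S" using U(1) \<open>0 < \<mu>\<close> by (simp add: S_def)
  ultimately obtain \<epsilon> where e: "0 < \<epsilon>" "ball 0 \<epsilon> \<subseteq> S" by (metis openE)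
  define \<omega> where "\<omega> z = g (mom (r * y) z)" for z
  have in_u: "z \<in> ball 0 \<delta>u" and in_r: "mom (r * y) z \<in> ball 0 \<rho>" and in_m: "cmod (mom (r * y) z) < \<mu>"
    if "z \<in> ball 0 \<epsilon>" for z
  proof -
    have "z \<in> S" using e(2) that by blast
    then show "z \<in> ball 0 \<delta>u" "mom (r * y) z \<in> ball 0 \<rho>" "cmod (mom (r * y) z) < \<mu>"
      using \<mu>(1) by (auto simp: S_def)
  qed
  show thesis
  proof (rule that[of \<delta> \<epsilon> \<omega>]; (intro ballI impI)?)
    show hu: "mom (r * y) holomorphic_on ball 0 \<epsilon>"
      by (rule holomorphic_on_subset[OF U(6)]) (use in_u in blast)
    have "g \<circ> mom (r * y) holomorphic_on ball 0 \<epsilon>"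
      by (rule holomorphic_on_compose_gen[OF hu R(7)]) (use in_r in blast)
    then show "\<omega> holomorphic_on ball 0 \<epsilon>" by (simp add: \<omega>_def[abs_def] o_def)
    show "\<omega> 0 = 0" using R(10)[of 0] R(2) by (simp add: \<omega>_def)
    show "inj_on (mom (r * y)) (ball 0 \<epsilon>)" by (rule inj_on_subset[OF U(5)]) (use in_u in blast)
    show "cmod z * norm r \<le> 1 / 2" if "z \<in> ball 0 \<delta>" for z by (rule R(3)[OF that])
    fix z :: complex assume z: "z \<in> ball 0 \<epsilon>"
    show \<omega>: "\<omega> z \<in> ball 0 \<delta>" using R(8) in_r[OF z] by (simp add: \<omega>_def)
    show "mom r (\<omega> z) = mom (r * y) z" using R(9) in_r[OF z] by (simp add: \<omega>_def)
    show "cmod z * norm (r * y) \<le> 1 / 2" by (rule U(3)[OF in_u[OF z]])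
    show "cmod (\<omega> z) * norm r \<le> 1 / 2" by (rule R(3)[OF \<omega>])
    show "\<exists>m c V. subordinate z (\<omega> z) m c V" if "z \<noteq> 0"
    proof -
      \<comment> \<open>\<open>mom (r * y)\<close> is injective and vanishes at 0, so the parameter
        \<open>m\<close> belonging to \<open>z\<close> is nonzero and \<open>main\<close> applies to
        it.\<close>
      have "mom (r * y) z \<noteq> mom (r * y) 0"
        using inj_onD[OF U(5), of z 0] that in_u[OF z] U(1) by auto
      then obtain z' c V where z': "z' \<in> ball 0 \<delta>u"
        "subordinate z' (\<omega> z) (mom (r * y) z) c V"
        using main[of "mom (r * y) z"] in_m[OF z] by (auto simp: \<omega>_def)
      have "z' = z"
        by (rule inj_onD[OF U(5) subordinate_mom[OF z'(2)] z'(1) in_u[OF z]])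
      then show ?thesis using z'(2) by blast
    qed
    fix w :: complex assume w: "w \<in> ball 0 \<epsilon>"
    have "\<omega> w \<in> ball 0 \<delta>" using R(8) in_r[OF w] by (simp add: \<omega>_def)
    then show "\<tau> (r * rs r (\<omega> z) * rs r (\<omega> w)) \<noteq> 0" by (rule R(4)[OF \<omega>])
  qed (use R e in auto)
qed

lemma two_point_formula:
  obtains \<delta> \<epsilon> \<omega> Q where "0 < \<delta>" "0 < \<epsilon>" "inj_on (mom r) (ball 0 \<delta>)"
    "\<omega> holomorphic_on ball 0 \<epsilon>" "\<omega> 0 = 0" "mom (x * y * x) holomorphic_on ball 0 \<epsilon>"
    "\<forall>z\<in>ball 0 \<epsilon>. \<omega> z \<in> ball 0 \<delta>"
    "\<forall>z\<in>ball 0 \<epsilon>. mom r (\<omega> z) = mom (x * y * x) z"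
    "\<forall>z\<in>ball 0 \<epsilon>. cmod z * norm (x * y * x) \<le> 1 / 2"
    "\<forall>z\<in>ball 0 \<epsilon>. cmod (\<omega> z) * norm r \<le> 1 / 2"
    "\<forall>z\<in>ball 0 \<epsilon>. \<forall>w\<in>ball 0 \<epsilon>. \<tau> (r * rs r (\<omega> z) * rs r (\<omega> w)) \<noteq> 0"
    "inj_on (mom (x * y * x)) (ball 0 \<epsilon>)"
    "continuous_on (ball 0 \<epsilon> \<times> ball 0 \<epsilon>) Q"
    "\<forall>z\<in>ball 0 \<epsilon>. \<forall>w\<in>ball 0 \<epsilon>. z \<noteq> w \<longrightarrow> Q (z, w) = (w * \<omega> z - z * \<omega> w) / (z - w)"
    "continuous_on (ball 0 \<epsilon> \<times> ball 0 \<epsilon>) (\<lambda>p. \<tau> (r * rs r (\<omega> (fst p)) * rs r (\<omega> (snd p))))"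
    "\<forall>z\<in>ball 0 \<epsilon>. \<forall>w\<in>ball 0 \<epsilon>. \<forall>g1\<in>AR. \<forall>g2\<in>AR. \<tau> (g1 * rs (x * y * x) z * g2 * rs (x * y * x) w) =
      \<tau> (g1 * g2 * rs r (\<omega> z) * rs r (\<omega> w)) +
      Q (z, w) * (\<tau> (r * g1 * rs r (\<omega> z) * rs r (\<omega> w)) * \<tau> (r * g2 * rs r (\<omega> z) * rs r (\<omega> w)) /
        \<tau> (r * rs r (\<omega> z) * rs r (\<omega> w)))"
    "\<forall>z\<in>ball 0 \<delta>. cmod z * norm r \<le> 1 / 2"
proof -
  obtain \<delta> \<epsilon>' \<omega> where loc: "0 < \<delta>" "0 < \<epsilon>'" "inj_on (mom r) (ball 0 \<delta>)"
    "\<omega> holomorphic_on ball 0 \<epsilon>'" "\<omega> 0 = 0" "mom (r * y) holomorphic_on ball 0 \<epsilon>'"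
    "\<forall>z\<in>ball 0 \<epsilon>'. \<omega> z \<in> ball 0 \<delta>"
    "\<forall>z\<in>ball 0 \<epsilon>'. mom r (\<omega> z) = mom (r * y) z"
    "\<forall>z\<in>ball 0 \<epsilon>'. cmod z * norm (r * y) \<le> 1 / 2"
    "\<forall>z\<in>ball 0 \<epsilon>'. cmod (\<omega> z) * norm r \<le> 1 / 2"
    "\<forall>z\<in>ball 0 \<epsilon>'. \<forall>w\<in>ball 0 \<epsilon>'. \<tau> (r * rs r (\<omega> z) * rs r (\<omega> w)) \<noteq> 0"
    "inj_on (mom (r * y)) (ball 0 \<epsilon>')"
    "\<forall>z\<in>ball 0 \<epsilon>'. z \<noteq> 0 \<longrightarrow> (\<exists>m c V. subordinate z (\<omega> z) m c V)"
    "\<forall>z\<in>ball 0 \<delta>. cmod z * norm r \<le> 1 / 2"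
    by (rule local_subordination)
  note loc = loc[rule_format]
  let ?u = "x * y * x"
  \<comment> \<open>The norms of \<open>x * y * x\<close> and \<open>r * y\<close> are unrelated
    here, so the radius has to respect both.\<close>
  define \<epsilon> where "\<epsilon> = min \<epsilon>' (1 / (2 * (norm ?u + 1)))"
  let ?D = "ball (0 :: complex) \<epsilon>"
  have nu: "0 < norm ?u + 1" by (simp add: add_nonneg_pos)
  have e: "0 < \<epsilon>" using nu loc(2) by (simp add: \<epsilon>_def)
  have D: "z \<in> ball 0 \<epsilon>'" if "z \<in> ?D" for z using that by (simp add: \<epsilon>_def)
  have sub: "?D \<subseteq> ball 0 \<epsilon>'" using D by blast
  have small_u: "cmod z * norm ?u \<le> 1 / 2" if "z \<in> ?D" for z
  proof -
    have "cmod z * norm ?u \<le> 1 / (2 * (norm ?u + 1)) * (norm ?u + 1)"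
      using that by (intro mult_mono) (auto simp: \<epsilon>_def)
    also have "\<dots> = 1 / 2" using nu by simp
    finally show ?thesis .
  qed
  have small_v: "cmod z * norm (x * x * y) \<le> 1 / 2" if "z \<in> ?D" for z
    using loc(9)[OF D[OF that]] by (simp add: x)
  have mom_eq: "mom ?u z = mom (r * y) z" if "z \<in> ?D" for z
    using conjugate_mom[OF x(1) y_A, of z] small_u[OF that] small_v[OF that] by (simp add: x)
  have u: "?u \<in> A" using x by (auto simp: mult_mem)
  have mem: "rs r (\<omega> z) \<in> A" "rs ?u z \<in> A" if "z \<in> ?D" for z
    using loc(10)[OF D[OF that]] small_u[OF that] u by (auto intro!: rs_mem)
  have c\<omega>: "continuous_on ?D \<omega>"
    by (rule holomorphic_on_imp_continuous_on[OF holomorphic_on_subset[OF loc(4) sub]])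
  have c\<omega>': "continuous_on (?D \<times> ?D) (\<lambda>p. \<omega> (fst p))" "continuous_on (?D \<times> ?D) (\<lambda>p. \<omega> (snd p))"
    by (rule continuous_on_compose2[OF c\<omega>], auto intro!: continuous_intros)+
  have cR: "continuous_on (?D \<times> ?D) (\<lambda>p. \<tau> (a * rs r (\<omega> (fst p)) * rs r (\<omega> (snd p))))" if "a \<in> A" for a
    using that mem loc(10)[OF D] by (intro continuous_intros c\<omega>') (auto intro!: mult_mem)
  have cU: "continuous_on (?D \<times> ?D) (\<lambda>p. \<tau> (a * rs ?u (fst p) * b * rs ?u (snd p)))" if "a \<in> A" "b \<in> A" for a b
    using that mem small_u by (intro continuous_intros) (auto intro!: mult_mem)
  define B where "B p = \<tau> (r * rs r (\<omega> (fst p)) * rs r (\<omega> (snd p)))" for p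
  \<comment> \<open>Off the diagonal the quotient is
    \<open>w (\<omega> z - \<omega> w) / (z - w) - \<omega> w\<close>. Since the moment transform of
    \<open>r\<close> at \<open>\<omega>\<close> is that of \<open>?u\<close>, the difference
    quotient of \<open>\<omega>\<close> is a ratio of two traces, which is continuous across the
    diagonal.\<close>
  define Q where "Q p = snd p * (\<tau> (?u * rs ?u (fst p) * 1 * rs ?u (snd p)) / B p) - \<omega> (snd p)" for p
  have cB: "continuous_on (?D \<times> ?D) B" unfolding B_def by (rule cR[OF r_A])
  have B0: "B p \<noteq> 0" if "p \<in> ?D \<times> ?D" for p using that loc(11) D by (auto simp: B_def)
  have cQ: "continuous_on (?D \<times> ?D) Q"
    unfolding Q_def using B0 by (intro continuous_intros cB cU c\<omega>' u one_mem) auto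
  have Q: "Q (z, w) = (w * \<omega> z - z * \<omega> w) / (z - w)" if zw: "z \<in> ?D" "w \<in> ?D" "z \<noteq> w" for z w
  proof -
    have "mom ?u z - mom ?u w = (z - w) * \<tau> (?u * rs ?u z * rs ?u w)"
      using small_u[OF zw(1)] small_u[OF zw(2)] by (intro mom_diff u) auto
    moreover have "mom r (\<omega> z) - mom r (\<omega> w) = (\<omega> z - \<omega> w) * B (z, w)"
      unfolding B_def using loc(10)[OF D[OF zw(1)]] loc(10)[OF D[OF zw(2)]] mom_diff[OF r_A, of "\<omega> z" "\<omega> w"] by simp
    ultimately have "(z - w) * \<tau> (?u * rs ?u z * rs ?u w) = (\<omega> z - \<omega> w) * B (z, w)"
      using zw mom_eq loc(8)[OF D] by simp
    then have "\<tau> (?u * rs ?u z * rs ?u w) / B (z, w) = (\<omega> z - \<omega> w) / (z - w)"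
      using zw B0[of "(z, w)"] by (simp add: field_simps)
    then have "Q (z, w) = w * ((\<omega> z - \<omega> w) / (z - w)) - \<omega> w" by (simp add: Q_def)
    also have "\<dots> = (w * \<omega> z - z * \<omega> w) / (z - w)" using zw by (simp add: field_simps)
    finally show ?thesis .
  qed
  have formula: "\<tau> (g1 * rs ?u z * g2 * rs ?u w) =
      \<tau> (g1 * g2 * rs r (\<omega> z) * rs r (\<omega> w)) +
      Q (z, w) * (\<tau> (r * g1 * rs r (\<omega> z) * rs r (\<omega> w)) * \<tau> (r * g2 * rs r (\<omega> z) * rs r (\<omega> w)) / B (z, w))"
    if zw: "z \<in> ?D" "w \<in> ?D" and g: "g1 \<in> AR" "g2 \<in> AR" for z w g1 g2
  proof -
    note gA = g[THEN AR_A]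
    let ?F = "\<lambda>p. \<tau> (g1 * rs ?u (fst p) * g2 * rs ?u (snd p))"
    let ?G = "\<lambda>p. \<tau> (g1 * g2 * rs r (\<omega> (fst p)) * rs r (\<omega> (snd p))) +
      Q p * (\<tau> (r * g1 * rs r (\<omega> (fst p)) * rs r (\<omega> (snd p))) *
        \<tau> (r * g2 * rs r (\<omega> (fst p)) * rs r (\<omega> (snd p))) / B p)"
    have "?F (z, w) = ?G (z, w)"
    proof (rule eq_on_square_by_density[where D = ?D and F = ?F and G = ?G])
      show "continuous_on (?D \<times> ?D) ?F" by (rule cU[OF gA])
      show "continuous_on (?D \<times> ?D) ?G"
        by (rule continuous_on_add[OF cR continuous_on_mult[OF cQ continuous_on_divide[OF
              continuous_on_mult[OF cR cR] cB]]])
           (use B0 gA in \<open>auto simp: mult_mem\<close>)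
      fix z w assume zw: "z \<in> ?D" "w \<in> ?D" "z \<noteq> w" "z \<noteq> 0" "w \<noteq> 0"
      obtain m c V where z: "subordinate z (\<omega> z) m c V" using loc(13)[OF D[OF zw(1)] zw(4)] by blast
      obtain m' c' V' where w: "subordinate w (\<omega> w) m' c' V'" using loc(13)[OF D[OF zw(2)] zw(5)] by blast
      have small: "cmod z * norm ?u < 1" "cmod z * norm (x * x * y) < 1"
        "cmod w * norm ?u < 1" "cmod w * norm (x * x * y) < 1"
        using small_u[OF zw(1)] small_v[OF zw(1)] small_u[OF zw(2)] small_v[OF zw(2)] by linarith+
      have "?F (z, w) = \<tau> (g1 * rs (r * y) z * g2 * rs (r * y) w)"
        using conjugate_resolvents[OF x(1) y_A gA x_commute[OF g(1)] x_commute[OF g(2)] small]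
        by (simp add: x)
      then show "?F (z, w) = ?G (z, w)"
        by (simp only: subordinate_two_point[OF z w g zw(3) loc(11)[OF D[OF zw(1)] D[OF zw(2)]]]
            Q[OF zw(1-3)] B_def fst_conv snd_conv)
    qed (use zw in auto)
    then show ?thesis by simp
  qed
  have "mom ?u holomorphic_on ?D"
    by (rule holomorphic_transform[OF holomorphic_on_subset[OF loc(6) sub]]) (simp add: mom_eq)
  moreover have "inj_on (mom ?u) ?D"
    using inj_on_subset[OF loc(12) sub] mom_eq by (simp add: inj_on_def)
  moreover have "mom r (\<omega> z) = mom ?u z" if "z \<in> ?D" for z
    using loc(8)[OF D[OF that]] mom_eq[OF that] by simp
  ultimately show thesis
    by (intro that[OF loc(1) e loc(3) holomorphic_on_subset[OF loc(4) sub] loc(5) _ _ _ _ _ _ _ cQ _ cB[unfolded B_def]]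
          ballI impI formula[unfolded B_def fst_conv snd_conv] Q small_u loc(7,10,11,14) D)
qed

end

section \<open>Bounded operators as a complex Banach algebra\<close>

lemma bounded_opsD: "T \<in> bounded_ops \<Longrightarrow> blinfun_apply T (c *\<^sub>C x) = c *\<^sub>C blinfun_apply T x"
  by (simp add: bounded_ops_def)

lemma scaleC_zero [simp]: "c *\<^sub>C (0 :: 'a::complex_hilbert) = 0"
  using scaleC_add_right[of c "0 :: 'a" 0] by simp

lemma scaleC_minus_right: "c *\<^sub>C (- x) = - (c *\<^sub>C (x :: 'a::complex_hilbert))"
  using scaleC_add_right[of c x "- x"] by (simp add: eq_neg_iff_add_eq_0 add.commute)

lemma scaleC_diff_right: "c *\<^sub>C (x - y) = c *\<^sub>C x - c *\<^sub>C (y :: 'a::complex_hilbert)"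
  using scaleC_add_right[of c x "- y"] by (simp add: scaleC_minus_right)

lemma closed_bounded_ops: "closed (bounded_ops :: ('h::complex_hilbert \<Rightarrow>\<^sub>L 'h) set)"
proof -
  have "closed {T :: 'h \<Rightarrow>\<^sub>L 'h. blinfun_apply T (c *\<^sub>C x) = c *\<^sub>C blinfun_apply T x}" for c x
    by (intro closed_Collect_eq bounded_linear.continuous_on[OF bounded_linear_scaleC]
        blinfun.continuous_on continuous_on_id continuous_on_const)
  then have "closed (\<Inter>c. \<Inter>x. {T :: 'h \<Rightarrow>\<^sub>L 'h. blinfun_apply T (c *\<^sub>C x) = c *\<^sub>C blinfun_apply T x})"
    by (intro closed_INT ballI)
  also have "(\<Inter>c. \<Inter>x. {T :: 'h \<Rightarrow>\<^sub>L 'h. blinfun_apply T (c *\<^sub>C x) = c *\<^sub>C blinfun_apply T x}) = bounded_ops"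
    by (auto simp: bounded_ops_def)
  finally show ?thesis .
qed

text \<open>A complex scalar does not pass through a merely real-linear operator on its left, so the
  full operator type violates \<open>mult_smult_right\<close>. The complex-linear operators form an
  instance of \<open>complex_banach_algebra\<close>.\<close>

typedef (overloaded) 'h cop = "bounded_ops :: ('h::complex_hilbert \<Rightarrow>\<^sub>L 'h) set"
  morphisms op_of cop
  by (rule exI[of _ 0]) (simp add: bounded_ops_def)

setup_lifting type_definition_cop

instantiation cop :: (complex_hilbert) "{real_normed_algebra, monoid_mult}"
begin

lift_definition zero_cop :: "'a cop" is 0 by (simp add: bounded_ops_def)
lift_definition one_cop :: "'a cop" is id_blinfun by (simp add: bounded_ops_def)
lift_definition plus_cop :: "'a cop \<Rightarrow> 'a cop \<Rightarrow> 'a cop" is "(+)"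
  by (simp add: bounded_ops_def blinfun.add_left scaleC_add_right)
lift_definition minus_cop :: "'a cop \<Rightarrow> 'a cop \<Rightarrow> 'a cop" is "(-)"
  by (simp add: bounded_ops_def blinfun.diff_left scaleC_diff_right)
lift_definition uminus_cop :: "'a cop \<Rightarrow> 'a cop" is "uminus"
  by (simp add: bounded_ops_def blinfun.minus_left scaleC_minus_right)
lift_definition times_cop :: "'a cop \<Rightarrow> 'a cop \<Rightarrow> 'a cop" is "(o\<^sub>L)"
  by (simp add: bounded_ops_def)
lift_definition scaleR_cop :: "real \<Rightarrow> 'a cop \<Rightarrow> 'a cop" is "(*\<^sub>R)"
  by (simp add: bounded_ops_def blinfun.scaleR_left scaleR_scaleC scaleC_scaleC mult.commute)
lift_definition norm_cop :: "'a cop \<Rightarrow> real" is norm .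

definition dist_cop :: "'a cop \<Rightarrow> 'a cop \<Rightarrow> real" where
  "dist_cop x y = norm (x - y)"
definition sgn_cop :: "'a cop \<Rightarrow> 'a cop" where
  "sgn_cop x = scaleR (inverse (norm x)) x"
definition uniformity_cop :: "('a cop \<times> 'a cop) filter" where
  "uniformity_cop = (INF e\<in>{0 <..}. principal {(x, y). dist x y < e})"
definition open_cop :: "'a cop set \<Rightarrow> bool" where
  "open_cop U = (\<forall>x\<in>U. eventually (\<lambda>(x', y). x' = x \<longrightarrow> y \<in> U) uniformity)"

instance
proof
  fix x y z :: "'a cop" and a b :: real and c d :: complex
  show "x + y + z = x + (y + z)" by transfer simp
  show "x + y = y + x" by transfer simp
  show "0 + x = x" by transfer simp
  show "- x + x = 0" by transfer simp
  show "x - y = x + - y" by transfer simp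
  show "a *\<^sub>R (x + y) = a *\<^sub>R x + a *\<^sub>R y" by transfer (simp add: scaleR_right_distrib)
  show "(a + b) *\<^sub>R x = a *\<^sub>R x + b *\<^sub>R x" by transfer (simp add: scaleR_left_distrib)
  show "a *\<^sub>R b *\<^sub>R x = (a * b) *\<^sub>R x" by transfer simp
  show "1 *\<^sub>R x = x" by transfer simp
  show "dist x y = norm (x - y)" by (rule dist_cop_def)
  show "sgn x = scaleR (inverse (norm x)) x" by (rule sgn_cop_def)
  show "uniformity = (INF e\<in>{0 <..}. principal {(x :: 'a cop, y). dist x y < e})"
    by (rule uniformity_cop_def)
  show "open U = (\<forall>x\<in>U. eventually (\<lambda>(x', y). x' = x \<longrightarrow> y \<in> U) uniformity)" for U :: "'a cop set"
    by (rule open_cop_def)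
  show "(norm x = 0) = (x = 0)" by transfer simp
  show "norm (x + y) \<le> norm x + norm y" by transfer (rule norm_triangle_ineq)
  show "norm (a *\<^sub>R x) = \<bar>a\<bar> * norm x" by transfer simp
  show "x * y * z = x * (y * z)" by transfer (simp add: blinfun_eqI)
  show "(x + y) * z = x * z + y * z" by transfer (simp add: blinfun_eqI blinfun.add_left)
  show "x * (y + z) = x * y + x * z"
    by transfer (simp add: blinfun_eqI blinfun.add_left blinfun.add_right)
  show "a *\<^sub>R x * y = a *\<^sub>R (x * y)" by transfer (simp add: blinfun_eqI blinfun.scaleR_left)
  show "x * a *\<^sub>R y = a *\<^sub>R (x * y)"
    by transfer (simp add: blinfun_eqI blinfun.scaleR_left blinfun.scaleR_right)
  show "1 * x = x" by transfer (simp add: blinfun_eqI)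
  show "x * 1 = x" by transfer (simp add: blinfun_eqI)
  show "norm (x * y) \<le> norm x * norm y" by transfer (rule norm_blinfun_compose)
qed

end

instance cop :: (complex_hilbert) banach
proof
  fix X :: "nat \<Rightarrow> 'a cop" assume X: "Cauchy X"
  have d: "dist (op_of a) (op_of b) = dist a b" for a b :: "'a cop"
    by (simp add: dist_norm norm_cop.rep_eq minus_cop.rep_eq)
  have "Cauchy (\<lambda>n. op_of (X n))" using X by (simp add: Cauchy_def d)
  then obtain L where L: "(\<lambda>n. op_of (X n)) \<longlonglongrightarrow> L"
    using Cauchy_convergent convergent_def by blast
  have "L \<in> bounded_ops"
    by (rule closed_sequentially[OF closed_bounded_ops op_of L])
  then have L': "op_of (cop L) = L" by (rule cop_inverse)
  have "X \<longlonglongrightarrow> cop L"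
    using L by (simp add: LIMSEQ_def L' flip: d)
  then show "convergent X" by (rule convergentI)
qed

lemma norm_scaleC_blinfun: "norm (c *\<^sub>C (T :: 'h::complex_hilbert \<Rightarrow>\<^sub>L 'h)) = cmod c * norm T"
proof -
  have le: "norm (c *\<^sub>C (T :: 'h \<Rightarrow>\<^sub>L 'h)) \<le> cmod c * norm T" for c T
  proof (rule norm_blinfun_bound)
    show "norm (blinfun_apply (c *\<^sub>C T) x) \<le> cmod c * norm T * norm x" for x
      using mult_left_mono[OF norm_blinfun[of T x], of "cmod c"]
      by (simp add: scaleC_blinfun.rep_eq norm_scaleC mult.assoc)
  qed simp
  show ?thesis
  proof (cases "c = 0")
    case True
    then show ?thesis using le[of c T] by simp
  next
    case False
    have "inverse c *\<^sub>C c *\<^sub>C T = T"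
      using False scaleR_scaleC[of 1, where ?'a = 'h]
      by (intro blinfun_eqI) (simp add: scaleC_blinfun.rep_eq scaleC_scaleC)
    then have "norm T \<le> cmod (inverse c) * norm (c *\<^sub>C T)" using le[of "inverse c" "c *\<^sub>C T"] by simp
    then have "cmod c * norm T \<le> norm (c *\<^sub>C T)" using False by (simp add: norm_divide field_simps)
    then show ?thesis using le[of c T] by simp
  qed
qed

instantiation cop :: (complex_hilbert) complex_banach_algebra
begin

lift_definition scaleC_cop :: "complex \<Rightarrow> 'a cop \<Rightarrow> 'a cop" is "(*\<^sub>C)"
  by (simp add: bounded_ops_def scaleC_blinfun.rep_eq scaleC_scaleC mult.commute)

instance
proof
  fix x y z :: "'a cop" and a :: real and c d :: complex
  show "c *\<^sub>C (x + y) = c *\<^sub>C x + c *\<^sub>C y"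
    by transfer (simp add: blinfun_eqI blinfun.add_left scaleC_blinfun.rep_eq scaleC_add_right)
  show "(c + d) *\<^sub>C x = c *\<^sub>C x + d *\<^sub>C x"
    by transfer (simp add: blinfun_eqI blinfun.add_left scaleC_blinfun.rep_eq scaleC_add_left)
  show "c *\<^sub>C d *\<^sub>C x = (c * d) *\<^sub>C x"
    by transfer (simp add: blinfun_eqI scaleC_blinfun.rep_eq scaleC_scaleC)
  show "a *\<^sub>R x = complex_of_real a *\<^sub>C x"
    by transfer (simp add: blinfun_eqI scaleC_blinfun.rep_eq scaleR_scaleC blinfun.scaleR_left)
  show "(c *\<^sub>C x) * y = c *\<^sub>C (x * y)"
    by transfer (simp add: blinfun_eqI scaleC_blinfun.rep_eq)
  show "x * (c *\<^sub>C y) = c *\<^sub>C (x * y)"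
    by transfer (simp add: blinfun_eqI scaleC_blinfun.rep_eq bounded_opsD)
  show "norm (c *\<^sub>C x) = cmod c * norm x" by transfer (rule norm_scaleC_blinfun)
  show "norm (1 :: 'a cop) \<le> 1" by transfer (simp add: norm_blinfun_bound)
qed

end

section \<open>Positive operators\<close>

lemma cinner_add_left: "cinner (x + y) z = cinner x z + cinner y (z :: 'h::complex_hilbert)"
  by (metis cinner_add_right cinner_commute complex_cnj_add)

lemma cinner_scaleC_left: "cinner (c *\<^sub>C x) y = cnj c * cinner x (y :: 'h::complex_hilbert)"
  by (metis cinner_commute cinner_scaleC_right complex_cnj_mult)

lemma cinner_scaleR_right: "cinner x (r *\<^sub>R y) = complex_of_real r * cinner x (y :: 'h::complex_hilbert)"
  by (simp add: scaleR_scaleC cinner_scaleC_right)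

lemma cinner_scaleR_left: "cinner (r *\<^sub>R x) y = complex_of_real r * cinner x (y :: 'h::complex_hilbert)"
  by (simp add: scaleR_scaleC cinner_scaleC_left)

lemma cinner_diff_right: "cinner x (y - z) = cinner x y - cinner x (z :: 'h::complex_hilbert)"
  using cinner_add_right[of x "y - z" z] by simp

lemma cinner_diff_left: "cinner (x - y) z = cinner x z - cinner y (z :: 'h::complex_hilbert)"
  using cinner_add_left[of "x - y" y z] by simp

lemma cinner_zero_left [simp]: "cinner 0 (x :: 'h::complex_hilbert) = 0"
  using cinner_diff_left[of x x x] by simp

lemma cinner_zero_right [simp]: "cinner (x :: 'h::complex_hilbert) 0 = 0"
  using cinner_diff_right[of x x x] by simp

lemma cinner_minus_left: "cinner (- x) y = - cinner x (y :: 'h::complex_hilbert)"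
  using cinner_diff_left[of 0 x y] by simp

lemma cinner_minus_right: "cinner x (- y) = - cinner x (y :: 'h::complex_hilbert)"
  using cinner_diff_right[of x 0 y] by simp

lemma Re_cinner_self: "Re (cinner x x) = (norm (x :: 'h::complex_hilbert))\<^sup>2"
  by (simp add: norm_eq_sqrt_cinner cinner_self_nonneg)

abbreviation app :: "'h::complex_hilbert cop \<Rightarrow> 'h \<Rightarrow> 'h" (infixr \<open>\<cdot>\<close> 75) where
  "a \<cdot> x \<equiv> blinfun_apply (op_of a) x"

lemma app_simps [simp]:
  fixes x :: "'h::complex_hilbert"
  shows "(a + b) \<cdot> x = a \<cdot> x + b \<cdot> x" "(a - b) \<cdot> x = a \<cdot> x - b \<cdot> x" "(- a) \<cdot> x = - (a \<cdot> x)"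
    "(a * b) \<cdot> x = a \<cdot> b \<cdot> x" "1 \<cdot> x = x" "0 \<cdot> x = 0"
    "(c *\<^sub>C a) \<cdot> x = c *\<^sub>C (a \<cdot> x)" "(r *\<^sub>R a) \<cdot> x = r *\<^sub>R (a \<cdot> x)"
  by (simp_all add: plus_cop.rep_eq minus_cop.rep_eq uminus_cop.rep_eq times_cop.rep_eq one_cop.rep_eq
      zero_cop.rep_eq scaleC_cop.rep_eq scaleR_cop.rep_eq blinfun.add_left blinfun.diff_left
      blinfun.minus_left scaleC_blinfun.rep_eq blinfun.scaleR_left)

lemma cop_eqI: "(\<And>x. a \<cdot> x = b \<cdot> x) \<Longrightarrow> a = b"
  by (metis blinfun_eqI op_of_inject)

definition sa :: "'h::complex_hilbert cop \<Rightarrow> bool" where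
  "sa a \<longleftrightarrow> selfadjoint_op (op_of a)"

definition pos :: "'h::complex_hilbert cop \<Rightarrow> bool" where
  "pos a \<longleftrightarrow> positive_op (op_of a)"

lemma sa_iff: "sa a \<longleftrightarrow> (\<forall>x y. cinner (a \<cdot> x) y = cinner x (a \<cdot> y))"
  using op_of[of a] by (simp add: sa_def selfadjoint_op_def is_adjoint_def)

lemma pos_iff: "pos a \<longleftrightarrow> sa a \<and> (\<forall>x. 0 \<le> Re (cinner x (a \<cdot> x)))"
  by (simp add: pos_def positive_op_def sa_def)

lemma saD: "sa a \<Longrightarrow> cinner (a \<cdot> x) y = cinner x (a \<cdot> y)"
  by (simp add: sa_iff)

lemma pos_sa: "pos a \<Longrightarrow> sa a" and posD: "pos a \<Longrightarrow> 0 \<le> Re (cinner x (a \<cdot> x))"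
  by (simp_all add: pos_iff)

lemma sa_zero [simp]: "sa 0" and sa_one [simp]: "sa 1"
  by (simp_all add: sa_iff)

lemma sa_add: "sa a \<Longrightarrow> sa b \<Longrightarrow> sa (a + b)"
  and sa_diff: "sa a \<Longrightarrow> sa b \<Longrightarrow> sa (a - b)"
  and sa_scaleR: "sa a \<Longrightarrow> sa (r *\<^sub>R a)"
  and sa_mult: "sa a \<Longrightarrow> sa b \<Longrightarrow> a * b = b * a \<Longrightarrow> sa (a * b)"
  and sa_conj: "sa a \<Longrightarrow> sa b \<Longrightarrow> sa (b * a * b)"
proof -
  show "sa a \<Longrightarrow> sa b \<Longrightarrow> sa (a + b)" "sa a \<Longrightarrow> sa b \<Longrightarrow> sa (a - b)" "sa a \<Longrightarrow> sa (r *\<^sub>R a)"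
    "sa a \<Longrightarrow> sa b \<Longrightarrow> sa (b * a * b)"
    by (simp_all add: sa_iff cinner_add_left cinner_add_right cinner_diff_left cinner_diff_right
        cinner_scaleR_left cinner_scaleR_right)
  assume ab: "sa a" "sa b" "a * b = b * a"
  show "sa (a * b)"
    unfolding sa_iff
  proof (intro allI)
    fix x y
    have "cinner ((a * b) \<cdot> x) y = cinner x ((b * a) \<cdot> y)" by (simp add: saD ab(1,2))
    then show "cinner ((a * b) \<cdot> x) y = cinner x ((a * b) \<cdot> y)" by (simp only: ab(3))
  qed
qed

lemma pos_one [simp]: "pos 1" by (simp add: pos_iff cinner_self_nonneg)

lemma pos_add: "pos a \<Longrightarrow> pos b \<Longrightarrow> pos (a + b)"
  by (simp add: pos_iff sa_add cinner_add_right)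

lemma pos_scaleR: "pos a \<Longrightarrow> 0 \<le> r \<Longrightarrow> pos (r *\<^sub>R a)"
  by (simp add: pos_iff sa_scaleR cinner_scaleR_right)

lemma pos_conj:
  assumes "pos a" "sa b"
  shows "pos (b * a * b)"
proof -
  have "cinner x ((b * a * b) \<cdot> x) = cinner (b \<cdot> x) (a \<cdot> b \<cdot> x)" for x
    using saD[OF assms(2), of x "a \<cdot> b \<cdot> x"] by simp
  then show ?thesis using assms by (simp add: pos_iff sa_conj del: app_simps)
qed

section \<open>Cauchy-Schwarz inequalities and norm estimates\<close>

lemma quadratic_nonneg_discriminant:
  fixes a b c :: real
  assumes "\<And>t. 0 \<le> a + 2 * t * b + t\<^sup>2 * c" "0 \<le> c"
  shows "b\<^sup>2 \<le> a * c"
proof (cases "c = 0")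
  case True
  have "b = 0"
  proof (rule ccontr)
    assume "b \<noteq> 0"
    then have "a + 2 * (- (a + 1) / (2 * b)) * b = - 1" by (simp add: field_simps)
    then show False using assms(1)[of "- (a + 1) / (2 * b)"] True by simp
  qed
  then show ?thesis using True by simp
next
  case False
  then have "0 < c" using assms(2) by simp
  have "0 \<le> a + 2 * (- b / c) * b + (- b / c)\<^sup>2 * c" by (rule assms(1))
  also have "\<dots> = (a * c - b\<^sup>2) / c" using False by (simp add: field_simps power2_eq_square)
  finally show ?thesis using \<open>0 < c\<close> by (simp add: zero_le_divide_iff)
qed

lemma pos_cauchy_schwarz:
  assumes "pos a"
  shows "(Re (cinner x (a \<cdot> y)))\<^sup>2 \<le> Re (cinner x (a \<cdot> x)) * Re (cinner y (a \<cdot> y))"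
proof (rule quadratic_nonneg_discriminant)
  fix t :: real
  have "cinner y (a \<cdot> x) = cnj (cinner x (a \<cdot> y))"
    using saD[OF pos_sa[OF assms], of x y] cinner_commute[of y "a \<cdot> x"] by simp
  then have sym: "Re (cinner y (a \<cdot> x)) = Re (cinner x (a \<cdot> y))" by simp
  have "0 \<le> Re (cinner (x + t *\<^sub>R y) (a \<cdot> (x + t *\<^sub>R y)))" by (rule posD[OF assms])
  also have "\<dots> = Re (cinner x (a \<cdot> x)) + 2 * t * Re (cinner x (a \<cdot> y)) + t\<^sup>2 * Re (cinner y (a \<cdot> y))"
    using sym
    by (simp add: blinfun.add_right blinfun.scaleR_right cinner_add_left cinner_add_right
        cinner_scaleR_left cinner_scaleR_right power2_eq_square algebra_simps)
  finally show "0 \<le> Re (cinner x (a \<cdot> x)) + 2 * t * Re (cinner x (a \<cdot> y)) + t\<^sup>2 * Re (cinner y (a \<cdot> y))" .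
qed (rule posD[OF assms])

lemma Re_cinner_le: "\<bar>Re (cinner x y)\<bar> \<le> norm x * norm (y :: 'h::complex_hilbert)"
proof -
  have "(Re (cinner x y))\<^sup>2 \<le> (norm x * norm y)\<^sup>2"
    using pos_cauchy_schwarz[OF pos_one, of x y] by (simp add: Re_cinner_self power_mult_distrib)
  then show ?thesis by (metis abs_le_square_iff abs_of_nonneg mult_nonneg_nonneg norm_ge_zero)
qed

lemma cmod_cinner_le: "cmod (cinner x y) \<le> norm x * norm (y :: 'h::complex_hilbert)"
proof -
  \<comment> \<open>The scalar \<open>c\<close> rotates the inner product onto the nonnegative axis.
    It is 0 when the inner product is 0, hence the bound by 1 below instead of modulus 1.\<close>
  define c where "c = cnj (sgn (cinner x y))"
  have "cmod (cinner x y) = Re (cinner x (c *\<^sub>C y))"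
  proof (cases "cinner x y = 0")
    case False
    have "c * cinner x y = (cinner x y * cnj (cinner x y)) / complex_of_real (cmod (cinner x y))"
      by (simp add: c_def sgn_eq)
    also have "\<dots> = complex_of_real (cmod (cinner x y))"
      using False by (simp add: complex_norm_square[symmetric] power2_eq_square)
    finally show ?thesis by (simp add: cinner_scaleC_right)
  qed (simp add: cinner_scaleC_right)
  also have "\<dots> \<le> norm x * norm (c *\<^sub>C y)" using Re_cinner_le[of x "c *\<^sub>C y"] by simp
  also have "\<dots> \<le> norm x * (1 * norm y)"
    unfolding norm_scaleC by (intro mult_left_mono mult_right_mono) (auto simp: c_def norm_sgn)
  finally show ?thesis by simp
qed

lemma continuous_on_app [continuous_intros]:
  fixes f :: "'b::topological_space \<Rightarrow> 'h::complex_hilbert cop"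
  assumes "continuous_on S f"
  shows "continuous_on S (\<lambda>s. f s \<cdot> x)"
proof -
  have "bounded_linear (\<lambda>a :: 'h cop. a \<cdot> x)"
  proof (rule bounded_linear_intro[where K = "norm x"])
    show "norm (a \<cdot> x) \<le> norm a * norm x" for a
      by (simp add: norm_cop.rep_eq norm_blinfun)
  qed simp_all
  then show ?thesis by (rule bounded_linear.continuous_on) (rule assms)
qed

lemma closed_sa: "closed {a :: 'h::complex_hilbert cop. sa a}"
proof -
  have l: "bounded_linear (\<lambda>v. cinner v y)" for y :: 'h
  proof (rule bounded_linear_intro[where K = "norm y"])
    show "norm (cinner v y) \<le> norm v * norm y" for v by (rule cmod_cinner_le)
  qed (simp_all add: cinner_add_left cinner_scaleR_left scaleR_conv_of_real)
  have r: "bounded_linear (\<lambda>v. cinner y v)" for y :: 'h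
  proof (rule bounded_linear_intro[where K = "norm y"])
    show "norm (cinner y v) \<le> norm v * norm y" for v
      using cmod_cinner_le[of y v] by (simp add: mult.commute)
  qed (simp_all add: cinner_add_right cinner_scaleR_right scaleR_conv_of_real)
  have "closed {a. cinner (a \<cdot> x) y = cinner x (a \<cdot> y)}" for x y :: 'h
    by (intro closed_Collect_eq bounded_linear.continuous_on[OF l] bounded_linear.continuous_on[OF r]
        continuous_on_app continuous_on_id)
  then have "closed (\<Inter>x. \<Inter>y. {a :: 'h cop. cinner (a \<cdot> x) y = cinner x (a \<cdot> y)})"
    by (intro closed_INT ballI)
  also have "(\<Inter>x. \<Inter>y. {a :: 'h cop. cinner (a \<cdot> x) y = cinner x (a \<cdot> y)}) = {a. sa a}"
    by (auto simp: sa_iff)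
  finally show ?thesis .
qed

lemma norm_app_le: "norm (a \<cdot> x) \<le> norm a * norm (x :: 'h::complex_hilbert)"
  by (simp add: norm_cop.rep_eq norm_blinfun)

lemma norm_cop_le:
  assumes "0 \<le> b" "\<And>x. norm (a \<cdot> x) \<le> b * norm (x :: 'h::complex_hilbert)"
  shows "norm a \<le> b"
  unfolding norm_cop.rep_eq by (rule norm_blinfun_bound) (use assms in auto)

lemma pos_norm_minus:
  assumes "sa a" "norm a \<le> c"
  shows "pos (c *\<^sub>R 1 - a)"
proof -
  have "Re (cinner x (a \<cdot> x)) \<le> c * (norm x)\<^sup>2" for x
  proof -
    have "Re (cinner x (a \<cdot> x)) \<le> norm x * norm (a \<cdot> x)" using Re_cinner_le[of x "a \<cdot> x"] by simp
    also have "\<dots> \<le> norm x * (c * norm x)"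
      by (intro mult_left_mono order_trans[OF norm_app_le] mult_right_mono assms) auto
    finally show ?thesis by (simp add: power2_eq_square mult_ac)
  qed
  then show ?thesis using assms(1)
    by (simp add: pos_iff sa_diff sa_scaleR cinner_diff_right cinner_scaleR_right Re_cinner_self)
qed

text \<open>Cauchy-Schwarz for the form of \<open>a\<close> at the vectors \<open>x\<close> and
  \<open>a \<cdot> x\<close> bounds the fourth power of \<open>norm (a \<cdot> x)\<close> by a
  product of two values of the form, and positivity of \<open>1 - a\<close> bounds these by squared
  norms.\<close>

lemma norm_le_one_if_pos:
  assumes "pos a" "pos (1 - a)"
  shows "norm a \<le> 1"
proof (rule norm_cop_le)
  fix x
  let ?n = "norm (a \<cdot> x)"
  have "Re (cinner x (a \<cdot> a \<cdot> x)) = ?n\<^sup>2"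
    by (simp only: saD[OF pos_sa[OF assms(1)], of x "a \<cdot> x", symmetric] Re_cinner_self)
  then have "(?n\<^sup>2)\<^sup>2 \<le> Re (cinner x (a \<cdot> x)) * Re (cinner (a \<cdot> x) (a \<cdot> a \<cdot> x))"
    using pos_cauchy_schwarz[OF assms(1), of x "a \<cdot> x"] by simp
  also have "\<dots> \<le> (norm x)\<^sup>2 * ?n\<^sup>2"
    using posD[OF assms(2), of x] posD[OF assms(2), of "a \<cdot> x"] posD[OF assms(1)]
    by (intro mult_mono) (auto simp: cinner_diff_right Re_cinner_self)
  finally have *: "?n\<^sup>2 * ?n\<^sup>2 \<le> (norm x)\<^sup>2 * ?n\<^sup>2" by (simp add: power2_eq_square)
  show "?n \<le> 1 * norm x"
  proof (cases "?n = 0")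
    case False
    then have "0 < ?n\<^sup>2" by simp
    with * have "?n\<^sup>2 \<le> (norm x)\<^sup>2" by (rule mult_right_le_imp_le)
    then have "?n \<le> norm x" by (rule power2_le_imp_le) simp
    then show ?thesis by simp
  qed simp
qed simp

lemma pos_zero_apply:
  assumes "pos a" "Re (cinner x (a \<cdot> x)) = 0"
  shows "a \<cdot> x = 0"
proof -
  have "(Re (cinner (a \<cdot> x) (a \<cdot> x)))\<^sup>2 \<le> 0"
    using pos_cauchy_schwarz[OF assms(1), of "a \<cdot> x" x] assms(2) by simp
  then show ?thesis by (simp add: Re_cinner_self)
qed

text \<open>Dividing \<open>r\<close> by \<open>norm r + 1\<close> gives \<open>1 - t\<close> with
  \<open>t\<close> and \<open>1 - t\<close> positive, so \<open>sqrt_one_minus\<close> applies to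
  the contraction \<open>t\<close>. The commutation clause serves uniqueness and the conjugation
  argument, the membership clause puts the root into the von Neumann algebra.\<close>

lemma pos_sqrt_exists:
  assumes "pos (r :: 'h::complex_hilbert cop)"
  obtains s where "pos s" "s * s = r" "\<forall>b. b * r = r * b \<longrightarrow> b * s = s * b"
    "\<forall>A. closed_subalgebra A \<and> r \<in> A \<longrightarrow> s \<in> A"
proof -
  define c where "c = norm r + 1"
  have c: "0 < c" by (simp add: c_def add_nonneg_pos)
  define t where "t = 1 - (1 / c) *\<^sub>R r"
  have n: "norm ((1 / c) *\<^sub>R r) \<le> 1" using c by (simp add: c_def)
  have "pos ((1 / c) *\<^sub>R r)" using assms c by (intro pos_scaleR) auto
  then have p: "pos (1 - t)" by (simp add: t_def)
  moreover have pt: "pos t" using pos_norm_minus[OF pos_sa n] \<open>pos ((1 / c) *\<^sub>R r)\<close> by (simp add: t_def)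
  ultimately have "norm t \<le> 1" by (intro norm_le_one_if_pos)
  then obtain q where q: "(1 - q) * (1 - q) = 1 - t" "norm q \<le> 1"
    "\<forall>S. closed S \<longrightarrow> 0 \<in> S \<longrightarrow> (\<forall>x\<in>S. (1 / 2) *\<^sub>R (t + x * x) \<in> S) \<longrightarrow> q \<in> S"
    by (rule sqrt_one_minus)
  note q = q(1,2) q(3)[rule_format]
  have "q \<in> {a. sa a}"
    by (rule q(3)[OF closed_sa]) (auto intro!: sa_scaleR sa_add sa_mult pos_sa[OF pt])
  then have "pos (1 - q)" using pos_norm_minus[of q 1] q(2) by simp
  define s where "s = sqrt c *\<^sub>R (1 - q)"
  show thesis
  proof (rule that[of s])
    show "pos s" unfolding s_def using c by (intro pos_scaleR \<open>pos (1 - q)\<close>) auto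
    have "s * s = (sqrt c * sqrt c) *\<^sub>R ((1 - q) * (1 - q))" by (simp add: s_def)
    also have "\<dots> = c *\<^sub>R ((1 / c) *\<^sub>R r)" using c unfolding q(1) by (simp add: t_def)
    also have "\<dots> = r" using c by simp
    finally show "s * s = r" .
    show "\<forall>b. b * r = r * b \<longrightarrow> b * s = s * b"
    proof (intro allI impI)
      fix b assume b: "b * r = r * b"
      have "q \<in> {x. b * x = x * b}"
      proof (rule q(3))
        show "closed {x. b * x = x * b}" by (intro closed_Collect_eq continuous_intros)
        fix x assume "x \<in> {x. b * x = x * b}"
        then have x: "b * x = x * b" by simp
        have "b * (x * x) = (x * x) * b" by (metis x mult.assoc)
        moreover have "b * t = t * b" using b by (simp add: t_def algebra_simps)
        ultimately show "(1 / 2) *\<^sub>R (t + x * x) \<in> {x. b * x = x * b}"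
          by (simp add: distrib_left distrib_right)
      qed simp
      then show "b * s = s * b" by (simp add: s_def algebra_simps)
    qed
    show "\<forall>A. closed_subalgebra A \<and> r \<in> A \<longrightarrow> s \<in> A"
    proof (intro allI impI, elim conjE)
      fix A assume "closed_subalgebra A" and r: "r \<in> A"
      then interpret A: closed_subalgebra A by simp
      have "t \<in> A" using r by (auto simp: t_def scaleR_smult)
      have "q \<in> A" by (rule q(3)[OF A.closed]) (use \<open>t \<in> A\<close> in \<open>auto simp: scaleR_smult\<close>)
      then show "s \<in> A" by (auto simp: s_def scaleR_smult)
    qed
  qed
qed

text \<open>Commutation gives \<open>(s + s') * (s - s') = 0\<close>. On the range of
  \<open>s - s'\<close> both positive forms therefore vanish, so \<open>s\<close> and
  \<open>s'\<close> annihilate it and \<open>(s - s') * (s - s') = 0\<close>, which forces the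
  self-adjoint \<open>s - s'\<close> to vanish.\<close>

lemma pos_sqrt_unique:
  assumes s: "pos s" "s * s = r" and s': "pos s'" "s' * s' = r" and comm: "s' * s = s * s'"
  shows "s' = s"
proof (rule cop_eqI)
  fix x
  let ?d = "s - s'"
  define v where "v = ?d \<cdot> x"
  have "(s + s') * ?d = 0" using s s' comm by (simp add: algebra_simps)
  then have "(s + s') \<cdot> v = 0" by (metis app_simps(4,6) v_def)
  then have "cinner v (s \<cdot> v) + cinner v (s' \<cdot> v) = 0"
    by (simp flip: cinner_add_right)
  from arg_cong[OF this, of Re]
  have "Re (cinner v (s \<cdot> v)) + Re (cinner v (s' \<cdot> v)) = 0" by simp
  then have "Re (cinner v (s \<cdot> v)) = 0" "Re (cinner v (s' \<cdot> v)) = 0"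
    using posD[OF s(1), of v] posD[OF s'(1), of v] by linarith+
  then have "?d \<cdot> v = 0" using pos_zero_apply[OF s(1), of v] pos_zero_apply[OF s'(1), of v] by simp
  then have "cinner x (?d \<cdot> v) = 0" by simp
  then have "cinner v v = 0" using saD[OF sa_diff[OF pos_sa[OF s(1)] pos_sa[OF s'(1)]], of x v]
    by (simp add: v_def)
  then have "v = 0" by (simp add: cinner_self_eq_0)
  then show "s' \<cdot> x = s \<cdot> x" by (simp add: v_def)
qed

lemma op_sqrt_exists:
  assumes "pos (r :: 'h::complex_hilbert cop)"
  obtains s where "op_sqrt (op_of r) = op_of s" "s * s = r" "\<forall>b. b * r = r * b \<longrightarrow> b * s = s * b"
    "\<forall>A. closed_subalgebra A \<and> r \<in> A \<longrightarrow> s \<in> A"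
proof -
  obtain s where s: "pos s" "s * s = r" "\<forall>b. b * r = r * b \<longrightarrow> b * s = s * b"
    "\<forall>A. closed_subalgebra A \<and> r \<in> A \<longrightarrow> s \<in> A"
    by (rule pos_sqrt_exists[OF assms])
  have "op_sqrt (op_of r) = op_of s"
    unfolding op_sqrt_def
  proof (rule the_equality)
    show "positive_op (op_of s) \<and> op_of s o\<^sub>L op_of s = op_of r"
      using s(1) by (simp add: pos_def times_cop.rep_eq[symmetric] s(2))
    fix S assume S: "positive_op S \<and> S o\<^sub>L S = op_of r"
    then have "S \<in> bounded_ops" by (simp add: positive_op_def selfadjoint_op_def)
    then have s': "S = op_of (cop S)" by (simp add: cop_inverse)
    define s' where "s' = cop S"
    note s' = s'[folded s'_def]
    have "pos s'" using S s' by (simp add: pos_def)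
    moreover have "op_of (s' * s') = op_of r" using S s' by (simp add: times_cop.rep_eq)
    then have "s' * s' = r" by (simp only: op_of_inject)
    moreover have "s' * s = s * s'"
    proof -
      \<comment> \<open>A competing root commutes with its own square \<open>r\<close>, hence with
        \<open>s\<close>.\<close>
      have "s' * r = r * s'" unfolding \<open>s' * s' = r\<close>[symmetric] by (simp add: mult.assoc)
      then show ?thesis using s(3) by blast
    qed
    ultimately have "s' = s" by (intro pos_sqrt_unique[OF s(1,2)])
    then show "S = op_of s" by (simp add: s')
  qed
  then show thesis using s by (intro that)
qed

lemma op_inv_eq:
  assumes "b * a = 1" "a * b = 1"
  shows "op_inv (op_of a) = op_of b" "op_invertible (op_of a)"
proof -
  have ab: "op_of b o\<^sub>L op_of a = id_blinfun" "op_of a o\<^sub>L op_of b = id_blinfun"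
    by (simp_all only: assms times_cop.rep_eq[symmetric] one_cop.rep_eq[symmetric])
  show "op_inv (op_of a) = op_of b"
    unfolding op_inv_def
  proof (rule the_equality)
    fix S assume S: "S \<in> bounded_ops \<and> S o\<^sub>L op_of a = id_blinfun \<and> op_of a o\<^sub>L S = id_blinfun"
    then have c: "S = op_of (cop S)" by (simp add: cop_inverse)
    then have "op_of (cop S * a) = op_of 1" using S by (simp add: times_cop.rep_eq one_cop.rep_eq)
    then have "cop S * a = 1" by (simp only: op_of_inject)
    from inverse_unique_monoid[OF this assms(2)] show "S = op_of b" using c by simp
  qed (use ab op_of in auto)
  show "op_invertible (op_of a)" unfolding op_invertible_def using ab op_of by blast
qed

lemma res_eq:
  assumes "b * (1 - z *\<^sub>C a) = 1" "(1 - z *\<^sub>C a) * b = 1"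
  shows "res (op_of a) z = op_of b" "op_invertible (id_blinfun - z *\<^sub>C op_of a)"
  using op_inv_eq[OF assms]
  by (simp_all add: res_def minus_cop.rep_eq one_cop.rep_eq scaleC_cop.rep_eq)

text \<open>By positivity the inverses of \<open>1 + t r\<close> are contractions, so Neumann series continue the
  inverse along \<open>[0, \<infinity>)\<close> in steps of fixed length.\<close>

lemma pos_invertible:
  assumes r: "pos (r :: 'h::complex_hilbert cop)" "r \<in> A" and A: "closed_subalgebra A" and t: "0 \<le> t"
  shows "\<exists>b\<in>A. b * (1 + t *\<^sub>R r) = 1 \<and> (1 + t *\<^sub>R r) * b = 1"
proof -
  interpret A: closed_subalgebra A by (rule A)
  define \<eta> where "\<eta> = 1 / (2 * (norm r + 1))"
  have nr: "0 < norm r + 1" by (simp add: add_nonneg_pos)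
  then have \<eta>: "0 < \<eta>" by (simp add: \<eta>_def)
  \<comment> \<open>Positivity of \<open>r\<close> gives
    \<open>(norm v)\<^sup>2 \<le> Re (cinner v ((1 + t r) v))\<close>; Cauchy-Schwarz turns this
    into a bound for any right inverse.\<close>
  have contr: "norm b \<le> 1" if b: "(1 + t *\<^sub>R r) * b = 1" and "0 \<le> t" for b t
  proof (rule norm_cop_le)
    fix x
    let ?v = "b \<cdot> x"
    have x: "(1 + t *\<^sub>R r) \<cdot> ?v = x" by (metis app_simps(4,5) b)
    have "(norm ?v)\<^sup>2 \<le> Re (cinner ?v ((1 + t *\<^sub>R r) \<cdot> ?v))"
      using posD[OF r(1), of ?v] \<open>0 \<le> t\<close>
      by (simp add: cinner_add_right cinner_scaleR_right Re_cinner_self)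
    also have "\<dots> \<le> norm ?v * norm x" unfolding x using Re_cinner_le[of ?v x] by simp
    finally have *: "norm ?v * norm ?v \<le> norm ?v * norm x" by (simp add: power2_eq_square)
    show "norm ?v \<le> 1 * norm x"
    proof (cases "norm ?v = 0")
      case True
      then show ?thesis by simp
    next
      case False
      then have "0 < norm ?v" by simp
      then show ?thesis using * by simp
    qed
  qed simp
  have "\<forall>t. 0 \<le> t \<and> t \<le> real n * \<eta> \<longrightarrow> (\<exists>b\<in>A. b * (1 + t *\<^sub>R r) = 1 \<and> (1 + t *\<^sub>R r) * b = 1)" for n
  proof (induction n)
    case 0
    then show ?case by (intro allI impI bexI[of _ 1]) auto
  next
    case (Suc n)
    show ?case
    proof (intro allI impI)
      fix t assume t: "0 \<le> t \<and> t \<le> real (Suc n) * \<eta>"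
      \<comment> \<open>The truncation keeps \<open>s\<close> in the range of the induction
        hypothesis when \<open>t\<close> is less than one step from 0.\<close>
      define s where "s = max 0 (t - \<eta>)"
      have s: "0 \<le> s" "s \<le> real n * \<eta>" "0 \<le> t - s" "t - s \<le> \<eta>"
        using t \<eta> by (auto simp: s_def algebra_simps)
      obtain b where b: "b \<in> A" "b * (1 + s *\<^sub>R r) = 1" "(1 + s *\<^sub>R r) * b = 1"
        using Suc s(1,2) by blast
      define w where "w = complex_of_real (- (t - s))"
      have nb: "norm (b * r) \<le> norm r"
      proof -
        have "norm (b * r) \<le> norm b * norm r" by (rule norm_mult_ineq)
        also have "\<dots> \<le> 1 * norm r" by (intro mult_right_mono contr[OF b(3) s(1)]) auto
        finally show ?thesis by simp
      qed
      have "cmod w * norm (b * r) \<le> \<eta> * norm r"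
        using s nb \<eta> by (intro mult_mono) (auto simp: w_def simp del: of_real_diff of_real_minus)
      also have "\<dots> < \<eta> * (norm r + 1)" using \<eta> by (intro mult_strict_left_mono) auto
      also have "\<dots> = 1 / 2" using nr by (simp add: \<eta>_def)
      finally have small: "cmod w * norm (b * r) < 1" by simp
      let ?R = "rs (b * r) w"
      \<comment> \<open>As \<open>b\<close> inverts \<open>1 + s r\<close>, the factor
        \<open>1 + (t - s) b r\<close> leads from \<open>1 + s r\<close> to \<open>1 + t r\<close>.
        The sign of \<open>w\<close> is negative because \<open>rs a w\<close> inverts
        \<open>1 - w a\<close>.\<close>
      have "(1 + s *\<^sub>R r) * (1 - w *\<^sub>C (b * r)) = 1 + s *\<^sub>R r + (t - s) *\<^sub>R ((1 + s *\<^sub>R r) * b * r)"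
        by (simp add: w_def scaleR_smult algebra_simps smult_distribs)
      also have "\<dots> = 1 + t *\<^sub>R r" by (simp add: b(3) scaleR_diff_left)
      finally have fac: "1 + t *\<^sub>R r = (1 + s *\<^sub>R r) * (1 - w *\<^sub>C (b * r))" by simp
      have "?R * b * (1 + t *\<^sub>R r) = ?R * (b * (1 + s *\<^sub>R r)) * (1 - w *\<^sub>C (b * r))"
        unfolding fac by (simp only: mult.assoc)
      then have 1: "?R * b * (1 + t *\<^sub>R r) = 1" by (simp only: b(2) mult_1_right rs_inverse_right[OF small])
      have "(1 + t *\<^sub>R r) * (?R * b) = (1 + s *\<^sub>R r) * ((1 - w *\<^sub>C (b * r)) * ?R) * b"
        unfolding fac by (simp only: mult.assoc)
      then have 2: "(1 + t *\<^sub>R r) * (?R * b) = 1" by (simp only: b(3) mult_1_right rs_inverse_left[OF small])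
      have "?R * b \<in> A" using b(1) r(2) small by (intro A.mult_mem A.rs_mem) auto
      then show "\<exists>b\<in>A. b * (1 + t *\<^sub>R r) = 1 \<and> (1 + t *\<^sub>R r) * b = 1" using 1 2 by blast
    qed
  qed
  moreover obtain n where "t \<le> real n * \<eta>" using reals_Archimedean3[OF \<eta>] by (meson less_imp_le)
  ultimately show ?thesis using t by blast
qed

lemma sa_inverse:
  assumes "sa a" "b * a = 1" "a * b = 1"
  shows "sa b"
  unfolding sa_iff
proof (intro allI)
  fix x y
  have *: "a \<cdot> b \<cdot> x = x" for x by (metis app_simps(4,5) assms(3))
  have "cinner (b \<cdot> x) y = cinner (b \<cdot> x) (a \<cdot> b \<cdot> y)" by (simp only: *)
  also have "\<dots> = cinner (a \<cdot> b \<cdot> x) (b \<cdot> y)" by (simp only: saD[OF assms(1)])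
  finally show "cinner (b \<cdot> x) y = cinner x (b \<cdot> y)" by (simp only: *)
qed

lemma inverse_commute:
  fixes a :: "'a::monoid_mult"
  assumes "b * a = 1" "a * b = 1" "a * c = c * a"
  shows "b * c = c * b"
  by (metis assms mult.assoc mult_1_left mult_1_right)

text \<open>The product is the conjugate, by the self-adjoint \<open>b * c\<close>, of
  \<open>(1 + p r) (1 + q r) r\<close>, a polynomial in \<open>r\<close> with positive
  terms.\<close>

lemma pos_resolvent_product:
  fixes r :: "'h::complex_hilbert cop"
  assumes r: "pos r" and pq: "0 \<le> p" "0 \<le> q"
    and b: "b * (1 + p *\<^sub>R r) = 1" "(1 + p *\<^sub>R r) * b = 1"
    and c: "c * (1 + q *\<^sub>R r) = 1" "(1 + q *\<^sub>R r) * c = 1"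
  shows "pos (r * b * c)"
proof -
  have br: "b * r = r * b" by (rule inverse_commute[OF b]) (simp add: algebra_simps)
  have cr: "c * r = r * c" by (rule inverse_commute[OF c]) (simp add: algebra_simps)
  have bc: "b * c = c * b" by (rule inverse_commute[OF b]) (simp add: algebra_simps cr)
  have sa: "sa (b * c)"
    by (intro sa_mult bc sa_inverse[OF _ b] sa_inverse[OF _ c] sa_add sa_scaleR pos_sa[OF r] sa_one)
  have "pos (r * 1 * r)" "pos (r * r * r)"
    by (rule pos_conj[OF pos_one pos_sa[OF r]], rule pos_conj[OF r pos_sa[OF r]])
  then have "pos (r + (p + q) *\<^sub>R (r * r) + (p * q) *\<^sub>R (r * r * r))"
    using r pq by (intro pos_add pos_scaleR) auto
  then have P: "pos ((1 + p *\<^sub>R r) * (1 + q *\<^sub>R r) * r)" by (simp add: algebra_simps)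
  have "(b * c) * ((1 + p *\<^sub>R r) * (1 + q *\<^sub>R r) * r) * (b * c) =
      c * (b * (1 + p *\<^sub>R r)) * (1 + q *\<^sub>R r) * r * (b * c)"
    by (simp only: bc mult.assoc)
  also have "\<dots> = r * b * c" by (simp only: b c mult_1_right mult_1_left mult.assoc)
  finally show ?thesis using pos_conj[OF P sa] by simp
qed

section \<open>Closures of algebras and freeness\<close>

lemma closed_subalgebra_closure:
  fixes S :: "'a::complex_banach_algebra set"
  assumes "1 \<in> S" "\<And>x y. x \<in> S \<Longrightarrow> y \<in> S \<Longrightarrow> x + y \<in> S" "\<And>x y. x \<in> S \<Longrightarrow> y \<in> S \<Longrightarrow> x * y \<in> S"
    "\<And>c x. x \<in> S \<Longrightarrow> c *\<^sub>C x \<in> S"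
  shows "closed_subalgebra (closure S)"
proof
  show "1 \<in> closure S" using assms(1) closure_subset by blast
  fix x y assume "x \<in> closure S" "y \<in> closure S"
  then obtain f g where f: "\<And>n. f n \<in> S" "f \<longlonglongrightarrow> x" and g: "\<And>n. g n \<in> S" "g \<longlonglongrightarrow> y"
    unfolding closure_sequential by blast
  show "x + y \<in> closure S"
    unfolding closure_sequential using f g
    by (intro exI[of _ "\<lambda>n. f n + g n"]) (auto intro: assms tendsto_add)
  show "x * y \<in> closure S"
    unfolding closure_sequential using f g
    by (intro exI[of _ "\<lambda>n. f n * g n"]) (auto intro: assms tendsto_mult)
next
  fix c x assume "x \<in> closure S"
  then obtain f where f: "\<And>n. f n \<in> S" "f \<longlonglongrightarrow> x"
    unfolding closure_sequential by blast
  then show "c *\<^sub>C x \<in> closure S"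
    unfolding closure_sequential
    by (intro exI[of _ "\<lambda>n. c *\<^sub>C f n"]) (auto intro: assms tendsto_smult tendsto_const)
qed simp

text \<open>Serves the von Neumann algebra, which is the commutant of its own commutant, and carries
  commutation relations from an operator to the closed algebra it generates.\<close>

lemma closed_subalgebra_commutant:
  fixes C :: "'a::complex_banach_algebra set"
  shows "closed_subalgebra {a. \<forall>s\<in>C. a * s = s * a}"
proof
  have "closed {a. a * s = s * a}" for s :: 'a
    by (intro closed_Collect_eq continuous_intros)
  then have "closed (\<Inter>s\<in>C. {a. a * s = s * a})" by (intro closed_INT ballI)
  also have "(\<Inter>s\<in>C. {a. a * s = s * a}) = {a. \<forall>s\<in>C. a * s = s * a}" by auto
  finally show "closed {a. \<forall>s\<in>C. a * s = s * a}" .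
  fix x y assume "x \<in> {a. \<forall>s\<in>C. a * s = s * a}" "y \<in> {a. \<forall>s\<in>C. a * s = s * a}"
  then have *: "x * s = s * x" "y * s = s * y" if "s \<in> C" for s using that by auto
  have "x * y * s = s * (x * y)" if "s \<in> C" for s
  proof -
    have "x * y * s = x * (s * y)" using *(2)[OF that] by (simp add: mult.assoc)
    also have "\<dots> = s * (x * y)" using *(1)[OF that] by (simp flip: mult.assoc)
    finally show ?thesis .
  qed
  then show "x * y \<in> {a. \<forall>s\<in>C. a * s = s * a}" by simp
  show "x + y \<in> {a. \<forall>s\<in>C. a * s = s * a}" using * by (simp add: distrib_left distrib_right)
qed auto

text \<open>Approximants of a centred letter can be centred themselves: the subtracted scalars tend
  to the trace of the limit, which is 0. Words then converge in norm, and the trace is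
  continuous.\<close>

lemma (in tracial_algebra) free_closure:
  fixes S :: "'i \<Rightarrow> 'a set"
  assumes S: "\<And>i. S i \<subseteq> A" "\<And>i. 1 \<in> S i" "\<And>i x y. x \<in> S i \<Longrightarrow> y \<in> S i \<Longrightarrow> x + y \<in> S i"
      "\<And>i c x. x \<in> S i \<Longrightarrow> c *\<^sub>C x \<in> S i"
    and free: "\<And>xs. xs \<noteq> [] \<Longrightarrow> (\<forall>(i, a) \<in> set xs. a \<in> S i \<and> \<tau> a = 0) \<Longrightarrow>
      distinct_adj (map fst xs) \<Longrightarrow> \<tau> (prod_list (map snd xs)) = 0"
    and xs: "xs \<noteq> []" "\<forall>(i, a) \<in> set xs. a \<in> closure (S i) \<and> \<tau> a = 0" "distinct_adj (map fst xs)"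
  shows "\<tau> (prod_list (map snd xs)) = 0"
proof -
  have clA: "closure (S i) \<subseteq> A" for i by (rule closure_minimal[OF S(1) closed])
  have "\<exists>f. (\<forall>n. f n \<in> S i \<and> \<tau> (f n) = 0) \<and> f \<longlonglongrightarrow> a" if a: "a \<in> closure (S i)" "\<tau> a = 0" for i a
  proof -
    obtain f where f: "\<And>n. f n \<in> S i" "f \<longlonglongrightarrow> a" using a(1) unfolding closure_sequential by blast
    have fA: "f n \<in> A" for n using f(1) S(1) by blast
    have "(\<lambda>n. \<tau> (f n)) \<longlonglongrightarrow> \<tau> a" by (rule tendsto_tau[OF f(2) fA]) (use a clA in blast)
    then have "(\<lambda>n. f n + (- \<tau> (f n)) *\<^sub>C 1) \<longlonglongrightarrow> a + (- \<tau> a) *\<^sub>C 1"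
      by (intro tendsto_intros f)
    moreover have "f n + (- \<tau> (f n)) *\<^sub>C 1 \<in> S i" for n by (intro S f)
    moreover have "\<tau> (f n + (- \<tau> (f n)) *\<^sub>C 1) = 0" for n
      using tau_add[OF fA smult_mem[OF one_mem], of n "- \<tau> (f n)"] tau_smult[OF one_mem, of "- \<tau> (f n)"] by simp
    ultimately show ?thesis using a(2)
      by (intro exI[of _ "\<lambda>n. f n + (- \<tau> (f n)) *\<^sub>C 1"]) simp
  qed
  then have "\<forall>p. \<exists>f. snd p \<in> closure (S (fst p)) \<and> \<tau> (snd p) = 0 \<longrightarrow>
      (\<forall>n. f n \<in> S (fst p) \<and> \<tau> (f n) = 0) \<and> f \<longlonglongrightarrow> snd p" by blast
  from choice[OF this] obtain f where f: "\<forall>p. snd p \<in> closure (S (fst p)) \<and> \<tau> (snd p) = 0 \<longrightarrow>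
      (\<forall>n. f p n \<in> S (fst p) \<and> \<tau> (f p n) = 0) \<and> f p \<longlonglongrightarrow> snd p" ..
  have fx: "(\<forall>n. f p n \<in> S (fst p) \<and> \<tau> (f p n) = 0) \<and> f p \<longlonglongrightarrow> snd p" if "p \<in> set xs" for p
    using f xs(2) that by fastforce
  define ys where "ys n = map (\<lambda>p. (fst p, f p n)) xs" for n
  have "(\<lambda>n. prod_list (map (\<lambda>p. f p n) zs)) \<longlonglongrightarrow> prod_list (map snd zs)"
    if "set zs \<subseteq> set xs" for zs using that
    by (induction zs) (auto intro!: tendsto_mult dest: fx)
  then have lim: "(\<lambda>n. prod_list (map snd (ys n))) \<longlonglongrightarrow> prod_list (map snd xs)"
    by (simp add: ys_def o_def)
  have prodA: "prod_list zs \<in> A" if "set zs \<subseteq> A" for zs using that by (induction zs) auto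
  have "(\<lambda>n. \<tau> (prod_list (map snd (ys n)))) \<longlonglongrightarrow> \<tau> (prod_list (map snd xs))"
  proof (rule tendsto_tau[OF lim])
    show "prod_list (map snd (ys n)) \<in> A" for n
      by (rule prodA) (use fx S(1) in \<open>fastforce simp: ys_def\<close>)
    show "prod_list (map snd xs) \<in> A"
      by (rule prodA) (use xs(2) clA in fastforce)
  qed
  moreover have "\<tau> (prod_list (map snd (ys n))) = 0" for n
  proof (rule free)
    show "ys n \<noteq> []" using xs by (simp add: ys_def)
    show "\<forall>(i, a) \<in> set (ys n). a \<in> S i \<and> \<tau> a = 0" using fx by (auto simp: ys_def)
    show "distinct_adj (map fst (ys n))" using xs(3) by (simp add: ys_def o_def)
  qed
  ultimately show ?thesis by (simp add: LIMSEQ_const_iff)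
qed

definition generated :: "'h::complex_hilbert cop \<Rightarrow> 'h cop set" where
  "generated a = {b. op_of b \<in> unital_subalgebra {op_of a}}"

lemma generated_one: "1 \<in> generated a"
  and generated_self: "a \<in> generated a"
  and generated_add: "b \<in> generated a \<Longrightarrow> c \<in> generated a \<Longrightarrow> b + c \<in> generated a"
  and generated_mult: "b \<in> generated a \<Longrightarrow> c \<in> generated a \<Longrightarrow> b * c \<in> generated a"
  and generated_smult: "b \<in> generated a \<Longrightarrow> z *\<^sub>C b \<in> generated a"
  by (simp_all add: generated_def one_cop.rep_eq plus_cop.rep_eq times_cop.rep_eq scaleC_cop.rep_eq
      unital_subalgebra.intros)

lemma unital_subalgebra_least:
  assumes "T \<in> unital_subalgebra {op_of a}" "closed_subalgebra S" "a \<in> S"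
  shows "\<exists>b\<in>S. T = op_of b"
proof -
  interpret closed_subalgebra S by (rule assms(2))
  show ?thesis
    using assms(1)
  proof induction
    case unit
    then show ?case by (intro bexI[of _ 1]) (auto simp: one_cop.rep_eq)
  next
    case (gen T)
    then show ?case using assms(3) by auto
  next
    case (add T T')
    then obtain b c where "b \<in> S" "c \<in> S" "T = op_of b" "T' = op_of c" by auto
    then show ?case by (intro bexI[of _ "b + c"]) (auto simp: plus_cop.rep_eq)
  next
    case (scale T z)
    then obtain b where "b \<in> S" "T = op_of b" by auto
    then show ?case by (intro bexI[of _ "z *\<^sub>C b"]) (auto simp: scaleC_cop.rep_eq)
  next
    case (mult T T')
    then obtain b c where "b \<in> S" "c \<in> S" "T = op_of b" "T' = op_of c" by auto
    then show ?case by (intro bexI[of _ "b * c"]) (auto simp: times_cop.rep_eq)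
  qed
qed

lemma closed_subalgebra_generated: "closed_subalgebra (closure (generated a))"
  by (rule closed_subalgebra_closure) (auto intro: generated_one generated_add generated_mult generated_smult)

lemma closure_generated_least:
  assumes "closed_subalgebra S" "a \<in> S"
  shows "closure (generated a) \<subseteq> S"
proof (rule closure_minimal)
  show "generated a \<subseteq> S"
  proof
    fix b assume "b \<in> generated a"
    then obtain c where "c \<in> S" "op_of b = op_of c"
      using unital_subalgebra_least[OF _ assms] by (auto simp: generated_def)
    then show "b \<in> S" by (simp add: op_of_inject)
  qed
  show "closed S" using assms(1) by (rule closed_subalgebra.closed)
qed

lemma closure_generated_self: "a \<in> closure (generated a)"
  using closure_subset generated_self by blast

lemma closure_generated_commute:
  assumes "x * a = a * x" "b \<in> closure (generated a)"
  shows "b * x = x * b"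
proof -
  have "closure (generated a) \<subseteq> {b. \<forall>s\<in>{x}. b * s = s * b}"
    by (rule closure_generated_least[OF closed_subalgebra_commutant]) (use assms in simp)
  then show ?thesis using assms(2) by auto
qed

section \<open>The trace on operators\<close>

context wstar_probability_space
begin

definition alg :: "'h cop set" where
  "alg = {a. op_of a \<in> \<A>}"

definition tr :: "'h cop \<Rightarrow> complex" where
  "tr a = \<phi> (op_of a)"

lemma A_bounded: "\<A> \<subseteq> bounded_ops" and A_bicommutant: "commutant (commutant \<A>) = \<A>"
  and A_adjoint: "T \<in> \<A> \<Longrightarrow> \<exists>S\<in>\<A>. is_adjoint S T"
  using finite_vN by (auto simp: finite_von_neumann_algebra_def von_neumann_algebra_def)

lemma cop_of_A:
  assumes "T \<in> \<A>"
  obtains a where "T = op_of a" "a \<in> alg"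
proof (rule that[of "cop T"])
  show "T = op_of (cop T)" using assms A_bounded by (subst cop_inverse) auto
  then show "cop T \<in> alg" using assms by (simp add: alg_def)
qed

lemma closed_subalgebra_alg: "closed_subalgebra alg"
proof -
  have "alg = {a. \<forall>s\<in>{s. op_of s \<in> commutant \<A>}. a * s = s * a}"
  proof (intro set_eqI iffI)
    fix a assume "a \<in> alg"
    then have "op_of a \<in> commutant (commutant \<A>)" by (simp add: alg_def A_bicommutant)
    then show "a \<in> {a. \<forall>s\<in>{s. op_of s \<in> commutant \<A>}. a * s = s * a}"
      by (auto simp: commutant_def[of "commutant \<A>"] times_cop.rep_eq simp flip: op_of_inject)
  next
    fix a assume a: "a \<in> {a. \<forall>s\<in>{s. op_of s \<in> commutant \<A>}. a * s = s * a}"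
    have "op_of a o\<^sub>L S = S o\<^sub>L op_of a" if "S \<in> commutant \<A>" for S
    proof -
      have S: "op_of (cop S) = S" using that by (simp add: commutant_def cop_inverse)
      then have "a * cop S = cop S * a" using a that by simp
      then show ?thesis using S by (metis times_cop.rep_eq)
    qed
    then have "op_of a \<in> commutant (commutant \<A>)"
      using op_of by (simp add: commutant_def[of "commutant \<A>"])
    then show "a \<in> alg" by (simp add: alg_def A_bicommutant)
  qed
  then show ?thesis by (simp only: closed_subalgebra_commutant)
qed

sublocale alg: closed_subalgebra alg by (rule closed_subalgebra_alg)

lemma tr_add: "a \<in> alg \<Longrightarrow> b \<in> alg \<Longrightarrow> tr (a + b) = tr a + tr b"
  by (simp add: tr_def alg_def plus_cop.rep_eq state_add)

lemma tr_smult: "a \<in> alg \<Longrightarrow> tr (c *\<^sub>C a) = c * tr a"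
  by (simp add: tr_def alg_def scaleC_cop.rep_eq state_scaleC)

lemma tr_one: "tr 1 = 1"
  by (simp add: tr_def one_cop.rep_eq state_unit)

lemma tr_pos: "a \<in> alg \<Longrightarrow> pos a \<Longrightarrow> Im (tr a) = 0 \<and> 0 \<le> Re (tr a)"
  unfolding tr_def pos_def alg_def by (rule state_pos) simp_all

lemma tr_faithful: "a \<in> alg \<Longrightarrow> pos a \<Longrightarrow> tr a = 0 \<Longrightarrow> a = 0"
  using faithful[of "op_of a"] by (simp add: tr_def pos_def alg_def zero_cop.rep_eq flip: op_of_inject)

lemma tr_bound_sa:
  assumes "a \<in> alg" "sa a"
  shows "cmod (tr a) \<le> norm a"
proof -
  have m: "norm a *\<^sub>R 1 \<in> alg" "-1 *\<^sub>C a \<in> alg" using assms by (auto simp: scaleR_smult)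
  have t: "tr (norm a *\<^sub>R 1) = norm a" by (simp add: scaleR_smult tr_smult tr_one)
  have "pos (norm a *\<^sub>R 1 - a)" by (rule pos_norm_minus[OF assms(2)]) simp
  then have 1: "pos (norm a *\<^sub>R 1 + (-1) *\<^sub>C a)" by simp
  have "sa (- a)" using sa_scaleR[OF assms(2), of "-1"] by simp
  then have "pos (norm a *\<^sub>R 1 - (- a))" by (rule pos_norm_minus) simp
  then have 2: "pos (norm a *\<^sub>R 1 + a)" by simp
  have "Im (tr (norm a *\<^sub>R 1 + (-1) *\<^sub>C a)) = 0 \<and> 0 \<le> Re (tr (norm a *\<^sub>R 1 + (-1) *\<^sub>C a))"
    by (rule tr_pos[OF alg.add_mem[OF m] 1])
  moreover have "0 \<le> Re (tr (norm a *\<^sub>R 1 + a))"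
    using tr_pos[OF alg.add_mem[OF m(1) assms(1)] 2] by simp
  ultimately have "Im (tr a) = 0" "\<bar>Re (tr a)\<bar> \<le> norm a"
    using tr_add[OF m] tr_add[OF m(1) assms(1)] tr_smult[OF assms(1), of "-1"] t by auto
  then show ?thesis by (simp add: cmod_eq_Re)
qed

text \<open>The adjoint of \<open>a\<close> has norm at most \<open>norm a\<close>, so the
  self-adjoint real and imaginary parts \<open>h\<close> and \<open>k\<close> do too; each
  contributes one \<open>norm a\<close> to the factor 2.\<close>

lemma tr_bound:
  assumes a: "a \<in> alg"
  shows "cmod (tr a) \<le> 2 * norm a"
proof -
  obtain S where "S \<in> \<A>" "is_adjoint S (op_of a)" using A_adjoint a by (auto simp: alg_def)
  then obtain b where b: "b \<in> alg" "is_adjoint (op_of b) (op_of a)" by (metis cop_of_A)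
  have adj: "cinner (b \<cdot> x) y = cinner x (a \<cdot> y)" for x y using b(2) by (simp add: is_adjoint_def)
  have adj': "cinner (a \<cdot> x) y = cinner x (b \<cdot> y)" for x y
    using adj[of y x] cinner_commute[of x "b \<cdot> y"] cinner_commute[of "a \<cdot> x" y] by simp
  have nb: "norm b \<le> norm a"
  proof (rule norm_cop_le)
    fix x
    have "norm (b \<cdot> x) * norm (b \<cdot> x) = Re (cinner (b \<cdot> x) (b \<cdot> x))" by (simp add: Re_cinner_self power2_eq_square)
    also have "\<dots> = Re (cinner x (a \<cdot> b \<cdot> x))" by (simp only: adj)
    also have "\<dots> \<le> norm x * norm (a \<cdot> b \<cdot> x)" using Re_cinner_le[of x "a \<cdot> b \<cdot> x"] by simp
    also have "\<dots> \<le> norm x * (norm a * norm (b \<cdot> x))" by (intro mult_left_mono norm_app_le) simp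
    finally have *: "norm (b \<cdot> x) * norm (b \<cdot> x) \<le> (norm a * norm x) * norm (b \<cdot> x)" by (simp add: mult_ac)
    show "norm (b \<cdot> x) \<le> norm a * norm x"
    proof (cases "norm (b \<cdot> x) = 0")
      case False
      then have "0 < norm (b \<cdot> x)" by simp
      with * show ?thesis by (rule mult_right_le_imp_le)
    next
      case True
      then show ?thesis by (simp only: mult_nonneg_nonneg norm_ge_zero)
    qed
  qed simp
  define h where "h = (1 / 2 :: complex) *\<^sub>C (a + b)"
  define k where "k = (- \<i> / 2) *\<^sub>C (a - b)"
  have m: "h \<in> alg" "k \<in> alg" using a b by (auto simp: h_def k_def)
  have "sa h" "sa k"
    by (simp_all add: h_def k_def sa_iff cinner_scaleC_left cinner_scaleC_right cinner_add_left
        cinner_add_right cinner_diff_left cinner_diff_right cinner_minus_left cinner_minus_right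
        adj adj' algebra_simps)
  then have "cmod (tr h) \<le> norm h" "cmod (tr k) \<le> norm k" using m by (auto intro: tr_bound_sa)
  moreover have "norm h \<le> norm a"
    using norm_triangle_ineq[of a b] nb by (simp add: h_def norm_smult)
  moreover have "norm k \<le> norm a"
    using norm_triangle_ineq4[of a b] nb by (simp add: k_def norm_smult)
  moreover have "a = h + \<i> *\<^sub>C k"
  proof -
    have "h + \<i> *\<^sub>C k = (1 / 2 + 1 / 2 :: complex) *\<^sub>C a"
      unfolding h_def k_def by (subst smult_add_left) (simp add: smult_distribs)
    then show ?thesis by simp
  qed
  then have "tr a = tr h + \<i> * tr k" using m by (metis alg.smult_mem tr_add tr_smult)
  then have "cmod (tr a) \<le> cmod (tr h) + cmod (tr k)" by (metis norm_ii mult_1 norm_mult norm_triangle_ineq)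
  ultimately show ?thesis by simp
qed

sublocale tr: tracial_algebra alg tr 2
proof
  show "tr (a * b) = tr (b * a)" if "a \<in> alg" "b \<in> alg" for a b
    using that tracial by (simp add: tr_def alg_def times_cop.rep_eq)
qed (auto intro: tr_add tr_smult tr_one tr_bound)

text \<open>Extends the assumed freeness of polynomials in \<open>R\<close> and \<open>Y\<close> to
  the closed algebras, which contain the resolvents.\<close>

lemma tr_free:
  assumes free: "free_variables \<phi> (op_of r) (op_of y)" and mem: "r \<in> alg" "y \<in> alg"
    and xs: "xs \<noteq> []" "\<forall>(i, a) \<in> set xs. a \<in> (if i then closure (generated r) else closure (generated y)) \<and> tr a = 0"
      "distinct_adj (map fst xs)"
  shows "tr (prod_list (map snd xs)) = 0"
proof (rule tr.free_closure[where S = "\<lambda>b. generated (if b then r else y)"])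
  show "generated (if b then r else y) \<subseteq> alg" for b
    using closure_generated_least[OF closed_subalgebra_alg, of "if b then r else y"] closure_subset mem
    by (cases b) auto
  show "\<forall>(i, a) \<in> set xs. a \<in> closure (generated (if i then r else y)) \<and> tr a = 0"
    using xs(2) by (auto split: if_splits)
  fix ys :: "(bool \<times> 'h cop) list"
  assume ys: "ys \<noteq> []" "\<forall>(i, a) \<in> set ys. a \<in> generated (if i then r else y) \<and> tr a = 0"
    "distinct_adj (map fst ys)"
  define zs where "zs = map (\<lambda>(i, a). (i, op_of a)) ys"
  have "op_of (prod_list (map snd ys)) = foldr (\<lambda>(i, a) T. a o\<^sub>L T) zs id_blinfun"
    unfolding zs_def by (induction ys) (auto simp: one_cop.rep_eq times_cop.rep_eq)
  moreover have "\<phi> (foldr (\<lambda>(i, a) T. a o\<^sub>L T) zs id_blinfun) = 0"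
  proof (rule free[unfolded free_variables_def free_family_def, rule_format], intro conjI allI impI)
    show "zs \<noteq> []" using ys(1) by (simp add: zs_def)
    show "\<forall>(i, a)\<in>set zs. i \<in> UNIV \<and> a \<in> unital_subalgebra {if i then op_of r else op_of y} \<and> \<phi> a = 0"
      using ys(2) by (fastforce simp: zs_def generated_def tr_def)
    show "fst (zs ! j) \<noteq> fst (zs ! Suc j)" if "Suc j < length zs" for j
      using ys(3) that by (auto simp: zs_def distinct_adj_conv_nth case_prod_beta)
  qed
  ultimately show "tr (prod_list (map snd ys)) = 0" by (simp add: tr_def)
qed (use xs in \<open>auto intro: generated_one generated_add generated_smult\<close>)

section \<open>The subordination function near the origin\<close>

lemma moment_transform_eq:
  assumes "d * (1 - z *\<^sub>C a) = 1" "(1 - z *\<^sub>C a) * d = 1"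
  shows "moment_transform \<phi> (op_of a) z = tr (z *\<^sub>C (a * d))"
proof -
  have "moment_transform \<phi> (op_of a) z = tr ((z *\<^sub>C a) * d)"
    by (simp only: moment_transform_def res_eq(1)[OF assms] tr_def times_cop.rep_eq scaleC_cop.rep_eq)
  then show ?thesis by simp
qed

text \<open>At \<open>- t\<close> the transform is \<open>tr b - 1\<close> with \<open>b\<close> the
  inverse of \<open>1 + t r\<close>. The resolvent identity gives \<open>b - c\<close> as
  \<open>s - t\<close> times the positive nonzero operator \<open>r * b * c\<close>, and
  faithfulness makes the inequality strict.\<close>

lemma moment_transform_mono:
  assumes r: "r \<in> alg" "pos r" "r \<noteq> 0" and st: "0 \<le> s" "s < t"
  shows "Re (moment_transform \<phi> (op_of r) (of_real (- t))) < Re (moment_transform \<phi> (op_of r) (of_real (- s)))"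
proof -
  obtain b where b: "b \<in> alg" "b * (1 + t *\<^sub>R r) = 1" "(1 + t *\<^sub>R r) * b = 1"
    using pos_invertible[OF r(2,1) closed_subalgebra_alg, of t] st by auto
  obtain c where c: "c \<in> alg" "c * (1 + s *\<^sub>R r) = 1" "(1 + s *\<^sub>R r) * c = 1"
    using pos_invertible[OF r(2,1) closed_subalgebra_alg, of s] st by auto
  have mt: "moment_transform \<phi> (op_of r) (of_real (- t)) = tr d - 1"
    if d: "d \<in> alg" "d * (1 + t *\<^sub>R r) = 1" "(1 + t *\<^sub>R r) * d = 1" for d t
  proof -
    have "moment_transform \<phi> (op_of r) (of_real (- t)) = tr (of_real (- t) *\<^sub>C (r * d))"
      using d by (intro moment_transform_eq) (simp_all add: scaleR_smult)
    also have "of_real (- t) *\<^sub>C (r * d) = d - 1"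
      using d(3) by (simp add: scaleR_smult algebra_simps)
    finally show ?thesis using d(1) by (simp add: tr.tau_diff)
  qed
  have "b - c = b * ((1 + s *\<^sub>R r) * c) - (b * (1 + t *\<^sub>R r)) * c" by (simp only: b c mult_1_left mult_1_right)
  also have "\<dots> = (s - t) *\<^sub>R (b * r * c)" by (simp add: algebra_simps)
  also have "b * r = r * b" by (rule inverse_commute[OF b(2,3)]) (simp add: algebra_simps)
  finally have bc: "b - c = complex_of_real (s - t) *\<^sub>C (r * b * c)" by (simp add: scaleR_smult)
  have p: "pos (r * b * c)" using pos_resolvent_product[OF r(2) _ st(1) b(2,3) c(2,3)] st by simp
  have m: "r * b * c \<in> alg" using r b c by auto
  have "r * b * c \<noteq> 0"
  proof
    assume "r * b * c = 0"
    then have "r * b * c * (1 + s *\<^sub>R r) * (1 + t *\<^sub>R r) = 0" by simp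
    then have "r * (b * (c * (1 + s *\<^sub>R r))) * (1 + t *\<^sub>R r) = 0" by (simp only: mult.assoc)
    then have "r * (b * (1 + t *\<^sub>R r)) = 0" by (simp only: c(2) mult_1_right mult.assoc)
    then show False using r(3) by (simp only: b(2) mult_1_right)
  qed
  then have "tr (r * b * c) \<noteq> 0" using tr_faithful[OF m p] by blast
  with tr_pos[OF m p] have "0 < Re (tr (r * b * c))" by (auto simp: complex_eq_iff less_le)
  then have "(s - t) * Re (tr (r * b * c)) < 0" using st by (intro mult_neg_pos) auto
  moreover have "tr b - tr c = complex_of_real (s - t) * tr (r * b * c)"
    using arg_cong[OF bc, of tr] b(1) c(1) m by (simp add: tr.tau_diff tr_smult)
  from arg_cong[OF this, of Re]
  have "Re (tr b) - Re (tr c) = (s - t) * Re (tr (r * b * c))" by simp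
  ultimately have "Re (tr b) < Re (tr c)" by linarith
  then show ?thesis using mt[OF b] mt[OF c] by simp
qed

end

text \<open>Cosine decreases on \<open>[0, pi]\<close> and is already negative at the argument of
  \<open>w\<close>. The point \<open>z = 0\<close> has no polar form and is settled
  separately.\<close>

lemma Re_nonpos_if_Arg_ge:
  assumes "0 < Im w" "Re w < 0" "Arg w \<le> Arg z"
  shows "Re z \<le> 0"
proof (cases "z = 0")
  case False
  have "w \<noteq> 0" using assms by auto
  have "0 < Arg w" "Arg w < pi" using Arg_lt_pi[of w] assms(1) by auto
  then have "cos (Arg z) \<le> cos (Arg w)"
    using assms(3) Arg_le_pi[of z] by (intro cos_monotone_0_pi_le) auto
  also have "\<dots> < 0" using assms(2) \<open>w \<noteq> 0\<close> by (simp add: cos_Arg divide_neg_pos)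
  finally show ?thesis using False by (simp add: cos_Arg divide_less_0_iff)
qed simp

lemma open_slit_plane: "open slit_plane"
proof -
  have "complex_of_real ` {0..} = {z. Im z = 0} \<inter> {z. 0 \<le> Re z}"
    by (auto simp: image_iff complex_eq_iff)
  moreover have "closed ({z. Im z = 0} \<inter> {z. 0 \<le> Re z})"
    by (intro closed_Int closed_Collect_eq closed_Collect_le continuous_intros)
  ultimately show ?thesis unfolding slit_plane_def by (simp only: open_Compl)
qed

lemma slit_plane_iff: "z \<in> slit_plane \<longleftrightarrow> Im z \<noteq> 0 \<or> Re z < 0"
  by (auto simp: slit_plane_def image_iff complex_eq_iff not_le)

text \<open>The set is starlike about \<open>- r / 2\<close>: a segment from there to a point of the
  set either leaves the real line at once or stays on its negative half.\<close>

lemma connected_ball_slit_plane: "0 < r \<Longrightarrow> connected (ball 0 r \<inter> slit_plane)"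
proof (rule starlike_imp_connected)
  assume r: "0 < r"
  define a where "a = complex_of_real (- r / 2)"
  have "a \<in> ball 0 r \<inter> slit_plane" using r by (simp add: a_def slit_plane_iff)
  moreover have "closed_segment a z \<subseteq> ball 0 r \<inter> slit_plane" if z: "z \<in> ball 0 r \<inter> slit_plane" for z
  proof
    fix p assume p: "p \<in> closed_segment a z"
    have "p \<in> ball 0 r"
      using closed_segment_subset[OF _ _ convex_ball, of a 0 r z] p z \<open>a \<in> _\<close> by auto
    moreover have "p \<in> slit_plane"
    proof -
      obtain u where u: "0 \<le> u" "u \<le> 1" "p = (1 - u) *\<^sub>R a + u *\<^sub>R z"
        using p by (auto simp: in_segment)
      have pz: "Im p = u * Im z" "Re p = (1 - u) * (- r / 2) + u * Re z"
        by (simp_all add: u(3) a_def)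
      show ?thesis
      proof (cases "u = 0 \<or> Im z \<noteq> 0")
        case True
        then show ?thesis using r by (auto simp: slit_plane_iff pz)
      next
        case False
        then have "Re z < 0" using z by (simp add: slit_plane_iff)
        then have "u * Re z < 0" using False u(1) by (simp add: mult_pos_neg)
        moreover have "(1 - u) * (- r / 2) \<le> 0" using u r by (simp add: mult_nonneg_nonneg)
        ultimately show ?thesis by (simp add: slit_plane_iff pz)
      qed
    qed
    ultimately show "p \<in> ball 0 r \<inter> slit_plane" by simp
  qed
  ultimately show "starlike (ball 0 r \<inter> slit_plane)" unfolding starlike_def by blast
qed

text \<open>Symmetry under conjugation makes the value real. Its sign comes from approaching
  \<open>x\<close> through the upper half-plane, where the condition on arguments applies.\<close>

lemma subordination_negative_axis:
  assumes sub: "subordination_functions \<phi> U Y R \<omega>1 \<omega>2" and x: "x < 0"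
  shows "Im (\<omega>2 (of_real x)) = 0" "Re (\<omega>2 (of_real x)) \<le> 0"
proof -
  have hol: "\<omega>2 holomorphic_on slit_plane"
    and cnj: "\<forall>z \<in> slit_plane. \<omega>2 (cnj z) = cnj (\<omega>2 z)"
    and arg: "\<forall>z. 0 < Im z \<longrightarrow> Arg z \<le> Arg (\<omega>2 z)"
    using sub by (simp_all add: subordination_functions_def)
  have xs: "of_real x \<in> slit_plane" using x by (simp add: slit_plane_iff)
  have "\<omega>2 (of_real x) = cnj (\<omega>2 (of_real x))" using cnj xs by force
  then show "Im (\<omega>2 (of_real x)) = 0" by (simp add: complex_eq_iff)
  have "isCont \<omega>2 (of_real x)"
    using holomorphic_on_imp_continuous_on[OF hol] open_slit_plane xs
    by (simp add: continuous_on_eq_continuous_at)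
  moreover have "(\<lambda>n. Complex x (inverse (real (Suc n)))) \<longlonglongrightarrow> Complex x 0"
    by (intro tendsto_Complex tendsto_const LIMSEQ_inverse_real_of_nat)
  then have "(\<lambda>n. Complex x (inverse (real (Suc n)))) \<longlonglongrightarrow> of_real x"
    by (simp add: complex_of_real_def)
  ultimately have "(\<lambda>n. \<omega>2 (Complex x (inverse (real (Suc n))))) \<longlonglongrightarrow> \<omega>2 (of_real x)"
    by (rule isCont_tendsto_compose)
  then have "(\<lambda>n. Re (\<omega>2 (Complex x (inverse (real (Suc n)))))) \<longlonglongrightarrow> Re (\<omega>2 (of_real x))"
    by (rule tendsto_Re)
  moreover have "Re (\<omega>2 (Complex x (inverse (real (Suc n))))) \<le> 0" for n
    by (rule Re_nonpos_if_Arg_ge[of "Complex x (inverse (real (Suc n)))"]) (use arg x in auto)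
  ultimately show "Re (\<omega>2 (of_real x)) \<le> 0" by (intro LIMSEQ_le_const2) auto
qed

text \<open>On the negative axis \<open>\<omega>\<^sub>2\<close> is determined by strict monotonicity of the moment transform of \<open>R\<close>
  on \<open>(-\<infinity>, 0]\<close>, which forces it to be small near \<open>0\<close>; the rest is analytic continuation.\<close>

lemma (in wstar_probability_space) subordination_near_zero:
  assumes r: "r \<in> alg" "pos r" "r \<noteq> 0"
    and sub: "subordination_functions \<phi> U Y (op_of r) \<omega>1 \<omega>2"
    and \<delta>: "0 < \<delta>" "inj_on (moment_transform \<phi> (op_of r)) (ball 0 \<delta>)"
    and \<epsilon>: "0 < \<epsilon>" "\<omega> holomorphic_on ball 0 \<epsilon>" "moment_transform \<phi> U holomorphic_on ball 0 \<epsilon>"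
      "moment_transform \<phi> U 0 = 0"
      "\<And>z. z \<in> ball 0 \<epsilon> \<Longrightarrow> \<omega> z \<in> ball 0 \<delta>"
      "\<And>z. z \<in> ball 0 \<epsilon> \<Longrightarrow> moment_transform \<phi> (op_of r) (\<omega> z) = moment_transform \<phi> U z"
    and z: "z \<in> ball 0 \<epsilon> \<inter> slit_plane"
  shows "\<omega> z = \<omega>2 z"
proof -
  let ?M = "moment_transform \<phi> (op_of r)" and ?N = "moment_transform \<phi> U"
  have M0: "?M (of_real (- 0)) = 0"
  proof -
    have "(0 :: complex) *\<^sub>C op_of r = 0"
      using scaleC_cop.rep_eq[of 0 r] by (simp add: zero_cop.rep_eq)
    moreover have "\<phi> 0 = 0" using tr.tau_zero by (simp add: tr_def zero_cop.rep_eq)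
    ultimately show ?thesis by (simp add: moment_transform_def)
  qed
  \<comment> \<open>By monotonicity \<open>?M\<close> is below \<open>- \<eta>\<close> at every
    \<open>- t\<close> with \<open>t \<ge> \<delta>\<close>, so a value of \<open>?N\<close> of
    modulus less than \<open>\<eta>\<close> forces \<open>t < \<delta>\<close>, that is, into the
    ball where \<open>?M\<close> is injective.\<close>
  define \<eta> where "\<eta> = - Re (?M (of_real (- (\<delta> / 2))))"
  have \<eta>: "0 < \<eta>" using moment_transform_mono[OF r, of 0 "\<delta> / 2"] M0 \<delta>(1) by (simp add: \<eta>_def)
  have "isCont ?N 0"
    using holomorphic_on_imp_continuous_on[OF \<epsilon>(3)] \<epsilon>(1) by (simp add: continuous_on_eq_continuous_at)
  then obtain d where d: "0 < d" "\<And>z. dist z 0 < d \<Longrightarrow> dist (?N z) 0 < \<eta>"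
    using \<eta> unfolding continuous_at_eps_delta \<epsilon>(4) by blast
  define \<mu> where "\<mu> = min d \<epsilon>"
  have \<mu>: "0 < \<mu>" using d \<epsilon> by (simp add: \<mu>_def)
  have axis: "\<omega> (of_real x) = \<omega>2 (of_real x)" if x: "- \<mu> < x" "x < 0" for x
  proof -
    define t where "t = - Re (\<omega>2 (of_real x))"
    have t: "\<omega>2 (of_real x) = of_real (- t)" "0 \<le> t"
      using subordination_negative_axis[OF sub x(2)] by (auto simp: t_def complex_eq_iff)
    have xb: "of_real x \<in> ball (0 :: complex) \<epsilon>" using x by (simp add: \<mu>_def)
    have Nx: "?N (of_real x) = ?M (\<omega>2 (of_real x))"
    proof -
      have "\<forall>z\<in>slit_plane. ?N z = ?M (\<omega>2 z)"
        using sub unfolding subordination_functions_def by blast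
      then show ?thesis using x by (simp add: slit_plane_iff)
    qed
    have "t < \<delta>"
    proof (rule ccontr)
      assume "\<not> t < \<delta>"
      then have "Re (?M (of_real (- t))) < - \<eta>"
        using moment_transform_mono[OF r, of "\<delta> / 2" t] \<delta>(1) by (simp add: \<eta>_def)
      moreover have "cmod (?N (of_real x)) < \<eta>" using d(2)[of "of_real x"] x by (simp add: \<mu>_def)
      ultimately show False using abs_Re_le_cmod[of "?N (of_real x)"] Nx t(1) by simp
    qed
    then have "\<omega>2 (of_real x) \<in> ball 0 \<delta>" using t by simp
    moreover have "?M (\<omega> (of_real x)) = ?M (\<omega>2 (of_real x))" using \<epsilon>(6)[OF xb] Nx by simp
    ultimately show ?thesis using inj_onD[OF \<delta>(2) _ \<epsilon>(5)[OF xb]] by blast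
  qed
  \<comment> \<open>An interior point of the real interval on which both functions agree, hence an
    accumulation point for the identity theorem.\<close>
  define \<xi> where "\<xi> = complex_of_real (- \<mu> / 2)"
  have "(\<lambda>z. \<omega> z - \<omega>2 z) z = 0"
  proof (rule analytic_continuation[where f = "\<lambda>z. \<omega> z - \<omega>2 z" and S = "ball 0 \<epsilon> \<inter> slit_plane" and \<xi> = \<xi>
        and U = "complex_of_real ` {- \<mu> <..< 0}"])
    have "\<omega>2 holomorphic_on slit_plane" using sub by (simp add: subordination_functions_def)
    then show "(\<lambda>z. \<omega> z - \<omega>2 z) holomorphic_on ball 0 \<epsilon> \<inter> slit_plane"
      by (intro holomorphic_intros) (auto intro: holomorphic_on_subset \<epsilon>(2))
    show "open (ball 0 \<epsilon> \<inter> slit_plane)" by (intro open_Int open_ball open_slit_plane)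
    show "connected (ball 0 \<epsilon> \<inter> slit_plane)" by (rule connected_ball_slit_plane[OF \<epsilon>(1)])
    show "complex_of_real ` {- \<mu> <..< 0} \<subseteq> ball 0 \<epsilon> \<inter> slit_plane"
      by (auto simp: slit_plane_iff \<mu>_def)
    show "\<xi> \<in> ball 0 \<epsilon> \<inter> slit_plane" using \<mu> by (auto simp: \<xi>_def slit_plane_iff \<mu>_def)
    have "- \<mu> / 2 islimpt {- \<mu> <..< 0}"
      using \<mu> by (intro interior_limit_point) (simp add: interior_open)
    then show "\<xi> islimpt complex_of_real ` {- \<mu> <..< 0}"
      unfolding \<xi>_def
      by (intro islimpt_isCont_image)
         (auto simp: eventually_at_filter simp del: of_real_minus of_real_divide)
  qed (use axis z in auto)
  then show ?thesis by simp
qed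

section \<open>Diagonal extensions\<close>

text \<open>\<open>Lim\<close> has a determined value only along a nontrivial filter, so
  \<open>(z, z)\<close> is first shown to be a limit point of off-diagonal pairs. Any continuous
  \<open>f\<close> that matches \<open>F\<close> off the diagonal then supplies the value on
  it.\<close>

lemma diagonal_extension_eq:
  assumes D: "open D" and cont: "continuous_on (D \<times> D) f"
    and eq: "\<And>z w. z \<in> D \<Longrightarrow> w \<in> D \<Longrightarrow> z \<noteq> w \<Longrightarrow> F z w = f (z, w)"
    and zw: "z \<in> D" "w \<in> D"
  shows "diagonal_extension F z w = f (z, w)"
proof (cases "z = w")
  case True
  let ?S = "{p :: complex \<times> complex. fst p \<noteq> snd p}"
  have "(z, z) islimpt ?S"
    unfolding islimpt_sequential
  proof (intro exI[of _ "\<lambda>n. (z + of_real (inverse (real (Suc n))), z)"] conjI allI)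
    let ?f = "\<lambda>n. (z + of_real (inverse (real (Suc n))), z)"
    show "?f n \<in> ?S - {(z, z)}" for n by (simp add: of_real_eq_0_iff del: of_real_inverse of_nat_Suc)
    have "?f \<longlonglongrightarrow> (z + of_real 0, z)"
      by (intro tendsto_intros LIMSEQ_inverse_real_of_nat)
    then show "?f \<longlonglongrightarrow> (z, z)" by simp
  qed
  then have nt: "at (z, z) within ?S \<noteq> bot" by (simp add: trivial_limit_within)
  have "isCont f (z, z)"
    using cont D zw True by (simp add: continuous_on_eq_continuous_at open_Times)
  then have "(f \<longlongrightarrow> f (z, z)) (at (z, z) within ?S)"
    by (auto simp: isCont_def intro: tendsto_within_subset)
  moreover have "\<forall>\<^sub>F p in at (z, z) within ?S. f p = F (fst p) (snd p)"
    unfolding eventually_at_topological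
    by (intro exI[of _ "D \<times> D"]) (use D zw True eq in \<open>auto simp: open_Times\<close>)
  ultimately have "((\<lambda>p. F (fst p) (snd p)) \<longlongrightarrow> f (z, z)) (at (z, z) within ?S)"
    by (rule Lim_transform_eventually)
  then show ?thesis using tendsto_Lim[OF nt] True by (simp add: diagonal_extension_def)
qed (use eq zw in \<open>simp add: diagonal_extension_def\<close>)

theorem theorem4p1:
  fixes \<A> :: "('h::complex_hilbert \<Rightarrow>\<^sub>L 'h) set"
    and \<phi> :: "('h \<Rightarrow>\<^sub>L 'h) \<Rightarrow> complex"
    and R Y U G1 G2 :: "'h \<Rightarrow>\<^sub>L 'h"
    and \<omega>1 \<omega>2 :: "complex \<Rightarrow> complex"
  assumes space: "wstar_probability_space \<A> \<phi>"
    and R: "R \<in> \<A>" "selfadjoint_op R" "positive_op R" "R \<noteq> 0"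
    and Y: "Y \<in> \<A>" "selfadjoint_op Y" "positive_op Y" "Y \<noteq> 0"
    and free: "free_variables \<phi> R Y"
    and U: "U = op_sqrt R o\<^sub>L Y o\<^sub>L op_sqrt R"
    and G1: "G1 \<in> unital_subalgebra {R}"
    and G2: "G2 \<in> unital_subalgebra {R}"
    and subord: "subordination_functions \<phi> U Y R \<omega>1 \<omega>2"
  shows "\<exists>r>0. \<exists>\<omega>.
    \<comment> \<open>\<open>\<omega>\<close> is the analytic extension of \<open>\<omega>2\<close> to a neighbourhood of \<open>0\<close>\<close>
    \<omega> holomorphic_on ball 0 r \<and> \<omega> 0 = 0 \<and>
    (\<forall>z \<in> ball 0 r \<inter> slit_plane. \<omega> z = \<omega>2 z) \<and>
    (let D = ball (0::complex) r;
         M = moment_transform \<phi> U;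
         k = (\<lambda>z w. \<phi> (G1 o\<^sub>L res U z o\<^sub>L G2 o\<^sub>L res U w));
         k1 = (\<lambda>z w. \<phi> (G1 o\<^sub>L G2 o\<^sub>L res R (\<omega> z) o\<^sub>L res R (\<omega> w)));
         A1 = (\<lambda>z w. \<phi> (R o\<^sub>L G1 o\<^sub>L res R (\<omega> z) o\<^sub>L res R (\<omega> w)));
         A2 = (\<lambda>z w. \<phi> (R o\<^sub>L G2 o\<^sub>L res R (\<omega> z) o\<^sub>L res R (\<omega> w)));
         B = (\<lambda>z w. \<phi> (R o\<^sub>L res R (\<omega> z) o\<^sub>L res R (\<omega> w)));
         P = diagonal_extension (\<lambda>z w.
               ((w * \<omega> z - z * \<omega> w) * (\<omega> z - \<omega> w)) / ((M z - M w) * (z - w)));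
         Q = diagonal_extension (\<lambda>z w. (w * \<omega> z - z * \<omega> w) / (z - w));
         N = diagonal_extension (\<lambda>z w. (M z - M w) / (\<omega> z - \<omega> w));
         k2 = (\<lambda>z w. P z w * A1 z w * A2 z w)
     in
       \<comment> \<open>all inverses and quotients are well defined\<close>
       (\<forall>z \<in> D. op_invertible (id_blinfun - z *\<^sub>C U) \<and>
                op_invertible (id_blinfun - \<omega> z *\<^sub>C R)) \<and>
       (\<forall>z \<in> D. \<forall>w \<in> D. z \<noteq> w \<longrightarrow> M z \<noteq> M w \<and> \<omega> z \<noteq> \<omega> w) \<and>
       (\<forall>z \<in> D. \<forall>w \<in> D. B z w \<noteq> 0) \<and>
       continuous_on (D \<times> D) (\<lambda>(z, w). P z w) \<and>
       continuous_on (D \<times> D) (\<lambda>(z, w). Q z w) \<and>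
       continuous_on (D \<times> D) (\<lambda>(z, w). N z w) \<and>
       (\<forall>z \<in> D. \<forall>w \<in> D.
          k z w = k1 z w + k2 z w \<and>
          k2 z w = Q z w * (A1 z w * A2 z w / B z w) \<and>
          B z w = N z w))"
proof -
  interpret wstar_probability_space \<A> \<phi> by (rule space)
  obtain r where r: "R = op_of r" "r \<in> alg" by (rule cop_of_A[OF R(1)])
  obtain y where y: "Y = op_of y" "y \<in> alg" by (rule cop_of_A[OF Y(1)])
  have pr: "pos r" "r \<noteq> 0" using R(3,4) unfolding pos_def r(1) by (auto simp: zero_cop.rep_eq)
  have py: "pos y" "y \<noteq> 0" using Y(3,4) unfolding pos_def y(1) by (auto simp: zero_cop.rep_eq)
  obtain s where s: "op_sqrt (op_of r) = op_of s" "s * s = r" "\<forall>b. b * r = r * b \<longrightarrow> b * s = s * b"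
    "\<forall>A. closed_subalgebra A \<and> r \<in> A \<longrightarrow> s \<in> A"
    by (rule op_sqrt_exists[OF pr(1)])
  have sA: "s \<in> alg" using s(4) closed_subalgebra_alg r(2) by blast
  define u where "u = s * y * s"
  have u: "U = op_of u" by (simp only: U r(1) y(1) s(1) u_def times_cop.rep_eq)
  let ?AR = "closure (generated r)" and ?AY = "closure (generated y)"
  \<comment> \<open>The closures replace the polynomial algebras because resolvents must lie in
    \<open>?AR\<close> and \<open>?AY\<close>; \<open>G1\<close> and \<open>G2\<close> are covered,
    being polynomials in \<open>R\<close>.\<close>
  interpret F: free_pair_sqrt alg tr 2 ?AR ?AY r y s
  proof (intro free_pair_sqrt.intro free_pair.intro free_pair_sqrt_axioms.intro free_pair_axioms.intro)
    show "tracial_algebra alg tr 2" by (rule tr.tracial_algebra_axioms)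
    show "closed_subalgebra ?AR" "closed_subalgebra ?AY" by (rule closed_subalgebra_generated)+
    show "?AR \<subseteq> alg" "?AY \<subseteq> alg"
      by (intro closure_generated_least[OF closed_subalgebra_alg] r(2) y(2))+
    show "r \<in> ?AR" "y \<in> ?AY" by (rule closure_generated_self)+
    have "a * r = r * a" if "a \<in> ?AR" for a
      by (rule closure_generated_commute[OF refl that])
    then show "a * b = b * a" if "a \<in> ?AR" "b \<in> ?AR" for a b
      using closure_generated_commute[of b r a] that by simp
    show "tr (prod_list (map snd xs)) = 0"
      if "xs \<noteq> []" "\<forall>(i, a) \<in> set xs. a \<in> (if i then ?AR else ?AY) \<and> tr a = 0"
        "distinct_adj (map fst xs)" for xs
      by (rule tr_free[OF free[unfolded r(1) y(1)] r(2) y(2) that])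
    show "a * s = s * a" if "a \<in> ?AR" for a
      using s(3)[rule_format, OF closure_generated_commute[OF refl that]] .
    show "tr r \<noteq> 0" using tr_faithful[OF r(2) pr(1)] pr(2) by blast
    show "tr y \<noteq> 0" using tr_faithful[OF y(2) py(1)] py(2) by blast
  qed (rule sA s(2))+
  obtain \<delta> \<epsilon> \<omega> Q where loc: "0 < \<delta>" "0 < \<epsilon>" "inj_on (tr.mom r) (ball 0 \<delta>)"
    "\<omega> holomorphic_on ball 0 \<epsilon>" "\<omega> 0 = 0" "tr.mom (s * y * s) holomorphic_on ball 0 \<epsilon>"
    "\<forall>z\<in>ball 0 \<epsilon>. \<omega> z \<in> ball 0 \<delta>"
    "\<forall>z\<in>ball 0 \<epsilon>. tr.mom r (\<omega> z) = tr.mom (s * y * s) z"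
    "\<forall>z\<in>ball 0 \<epsilon>. cmod z * norm (s * y * s) \<le> 1 / 2"
    "\<forall>z\<in>ball 0 \<epsilon>. cmod (\<omega> z) * norm r \<le> 1 / 2"
    "\<forall>z\<in>ball 0 \<epsilon>. \<forall>w\<in>ball 0 \<epsilon>. tr (r * rs r (\<omega> z) * rs r (\<omega> w)) \<noteq> 0"
    "inj_on (tr.mom (s * y * s)) (ball 0 \<epsilon>)"
    "continuous_on (ball 0 \<epsilon> \<times> ball 0 \<epsilon>) Q"
    "\<forall>z\<in>ball 0 \<epsilon>. \<forall>w\<in>ball 0 \<epsilon>. z \<noteq> w \<longrightarrow> Q (z, w) = (w * \<omega> z - z * \<omega> w) / (z - w)"
    "continuous_on (ball 0 \<epsilon> \<times> ball 0 \<epsilon>) (\<lambda>p. tr (r * rs r (\<omega> (fst p)) * rs r (\<omega> (snd p))))"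
    "\<forall>z\<in>ball 0 \<epsilon>. \<forall>w\<in>ball 0 \<epsilon>. \<forall>g1\<in>?AR. \<forall>g2\<in>?AR.
      tr (g1 * rs (s * y * s) z * g2 * rs (s * y * s) w) =
      tr (g1 * g2 * rs r (\<omega> z) * rs r (\<omega> w)) +
      Q (z, w) * (tr (r * g1 * rs r (\<omega> z) * rs r (\<omega> w)) * tr (r * g2 * rs r (\<omega> z) * rs r (\<omega> w)) /
        tr (r * rs r (\<omega> z) * rs r (\<omega> w)))"
    "\<forall>z\<in>ball 0 \<delta>. cmod z * norm r \<le> 1 / 2"
    by (rule F.two_point_formula)
  note loc = loc[folded u_def, rule_format]
  let ?D = "ball (0 :: complex) \<epsilon>"
  obtain g1 where g1: "G1 = op_of g1" "g1 \<in> ?AR"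
    using unital_subalgebra_least[OF G1[unfolded r(1)] closed_subalgebra_generated closure_generated_self] by blast
  obtain g2 where g2: "G2 = op_of g2" "g2 \<in> ?AR"
    using unital_subalgebra_least[OF G2[unfolded r(1)] closed_subalgebra_generated closure_generated_self] by blast
  have small_u: "cmod z * norm u < 1" if "z \<in> ?D" for z using loc(9)[OF that] by simp
  have small_r: "cmod z * norm r < 1" if "z \<in> ball 0 \<delta>" for z using loc(17)[OF that] by simp
  have small_\<omega>: "cmod (\<omega> z) * norm r < 1" if "z \<in> ?D" for z using loc(10)[OF that] by simp
  have resU: "res U z = op_of (rs u z)" "op_invertible (id_blinfun - z *\<^sub>C U)" if "z \<in> ?D" for z
    unfolding u using rs_inverse_left[OF small_u[OF that]] rs_inverse_right[OF small_u[OF that]]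
    by (intro res_eq; simp)+
  have resR: "res R (\<omega> z) = op_of (rs r (\<omega> z))" "op_invertible (id_blinfun - \<omega> z *\<^sub>C R)" if "z \<in> ?D" for z
    unfolding r(1) using rs_inverse_left[OF small_\<omega>[OF that]] rs_inverse_right[OF small_\<omega>[OF that]]
    by (intro res_eq; simp)+
  have momU: "moment_transform \<phi> U z = tr.mom u z" if "z \<in> ?D" for z
    unfolding u tr.mom_def
    by (rule moment_transform_eq[OF rs_inverse_right[OF small_u[OF that]] rs_inverse_left[OF small_u[OF that]]])
  have momR: "moment_transform \<phi> R z = tr.mom r z" if "z \<in> ball 0 \<delta>" for z
    unfolding r(1) tr.mom_def
    by (rule moment_transform_eq[OF rs_inverse_right[OF small_r[OF that]] rs_inverse_left[OF small_r[OF that]]])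
  define B where "B p = tr (r * rs r (\<omega> (fst p)) * rs r (\<omega> (snd p)))" for p
  define A1 where "A1 z w = tr (r * g1 * rs r (\<omega> z) * rs r (\<omega> w))" for z w
  define A2 where "A2 z w = tr (r * g2 * rs r (\<omega> z) * rs r (\<omega> w))" for z w
  have cB: "continuous_on (?D \<times> ?D) B" unfolding B_def by (rule loc(15))
  have B0: "B (z, w) \<noteq> 0" if "z \<in> ?D" "w \<in> ?D" for z w using loc(11)[OF that] by (simp add: B_def)
  have M_neq: "tr.mom u z \<noteq> tr.mom u w" if "z \<in> ?D" "w \<in> ?D" "z \<noteq> w" for z w
    using inj_onD[OF loc(12) _ that(1,2)] that(3) by blast
  \<comment> \<open>Equal values of \<open>\<omega>\<close> would give equal values of the injective
    \<open>tr.mom u\<close>. So the denominators in \<open>?P\<close> and \<open>?N\<close> do not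
    vanish off the diagonal.\<close>
  have \<omega>_neq: "\<omega> z \<noteq> \<omega> w" if "z \<in> ?D" "w \<in> ?D" "z \<noteq> w" for z w
    using M_neq[OF that] loc(8)[OF that(1)] loc(8)[OF that(2)] by auto
  have M_diff: "tr.mom u z - tr.mom u w = (\<omega> z - \<omega> w) * B (z, w)" if "z \<in> ?D" "w \<in> ?D" for z w
    using tr.mom_diff[OF r(2) small_\<omega>[OF that(1)] small_\<omega>[OF that(2)]] loc(8)[OF that(1)] loc(8)[OF that(2)]
    by (simp add: B_def)
  let ?M = "moment_transform \<phi> U"
  let ?P = "diagonal_extension (\<lambda>z w.
               ((w * \<omega> z - z * \<omega> w) * (\<omega> z - \<omega> w)) / ((?M z - ?M w) * (z - w)))"
  let ?Q = "diagonal_extension (\<lambda>z w. (w * \<omega> z - z * \<omega> w) / (z - w))"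
  let ?N = "diagonal_extension (\<lambda>z w. (?M z - ?M w) / (\<omega> z - \<omega> w))"
  have Q: "?Q z w = Q (z, w)" if "z \<in> ?D" "w \<in> ?D" for z w
    by (rule diagonal_extension_eq[OF open_ball loc(13) _ that]) (simp add: loc(14))
  have N: "?N z w = B (z, w)" if "z \<in> ?D" "w \<in> ?D" for z w
    by (rule diagonal_extension_eq[OF open_ball cB _ that]) (simp add: momU M_diff \<omega>_neq)
  have cP: "continuous_on (?D \<times> ?D) (\<lambda>p. Q p / B p)"
    by (intro continuous_on_divide loc(13) cB) (use B0 in auto)
  \<comment> \<open>The factor \<open>\<omega> z - \<omega> w\<close> cancels against
    \<open>M_diff\<close>, leaving the quotient of the continuous \<open>Q\<close> by the zero-free
    \<open>B\<close>.\<close>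
  have P: "?P z w = Q (z, w) / B (z, w)" if "z \<in> ?D" "w \<in> ?D" for z w
  proof (rule diagonal_extension_eq[OF open_ball cP _ that])
    fix z w assume zw: "z \<in> ?D" "w \<in> ?D" "z \<noteq> w"
    show "((w * \<omega> z - z * \<omega> w) * (\<omega> z - \<omega> w)) / ((?M z - ?M w) * (z - w)) = Q (z, w) / B (z, w)"
      using zw \<omega>_neq[OF zw] B0[OF zw(1,2)]
      by (simp add: momU M_diff loc(14))
  qed
  have split: "continuous_on (?D \<times> ?D) (\<lambda>(z, w). f z w)"
    if "continuous_on (?D \<times> ?D) h" "\<And>z w. z \<in> ?D \<Longrightarrow> w \<in> ?D \<Longrightarrow> f z w = h (z, w)"
    for f :: "complex \<Rightarrow> complex \<Rightarrow> complex" and h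
    using that(1) by (rule continuous_on_eq) (use that(2) in auto)
  have word: "\<phi> (op_of a o\<^sub>L op_of b o\<^sub>L op_of c o\<^sub>L op_of d) = tr (a * b * c * d)"
    "\<phi> (op_of a o\<^sub>L op_of b o\<^sub>L op_of c) = tr (a * b * c)" for a b c d
    by (simp_all add: tr_def times_cop.rep_eq)
  have k: "\<phi> (G1 o\<^sub>L res U z o\<^sub>L G2 o\<^sub>L res U w) = tr (g1 * rs u z * g2 * rs u w)"
    "\<phi> (G1 o\<^sub>L G2 o\<^sub>L res R (\<omega> z) o\<^sub>L res R (\<omega> w)) = tr (g1 * g2 * rs r (\<omega> z) * rs r (\<omega> w))"
    "\<phi> (R o\<^sub>L G1 o\<^sub>L res R (\<omega> z) o\<^sub>L res R (\<omega> w)) = A1 z w"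
    "\<phi> (R o\<^sub>L G2 o\<^sub>L res R (\<omega> z) o\<^sub>L res R (\<omega> w)) = A2 z w"
    "\<phi> (R o\<^sub>L res R (\<omega> z) o\<^sub>L res R (\<omega> w)) = B (z, w)"
    if "z \<in> ?D" "w \<in> ?D" for z w
    by (simp_all only: resU(1)[OF that(1)] resU(1)[OF that(2)] resR(1)[OF that(1), unfolded r(1)] resR(1)[OF that(2), unfolded r(1)]
        g1(1) g2(1) r(1) word A1_def A2_def B_def fst_conv snd_conv)
  have formula: "tr (g1 * rs u z * g2 * rs u w) =
      tr (g1 * g2 * rs r (\<omega> z) * rs r (\<omega> w)) + Q (z, w) * (A1 z w * A2 z w / B (z, w))"
    if "z \<in> ?D" "w \<in> ?D" for z w
    using loc(16)[OF that g1(2) g2(2)] by (simp add: A1_def A2_def B_def)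
  have ext: "\<omega> z = \<omega>2 z" if "z \<in> ?D \<inter> slit_plane" for z
  proof (rule subordination_near_zero[OF r(2) pr subord[unfolded r(1)] loc(1) _ loc(2,4) _ _ loc(7) _ that])
    show "inj_on (moment_transform \<phi> (op_of r)) (ball 0 \<delta>)"
      using loc(3) momR by (simp add: inj_on_def r(1))
    show "?M holomorphic_on ?D"
      by (rule holomorphic_transform[OF loc(6)]) (simp add: momU)
    show "?M 0 = 0" using momU[of 0] loc(2) by simp
    show "moment_transform \<phi> (op_of r) (\<omega> z) = ?M z" if "z \<in> ?D" for z
      using momR[OF loc(7)[OF that]] loc(8)[OF that] momU[OF that] by (simp add: r(1))
  qed
  show ?thesis
    unfolding Let_def
  proof (intro exI[of _ \<epsilon>] exI[of _ \<omega>] conjI ballI impI)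
    show "continuous_on (?D \<times> ?D) (\<lambda>(z, w). ?P z w)" by (rule split[OF cP P])
    show "continuous_on (?D \<times> ?D) (\<lambda>(z, w). ?Q z w)" by (rule split[OF loc(13) Q])
    show "continuous_on (?D \<times> ?D) (\<lambda>(z, w). ?N z w)" by (rule split[OF cB N])
    fix z w assume zw: "z \<in> ?D" "w \<in> ?D"
    note kzw = k[OF zw]
    show "?M z \<noteq> ?M w" if "z \<noteq> w" using M_neq[OF zw that] by (simp only: momU[OF zw(1)] momU[OF zw(2)] not_False_eq_True)
    show "\<omega> z \<noteq> \<omega> w" if "z \<noteq> w" by (rule \<omega>_neq[OF zw that])
    show "\<phi> (R o\<^sub>L res R (\<omega> z) o\<^sub>L res R (\<omega> w)) \<noteq> 0" using kzw(5) B0[OF zw] by simp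
    show "\<phi> (G1 o\<^sub>L res U z o\<^sub>L G2 o\<^sub>L res U w) =
        \<phi> (G1 o\<^sub>L G2 o\<^sub>L res R (\<omega> z) o\<^sub>L res R (\<omega> w)) +
        ?P z w * \<phi> (R o\<^sub>L G1 o\<^sub>L res R (\<omega> z) o\<^sub>L res R (\<omega> w)) *
          \<phi> (R o\<^sub>L G2 o\<^sub>L res R (\<omega> z) o\<^sub>L res R (\<omega> w))"
      unfolding kzw P[OF zw] formula[OF zw] by simp
    show "?P z w * \<phi> (R o\<^sub>L G1 o\<^sub>L res R (\<omega> z) o\<^sub>L res R (\<omega> w)) *
          \<phi> (R o\<^sub>L G2 o\<^sub>L res R (\<omega> z) o\<^sub>L res R (\<omega> w)) =
        ?Q z w * (\<phi> (R o\<^sub>L G1 o\<^sub>L res R (\<omega> z) o\<^sub>L res R (\<omega> w)) *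
          \<phi> (R o\<^sub>L G2 o\<^sub>L res R (\<omega> z) o\<^sub>L res R (\<omega> w)) / \<phi> (R o\<^sub>L res R (\<omega> z) o\<^sub>L res R (\<omega> w)))"
      unfolding kzw P[OF zw] Q[OF zw] by simp
    show "\<phi> (R o\<^sub>L res R (\<omega> z) o\<^sub>L res R (\<omega> w)) = ?N z w" unfolding kzw N[OF zw] ..
  qed (use loc resU resR ext in auto)
qed

end
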